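(* Let $E$ be a countable Borel equivalence relation on $\mathcal{E}_\infty$. Then there exists a Ramsey conull set $\mathcal{D}\subseteq\mathcal{E}_\infty$ such that for all $B\in\mathcal{D}$ and all $A,A'\in\mathcal{E}_\infty$ with $A,A'\le B$, $$A\;E\;A'\iff A=A'.$$ In particular, $\mathcal{I}(\mathcal{E}_\infty)$ canonizes every countable Borel equivalence relation on $\mathcal{E}_\infty$ to $(2^{\mathbb{N}},=)$.
   Context: $\mathcal{E}_\infty$ is the set of all equivalence relations on $\mathbb{N}=\{0,1,2,\ldots\}$ with infinitely many classes. For $A,B\in\mathcal{E}_\infty$ write $A\le B$ if every $A$-class is a union of $B$-classes. $\mathcal{E}_\infty$ carries the Polish topology inherited from $2^{\mathbb{N}\times\mathbb{N}}$ (viewing an equivalence relation as a subset of $\mathbb{N}\times\mathbb{N}$), and "Borel" refers to this topology. A countable Borel equivalence relation on $\mathcal{E}_\infty$ is an equivalence relation that is Borel as a subset of $\mathcal{E}_\infty\times\mathcal{E}_\infty$ and all of whose classes are countable. For $m\in\mathbb{N}$ and $B\in\mathcal{E}_\infty$, $[m,B]_\infty$ is the set of all $A\in\mathcal{E}_\infty$ with $A\le B$ such that $A$ and $B$ have the same restriction to $\{0,\ldots,m-1\}$. $\mathcal{I}(\mathcal{E}_\infty)$ is the $\sigma$-ideal of all $\mathcal{X}\subseteq\mathcal{E}_\infty$ such that for every $B\in\mathcal{E}_\infty$ and $m\in\mathbb{N}$ there is $B'\in[m,B]_\infty$ with $[m,B']_\infty\cap\mathcal{X}=\emptyset$. A set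 $\mathcal{D}\subseteq\mathcal{E}_\infty$ is Ramsey conull if $\mathcal{E}_\infty\setminus\mathcal{D}\in\mathcal{I}(\mathcal{E}_\infty)$. For equivalence relations $E$ on $X$ and $F$ on $Y$, $E\le_B F$ means there is a Borel map $f:X\to Y$ with $x\,E\,x'\iff f(x)\,F\,f(x')$ for all $x,x'\in X$. A $\sigma$-ideal $\mathcal{I}$ on a Polish space $X$ canonizes an equivalence relation $E$ on $X$ to $F\le_B E$ if for every Borel $\mathcal{B}\subseteq X$ with $\mathcal{B}\notin\mathcal{I}$ there is a Borel $\mathcal{C}\subseteq\mathcal{B}$ with $\mathcal{C}\notin\mathcal{I}$ such that $E\upharpoonright\mathcal{C}\le_B F$. *)

theory Defs
  imports "HOL-Analysis.Analysis"
begin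

text \<open>
  A binary relation on \<open>\<nat>\<close> is represented by its (curried) characteristic function, an element of
  the type \<open>nat \<Rightarrow> nat \<Rightarrow> bool\<close>. The topology of this type in the library is the iterated product
  topology over the discrete space \<open>bool\<close>, that is, the topology of $2^{N \times N}$. Subsets \<open>X\<close>
  of a topological space carry the subspace topology; their Borel sets are those of
  \<open>restrict_space borel X\<close>.
\<close>

definition classes :: "(nat \<Rightarrow> nat \<Rightarrow> bool) \<Rightarrow> nat set set" where
  "classes A = UNIV // {(x, y). A x y}"

definition Einf :: "(nat \<Rightarrow> nat \<Rightarrow> bool) set" where
  "Einf = {A. equivp A \<and> infinite (classes A)}"

text \<open>
  The relation written $A \le B$ in the mathematics. It is the reverse of the pointwise order
  \<open>A \<le> B\<close> of the library on \<open>nat \<Rightarrow> nat \<Rightarrow> bool\<close>, hence the separate name.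
\<close>

definition coarsens :: "(nat \<Rightarrow> nat \<Rightarrow> bool) \<Rightarrow> (nat \<Rightarrow> nat \<Rightarrow> bool) \<Rightarrow> bool" where
  "coarsens A B \<longleftrightarrow> (\<forall>C \<in> classes A. \<exists>S. S \<subseteq> classes B \<and> C = \<Union>S)"

definition basic_nbhd :: "nat \<Rightarrow> (nat \<Rightarrow> nat \<Rightarrow> bool) \<Rightarrow> (nat \<Rightarrow> nat \<Rightarrow> bool) set" where
  "basic_nbhd m B = {A \<in> Einf. coarsens A B \<and> (\<forall>i<m. \<forall>j<m. A i j \<longleftrightarrow> B i j)}"

definition Ramsey_ideal :: "(nat \<Rightarrow> nat \<Rightarrow> bool) set set" where
  "Ramsey_ideal = {X. X \<subseteq> Einf \<and>
     (\<forall>B \<in> Einf. \<forall>m. \<exists>B' \<in> basic_nbhd m B. basic_nbhd m B' \<inter> X = {})}"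

definition Ramsey_conull :: "(nat \<Rightarrow> nat \<Rightarrow> bool) set \<Rightarrow> bool" where
  "Ramsey_conull D \<longleftrightarrow> D \<subseteq> Einf \<and> Einf - D \<in> Ramsey_ideal"

definition countable_borel_equiv :: "'a::topological_space set \<Rightarrow> 'a rel \<Rightarrow> bool" where
  "countable_borel_equiv X E \<longleftrightarrow>
     equiv X E \<and> E \<in> sets (restrict_space borel (X \<times> X)) \<and> (\<forall>C \<in> X // E. countable C)"

definition borel_reducible ::
  "'a::topological_space set \<Rightarrow> 'a rel \<Rightarrow> 'b::topological_space set \<Rightarrow> 'b rel \<Rightarrow> bool" where
  "borel_reducible X E Y F \<longleftrightarrow>
     (\<exists>f \<in> restrict_space borel X \<rightarrow>\<^sub>M restrict_space borel Y.
        \<forall>x \<in> X. \<forall>x' \<in> X. (x, x') \<in> E \<longleftrightarrow> (f x, f x') \<in> F)"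

definition sigma_ideal_on :: "'a set \<Rightarrow> 'a set set \<Rightarrow> bool" where
  "sigma_ideal_on X I \<longleftrightarrow>
     I \<subseteq> Pow X \<and> {} \<in> I \<and> (\<forall>S \<in> I. \<forall>T. T \<subseteq> S \<longrightarrow> T \<in> I) \<and>
     (\<forall>S :: nat \<Rightarrow> 'a set. range S \<subseteq> I \<longrightarrow> (\<Union>n. S n) \<in> I)"

text \<open>
  The \<open>\<sigma>\<close>-ideal \<open>I\<close> on \<open>X\<close> canonizes \<open>E\<close> (on \<open>X\<close>) to \<open>F\<close> (on \<open>Y\<close>). The requirements that \<open>I\<close> be a
  \<open>\<sigma>\<close>-ideal, that \<open>E\<close> and \<open>F\<close> be equivalence relations, and that \<open>F\<close> be Borel reducible to \<open>E\<close>
  are part of the notion.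
\<close>

definition canonizes ::
  "'a::topological_space set \<Rightarrow> 'a set set \<Rightarrow> 'a rel \<Rightarrow> 'b::topological_space set \<Rightarrow> 'b rel \<Rightarrow> bool"
where
  "canonizes X I E Y F \<longleftrightarrow>
     sigma_ideal_on X I \<and> equiv X E \<and> equiv Y F \<and> borel_reducible Y F X E \<and>
     (\<forall>B \<in> sets (restrict_space borel X). B \<notin> I \<longrightarrow>
        (\<exists>C \<in> sets (restrict_space borel X). C \<subseteq> B \<and> C \<notin> I \<and>
           borel_reducible C (E \<inter> C \<times> C) Y F))"

end

theory Submission
  imports Defs
begin

text \<open>
  The Carlson--Simpson theorem is the pigeonhole principle of the space of coarsenings; it is derived
  from an ultrafilter \<open>y\<close> on words starting with a variable whose substitution instances are idempotents
  of one minimal left ideal, and combined with fusion it yields the Ramsey property of open sets.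

  Write \<open>E\<close> as the projection of a closed set \<open>F\<close>, and cut \<open>E\<close> into pieces by prescribing finite parts of
  \<open>A'\<close> and of the witness. Call a relation negligible if every \<open>B\<close> can be shrunk so that \<open>A \<le> A'\<close>
  pointwise for all related coarsenings \<open>A\<close>, \<open>A'\<close> of \<open>B\<close>. A relation whose second component is read
  continuously from the first is negligible, because a new class of \<open>B\<close> can be
  moved without \<open>A\<close> noticing. If \<open>E\<close> is not negligible, some piece is hereditarily not negligible; such a
  piece splits into two, since otherwise \<open>A'\<close> would be read continuously from \<open>A\<close>, and a perfect tree of
  such pieces produces an uncountable class. Hence \<open>E\<close> is negligible, and by symmetry related
  coarsenings of a suitable \<open>B\<close> are equal.
\<close>

section \<open>Idempotent ultrafilters\<close>

text \<open>Only open sets are shown to be Ramsey, never analytic ones. Being small, or bad, at some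
  height is an open condition on the first component for each piece, so open sets suffice; the rest
  of the complexity of \<open>E\<close> is absorbed by the closure of negligible relations under
  countable unions.

  The proof aims at one inclusion at a time because of what a moved class can detect. A class of
  \<open>B\<close> may be attached to \<open>x\<close> or to \<open>y\<close> without
  \<open>A\<close> noticing exactly because \<open>A\<close> already joins \<open>x\<close> to
  \<open>y\<close>; the conclusion is that \<open>A'\<close> must join them as well. Nothing is
  learnt about points that \<open>A\<close> separates.

  The ideal is defined by neighbourhoods, which fix a finite trace, whereas the theorem speaks of
  all coarsenings of \<open>B\<close>. A finite trace admits only finitely many patterns, and
  shrinking a coarsening with one pattern can be carried back to \<open>B\<close> without changing
  the trace of \<open>B\<close>; every passage from neighbourhoods to all coarsenings rests on this.

  Pieces confine the first component to a neighbourhood and the second only through a finite code.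
  In the tree all branches share the first component, which is the limit of one fusion, and differ
  in the second.\<close>

lemma open_coordinate: "open U \<Longrightarrow> open {h :: 'a \<Rightarrow> 'b::topological_space. h i \<in> U}"
  using open_vimage[OF _ continuous_on_product_coordinates, of U i] by (simp add: vimage_def)

instance "fun" :: (type, t0_space) t0_space
proof
  fix f g :: "'a \<Rightarrow> 'b"
  assume "f \<noteq> g"
  then obtain i where "f i \<noteq> g i"
    by auto
  then obtain U where "open U" "\<not> (f i \<in> U \<longleftrightarrow> g i \<in> U)"
    by (auto dest: t0_space_class.t0_space)
  then show "\<exists>U. open U \<and> \<not> (f \<in> U \<longleftrightarrow> g \<in> U)"
    by (intro exI[of _ "{h. h i \<in> U}"]) (auto simp: open_coordinate)
qed

instance "fun" :: (type, t1_space) t1_space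
proof
  fix f g :: "'a \<Rightarrow> 'b"
  assume "f \<noteq> g"
  then obtain i where "f i \<noteq> g i"
    by auto
  then obtain U where "open U" "f i \<in> U" "g i \<notin> U"
    by (auto dest: t1_space_class.t1_space)
  then show "\<exists>U. open U \<and> f \<in> U \<and> g \<notin> U"
    by (intro exI[of _ "{h. h i \<in> U}"]) (auto simp: open_coordinate)
qed

instance "fun" :: (type, t2_space) t2_space
proof
  fix f g :: "'a \<Rightarrow> 'b"
  assume "f \<noteq> g"
  then obtain i where "f i \<noteq> g i"
    by auto
  then obtain U V where UV: "open U" "open V" "f i \<in> U" "g i \<in> V" "U \<inter> V = {}"
    using hausdorff[of "f i" "g i"] by auto
  show "\<exists>U V. open U \<and> open V \<and> f \<in> U \<and> g \<in> V \<and> U \<inter> V = {}"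
    using UV by (intro exI[of _ "{h. h i \<in> U}"] exI[of _ "{h. h i \<in> V}"]) (auto simp: open_coordinate)
qed

text \<open>Zorn's lemma is applied to complements, as it delivers maximal sets; compactness keeps
  the intersection of a chain nonempty. \<open>P\<close> is left open because two kinds of minimal
  objects are needed: compact subsemigroups and compact left ideals.\<close>

lemma minimal_compact_set:
  fixes K :: "'a::t2_space set"
  assumes K: "compact K" "K \<noteq> {}" "P K"
    and Int: "\<And>\<D>. \<D> \<noteq> {} \<Longrightarrow> (\<And>D. D \<in> \<D> \<Longrightarrow> P D) \<Longrightarrow> P (\<Inter>\<D>)"
  shows "\<exists>M\<subseteq>K. compact M \<and> M \<noteq> {} \<and> P M \<and>
    (\<forall>N\<subseteq>M. compact N \<longrightarrow> N \<noteq> {} \<longrightarrow> P N \<longrightarrow> N = M)"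
proof -
  define \<A> where "\<A> = {D. D \<subseteq> K \<and> compact D \<and> D \<noteq> {} \<and> P D}"
  have "\<exists>U\<in>uminus ` \<A>. \<forall>X\<in>\<C>. X \<subseteq> U" if \<C>: "\<C> \<in> chains (uminus ` \<A>)" for \<C>
  proof (cases "\<C> = {}")
    case True
    then show ?thesis
      using K by (auto simp: \<A>_def)
  next
    case False
    define \<D> where "\<D> = uminus ` \<C>"
    have \<D>: "\<D> \<noteq> {}" "\<D> \<subseteq> \<A>"
      using False \<C> by (auto simp: \<D>_def chains_def)
    have chain: "X \<subseteq> Y \<or> Y \<subseteq> X" if "X \<in> \<D>" "Y \<in> \<D>" for X Y
      using that \<C> unfolding \<D>_def chains_def chain_subset_def by blast
    have "K \<inter> \<Inter>\<D> \<noteq> {}"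
    proof (rule compact_imp_fip[OF K(1)])
      show "closed T" if "T \<in> \<D>" for T
        using that \<D> by (auto simp: \<A>_def intro: compact_imp_closed)
      fix F assume F: "finite F" "F \<subseteq> \<D>"
      show "K \<inter> \<Inter>F \<noteq> {}"
      proof (cases "F = {}")
        case True
        then show ?thesis using K by simp
      next
        case False
        have "subset.chain \<D> F"
          using F chain unfolding subset_chain_def by blast
        then have "\<Inter>F \<in> F"
          using Inter_in_chain[OF F(1) False] by blast
        then have "\<Inter>F \<in> \<A>"
          using F \<D> by blast
        then show ?thesis
          by (auto simp: \<A>_def)
      qed
    qed
    moreover have "compact (\<Inter>\<D>)"
    proof -
      obtain D where "D \<in> \<D>"
        using \<D> by blast
      then have "\<Inter>\<D> = D \<inter> \<Inter>\<D>" "compact D"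
        using \<D> by (auto simp: \<A>_def)
      moreover have "closed (\<Inter>\<D>)"
        using \<D> by (intro closed_Inter) (auto simp: \<A>_def intro: compact_imp_closed)
      ultimately show ?thesis
        by (metis compact_Int_closed)
    qed
    moreover have "P (\<Inter>\<D>)"
      using \<D> by (intro Int) (auto simp: \<A>_def)
    moreover have "\<Inter>\<D> \<subseteq> K"
      using \<D> by (auto simp: \<A>_def)
    ultimately have "\<Inter>\<D> \<in> \<A>"
      unfolding \<A>_def by blast
    then have "- \<Inter>\<D> \<in> uminus ` \<A>"
      by blast
    moreover have "X \<subseteq> - \<Inter>\<D>" if "X \<in> \<C>" for X
      using that unfolding \<D>_def by blast
    ultimately show ?thesis by blast
  qed
  then obtain M where M: "M \<in> \<A>" "\<forall>X\<in>uminus ` \<A>. - M \<subseteq> X \<longrightarrow> X = - M"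
    using Zorn_Lemma2[of "uminus ` \<A>"] by auto
  have "N = M" if "N \<subseteq> M" "compact N" "N \<noteq> {}" "P N" for N
  proof -
    have "N \<in> \<A>"
      using that M by (auto simp: \<A>_def)
    then have "- N = - M"
      using M(2) that(1) by blast
    then show ?thesis by blast
  qed
  with M show ?thesis
    unfolding \<A>_def by auto
qed

text \<open>The Ellis--Numakura lemma. If \<open>M\<close> is a minimal compact subsemigroup and
  \<open>e\<close> lies in it, the translate of \<open>M\<close> by \<open>e\<close> is all of
  \<open>M\<close> and so contains \<open>e\<close>. Hence the \<open>x\<close> with
  \<open>x \<odot> e = e\<close> form a nonempty compact subsemigroup, which is again
  \<open>M\<close> and contains \<open>e\<close>.\<close>

lemma compact_semigroup_idempotent:
  fixes K :: "'a::t2_space set" and mult :: "'a \<Rightarrow> 'a \<Rightarrow> 'a" (infixl "\<odot>" 70)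
  assumes K: "compact K" "K \<noteq> {}"
    and closed: "\<And>x y. x \<in> K \<Longrightarrow> y \<in> K \<Longrightarrow> x \<odot> y \<in> K"
    and assoc: "\<And>x y z. x \<odot> y \<odot> z = x \<odot> (y \<odot> z)"
    and cont: "\<And>y. continuous_on UNIV (\<lambda>x. x \<odot> y)"
  obtains e where "e \<in> K" "e \<odot> e = e"
proof -
  define P where "P D \<longleftrightarrow> (\<forall>x\<in>D. \<forall>y\<in>D. x \<odot> y \<in> D)" for D
  obtain M where M: "M \<subseteq> K" "compact M" "M \<noteq> {}" "P M"
    and min: "\<And>N. N \<subseteq> M \<Longrightarrow> compact N \<Longrightarrow> N \<noteq> {} \<Longrightarrow> P N \<Longrightarrow> N = M"
    using minimal_compact_set[of K P] K closed by (auto simp: P_def)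
  obtain e where e: "e \<in> M"
    using M by blast
  have "(\<lambda>x. x \<odot> e) ` M = M"
  proof (rule min)
    show "compact ((\<lambda>x. x \<odot> e) ` M)"
      by (intro compact_continuous_image continuous_on_subset[OF cont] M) auto
    show "P ((\<lambda>x. x \<odot> e) ` M)"
      unfolding P_def
    proof safe
      fix x y assume "x \<in> M" "y \<in> M"
      then have "x \<odot> e \<odot> y \<in> M"
        using e M(4) by (auto simp: P_def)
      then show "x \<odot> e \<odot> (y \<odot> e) \<in> (\<lambda>x. x \<odot> e) ` M"
        by (intro image_eqI[of _ _ "x \<odot> e \<odot> y"]) (simp_all add: assoc)
    qed
  qed (use M e in \<open>auto simp: P_def\<close>)
  then obtain x where x: "x \<in> M" "x \<odot> e = e"
    using e by (metis imageE)
  have "{x \<in> M. x \<odot> e = e} = M"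
  proof (rule min)
    have "closed ((\<lambda>x. x \<odot> e) -` {e})"
      by (intro closed_vimage cont) auto
    moreover have "{x \<in> M. x \<odot> e = e} = M \<inter> ((\<lambda>x. x \<odot> e) -` {e})"
      by auto
    ultimately show "compact {x \<in> M. x \<odot> e = e}"
      using M by (auto intro: compact_Int_closed)
    show "P {x \<in> M. x \<odot> e = e}"
      using M(4) by (auto simp: P_def assoc)
  qed (use x in auto)
  then show ?thesis
    using e M that by blast
qed

section \<open>Ultrafilters and their convolution\<close>

definition ultra :: "('b set \<Rightarrow> bool) set" where
  "ultra = {p. p UNIV \<and> (\<forall>X Y. p (X \<inter> Y) \<longleftrightarrow> p X \<and> p Y) \<and> (\<forall>X. p (- X) \<longleftrightarrow> \<not> p X)}"

definition ultra_on :: "'b set \<Rightarrow> ('b set \<Rightarrow> bool) set" where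
  "ultra_on W = {p \<in> ultra. p W}"

definition pushf :: "('b \<Rightarrow> 'c) \<Rightarrow> ('b set \<Rightarrow> bool) \<Rightarrow> 'c set \<Rightarrow> bool" where
  "pushf f p X = p (f -` X)"

definition dirac :: "'b \<Rightarrow> 'b set \<Rightarrow> bool" where
  "dirac a X \<longleftrightarrow> a \<in> X"

text \<open>The extension of concatenation to the Stone-Cech compactification of the set of words.
  It is continuous in the left argument; continuity in the right argument is available for principal
  left factors.\<close>

definition conv :: "('b list set \<Rightarrow> bool) \<Rightarrow> ('b list set \<Rightarrow> bool) \<Rightarrow> 'b list set \<Rightarrow> bool"
    (infixl "\<odot>" 70) where
  "(p \<odot> q) X = p {s. q {t. s @ t \<in> X}}"

lemma ultra_mono: "p \<in> ultra \<Longrightarrow> p X \<Longrightarrow> X \<subseteq> Y \<Longrightarrow> p Y"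
  unfolding ultra_def by (metis (mono_tags, lifting) inf.absorb_iff1 mem_Collect_eq)

lemma ultra_Int: "p \<in> ultra \<Longrightarrow> p (X \<inter> Y) \<longleftrightarrow> p X \<and> p Y"
  unfolding ultra_def by auto

lemma ultra_Compl: "p \<in> ultra \<Longrightarrow> p (- X) \<longleftrightarrow> \<not> p X"
  unfolding ultra_def by auto

lemma ultra_UNIV: "p \<in> ultra \<Longrightarrow> p UNIV"
  unfolding ultra_def by auto

lemma ultra_nonempty: "p \<in> ultra \<Longrightarrow> p X \<Longrightarrow> X \<noteq> {}"
  using ultra_UNIV ultra_Compl[of p UNIV] by auto

lemma ultra_INT:
  assumes "p \<in> ultra" "finite I" "\<And>i. i \<in> I \<Longrightarrow> p (X i)"
  shows "p (\<Inter>i\<in>I. X i)"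
  using assms(2,3) by (induction I) (auto simp: ultra_Int ultra_UNIV assms(1))

lemma ultra_on_mono: "W \<subseteq> W' \<Longrightarrow> p \<in> ultra_on W \<Longrightarrow> p \<in> ultra_on W'"
  unfolding ultra_on_def using ultra_mono by blast

lemma dirac_ultra_on: "a \<in> W \<Longrightarrow> dirac a \<in> ultra_on W"
  by (auto simp: ultra_on_def ultra_def dirac_def)

lemma pushf_ultra_on:
  assumes "p \<in> ultra_on W" "f ` W \<subseteq> W'"
  shows "pushf f p \<in> ultra_on W'"
proof -
  have "p (f -` W')"
    using assms ultra_mono[of p W "f -` W'"] unfolding ultra_on_def by blast
  then show ?thesis
    using assms unfolding ultra_on_def ultra_def pushf_def
    by (auto simp: vimage_Compl)
qed

lemma pushf_id_on:
  assumes "p \<in> ultra_on W" "\<And>x. x \<in> W \<Longrightarrow> f x = x"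
  shows "pushf f p = p"
proof
  fix X
  have p: "p \<in> ultra" "p W"
    using assms by (auto simp: ultra_on_def)
  have "f -` X \<inter> W = X \<inter> W"
    using assms(2) by auto
  then have "p (f -` X \<inter> W) = p (X \<inter> W)" by simp
  then show "pushf f p X = p X"
    using p by (simp add: pushf_def ultra_Int)
qed

lemma conv_ultra_on:
  assumes "p \<in> ultra_on V" "q \<in> ultra_on W" "\<And>s t. s \<in> V \<Longrightarrow> t \<in> W \<Longrightarrow> s @ t \<in> U"
  shows "p \<odot> q \<in> ultra_on U"
proof -
  have p: "p \<in> ultra" "p V" and q: "q \<in> ultra" "q W"
    using assms by (auto simp: ultra_on_def)
  have "q {t. s @ t \<in> U}" if "s \<in> V" for s
    using that assms(3) by (intro ultra_mono[OF q]) auto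
  then have "p {s. q {t. s @ t \<in> U}}"
    by (intro ultra_mono[OF p]) auto
  moreover have "p \<odot> q \<in> ultra"
  proof -
    have *: "{t. s @ t \<in> X \<inter> Y} = {t. s @ t \<in> X} \<inter> {t. s @ t \<in> Y}"
      "{t. s @ t \<in> - X} = - {t. s @ t \<in> X}" for s and X Y :: "'a list set"
      by auto
    have "{s. q {t. s @ t \<in> X \<inter> Y}} = {s. q {t. s @ t \<in> X}} \<inter> {s. q {t. s @ t \<in> Y}}"
      "{s. q {t. s @ t \<in> - X}} = - {s. q {t. s @ t \<in> X}}" for X Y
      by (auto simp only: * ultra_Int[OF q(1)] ultra_Compl[OF q(1)])
    then have "(p \<odot> q) (X \<inter> Y) \<longleftrightarrow> (p \<odot> q) X \<and> (p \<odot> q) Y" "(p \<odot> q) (- X) \<longleftrightarrow> \<not> (p \<odot> q) X"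
      for X Y
      by (simp_all only: conv_def ultra_Int[OF p(1)] ultra_Compl[OF p(1)])
    moreover have "(p \<odot> q) UNIV"
      using p q by (simp add: conv_def ultra_UNIV)
    ultimately show ?thesis
      by (simp add: ultra_def)
  qed
  ultimately show ?thesis
    by (simp add: ultra_on_def conv_def)
qed

lemma conv_assoc: "p \<odot> q \<odot> r = p \<odot> (q \<odot> r)"
  by (simp add: fun_eq_iff conv_def)

lemma pushf_conv:
  assumes "\<And>s t. f (s @ t) = f s @ f t"
  shows "pushf f (p \<odot> q) = pushf f p \<odot> pushf f q"
  by (simp add: fun_eq_iff conv_def pushf_def assms vimage_def)

lemma continuous_on_conv_left: "continuous_on UNIV (\<lambda>p. p \<odot> q)"
  by (rule continuous_on_coordinatewise_then_product) (simp add: conv_def)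

lemma continuous_on_dirac_conv: "continuous_on UNIV (\<lambda>p. dirac a \<odot> p)"
  by (rule continuous_on_coordinatewise_then_product) (simp add: conv_def dirac_def)

lemma closed_coord_pred:
  fixes P :: "bool \<Rightarrow> bool \<Rightarrow> bool \<Rightarrow> bool"
  shows "closed {p :: 'a \<Rightarrow> bool. P (p x) (p y) (p z)}"
proof -
  have 1: "closed ((\<lambda>p :: 'a \<Rightarrow> bool. p x) -` S)" for x and S
    by (intro closed_vimage continuous_on_product_coordinates finite_imp_closed) simp_all
  have "{p. P (p x) (p y) (p z)} = (\<Union>b\<in>{(b1, b2, b3). P b1 b2 b3}.
    ((\<lambda>p. p x) -` {fst b}) \<inter> ((\<lambda>p. p y) -` {fst (snd b)}) \<inter> ((\<lambda>p. p z) -` {snd (snd b)}))"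
    by auto
  also have "closed \<dots>"
    by (intro closed_UN ballI closed_Int 1 finite)
  finally show ?thesis .
qed

text \<open>Ultrafilters are encoded as characteristic functions so that Tychonoff's theorem
  applies: each axiom constrains at most three coordinates and is therefore closed.\<close>

lemma compact_ultra_on: "compact (ultra_on W)"
proof -
  have "compact_space (product_topology (\<lambda>i :: 'a set. euclidean :: bool topology) UNIV)"
    unfolding compact_space_product_topology by (auto simp: compact_space_def finite_imp_compact)
  then have "compact (UNIV :: ('a set \<Rightarrow> bool) set)"
    by (simp add: euclidean_product_topology compact_space_def)
  moreover have "closed (ultra_on W)"
  proof -
    have "ultra_on W = {p. p UNIV} \<inter> {p. p W} \<inter> (\<Inter>X. \<Inter>Y. {p. p (X \<inter> Y) \<longleftrightarrow> p X \<and> p Y})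
        \<inter> (\<Inter>X. {p. p (- X) \<longleftrightarrow> \<not> p X})"
      by (auto simp: ultra_on_def ultra_def)
    also have "closed \<dots>"
      using closed_coord_pred[of "\<lambda>x y z. x" UNIV UNIV UNIV] closed_coord_pred[of "\<lambda>x y z. x" W W W]
      closed_coord_pred[of "\<lambda>x y z. x \<longleftrightarrow> y \<and> z"] closed_coord_pred[of "\<lambda>x y z. x \<longleftrightarrow> \<not> y" _ _ UNIV]
      by (intro closed_Int closed_INT ballI)
    finally show ?thesis .
  qed
  ultimately show ?thesis
    using compact_Int_closed[of UNIV "ultra_on W"] by simp
qed

section \<open>The Carlson--Simpson theorem\<close>

definition subst_letter :: "'b \<Rightarrow> 'b \<Rightarrow> 'b list \<Rightarrow> 'b list" where
  "subst_letter x a = map (\<lambda>c. if c = x then a else c)"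

text \<open>\<open>L\<close> is a minimal compact left ideal of the ultrafilters on words over
  \<open>\<Sigma>\<close>. The compact semigroup \<open>Y\<close> has an idempotent
  \<open>y\<close>. Substitution is a homomorphism that turns the elements of \<open>Y\<close> into
  left multiples of some \<open>w\<close> in \<open>L\<close>, so the instances of \<open>y\<close>
  are idempotents of \<open>L\<close>.\<close>

lemma left_variable_ultrafilter:
  fixes \<Sigma> :: "'b set" and x :: 'b
  assumes "\<Sigma> \<noteq> {}" "x \<notin> \<Sigma>"
  obtains y where "y \<in> ultra_on {x # t | t. t \<in> lists (insert x \<Sigma>)}"
    "\<And>a b. a \<in> \<Sigma> \<Longrightarrow> b \<in> \<Sigma> \<Longrightarrow>
      pushf (subst_letter x a) y \<odot> pushf (subst_letter x b) y = pushf (subst_letter x a) y"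
proof -
  define S where "S = ultra_on (lists \<Sigma>)"
  define T where "T = ultra_on (lists (insert x \<Sigma>))"
  have S_conv: "p \<odot> q \<in> S" if "p \<in> S" "q \<in> S" for p q
    using that unfolding S_def by (rule conv_ultra_on) auto
  have T_conv: "p \<odot> q \<in> T" if "p \<in> T" "q \<in> T" for p q
    using that unfolding T_def by (rule conv_ultra_on) auto
  have ST: "S \<subseteq> T"
    unfolding S_def T_def by (auto intro!: ultra_on_mono[of "lists \<Sigma>"])
  have dx: "dirac [x] \<in> T"
    unfolding T_def by (rule dirac_ultra_on) auto
  have push_S: "pushf (subst_letter x a) p \<in> S" if "a \<in> \<Sigma>" "p \<in> T" for a p
    using that(2) unfolding S_def T_def
    by (rule pushf_ultra_on) (use that(1) in \<open>auto simp: subst_letter_def\<close>)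
  define P where "P L \<longleftrightarrow> (\<forall>s\<in>S. \<forall>l\<in>L. s \<odot> l \<in> L)" for L
  have "dirac [] \<in> S"
    unfolding S_def by (rule dirac_ultra_on) auto
  have P_Inter: "P (\<Inter>\<D>)" if "\<D> \<noteq> {}" "\<And>D. D \<in> \<D> \<Longrightarrow> P D" for \<D>
    using that by (auto simp: P_def)
  have S: "compact S" "S \<noteq> {}" "P S"
    using S_conv \<open>dirac [] \<in> S\<close> by (auto simp: P_def S_def compact_ultra_on)
  obtain L where L: "L \<subseteq> S" "compact L" "L \<noteq> {}" "P L"
    and min: "\<And>N. N \<subseteq> L \<Longrightarrow> compact N \<Longrightarrow> N \<noteq> {} \<Longrightarrow> P N \<Longrightarrow> N = L"
    using minimal_compact_set[of S P, OF S P_Inter] by auto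
  obtain w where w: "w \<in> L"
    using L by blast
  \<comment> \<open>The left factor makes the words start with \<open>x\<close>. The right factor
    \<open>w\<close> concerns words without \<open>x\<close>, so substitution fixes it, and it
    carries every instance into \<open>L\<close>.\<close>
  define Y where "Y = (\<lambda>t. dirac [x] \<odot> (t \<odot> w)) ` T"
  have "compact Y"
    unfolding Y_def
  proof (rule compact_continuous_image)
    have "continuous_on UNIV ((\<lambda>q. dirac [x] \<odot> q) \<circ> (\<lambda>t. t \<odot> w))"
      by (intro continuous_on_compose continuous_on_conv_left
          continuous_on_subset[OF continuous_on_dirac_conv]) auto
    then show "continuous_on T (\<lambda>t. dirac [x] \<odot> (t \<odot> w))"
      by (auto simp: o_def intro: continuous_on_subset)
  qed (simp add: T_def compact_ultra_on)
  moreover have "Y \<noteq> {}"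
    using dx by (auto simp: Y_def)
  moreover have "p \<odot> q \<in> Y" if pq: "p \<in> Y" "q \<in> Y" for p q
  proof -
    obtain s t where st: "s \<in> T" "t \<in> T" and p: "p = dirac [x] \<odot> (s \<odot> w)"
      and q: "q = dirac [x] \<odot> (t \<odot> w)"
      using pq by (auto simp: Y_def)
    have "w \<in> T" using w L ST by blast
    then have "s \<odot> w \<odot> dirac [x] \<odot> t \<in> T"
      by (intro T_conv st dx)
    moreover have "p \<odot> q = dirac [x] \<odot> ((s \<odot> w \<odot> dirac [x] \<odot> t) \<odot> w)"
      by (simp add: p q conv_assoc)
    ultimately show ?thesis
      by (simp add: Y_def)
  qed
  ultimately obtain y where y: "y \<in> Y" "y \<odot> y = y"
    by (rule compact_semigroup_idempotent[of Y conv]) (auto simp: conv_assoc continuous_on_conv_left)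
  then obtain t where t: "t \<in> T" and yt: "y = dirac [x] \<odot> (t \<odot> w)"
    by (auto simp: Y_def)
  define q where "q a = pushf (subst_letter x a) y" for a
  have app: "subst_letter x a (u @ v) = subst_letter x a u @ subst_letter x a v" for a u v
    by (simp add: subst_letter_def)
  have qL: "q a \<in> L" if "a \<in> \<Sigma>" for a
  proof -
    have "pushf (subst_letter x a) w = w"
    proof (rule pushf_id_on)
      show "w \<in> ultra_on (lists \<Sigma>)"
        using w L by (auto simp: S_def)
      show "subst_letter x a u = u" if "u \<in> lists \<Sigma>" for u
        unfolding subst_letter_def by (rule map_idI) (use that assms in auto)
    qed
    then have "q a = pushf (subst_letter x a) (dirac [x]) \<odot> pushf (subst_letter x a) t \<odot> w"
      by (simp add: q_def yt pushf_conv app conv_assoc)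
    moreover have "pushf (subst_letter x a) (dirac [x]) \<odot> pushf (subst_letter x a) t \<in> S"
      by (intro S_conv push_S that dx t)
    ultimately show ?thesis
      using L(4) w by (auto simp: P_def)
  qed
  have q_idem: "q a \<odot> q a = q a" for a
    using y(2) by (simp add: q_def app flip: pushf_conv)
  have "q a \<odot> q b = q a" if a: "a \<in> \<Sigma>" and b: "b \<in> \<Sigma>" for a b
  proof -
    \<comment> \<open>Each element of a minimal left ideal generates it. So \<open>q a\<close> is a
      left multiple of the idempotent \<open>q b\<close>, which acts on it as a right
      identity.\<close>
    have "(\<lambda>s. s \<odot> q b) ` S = L"
    proof (rule min)
      show "(\<lambda>s. s \<odot> q b) ` S \<subseteq> L"
        using L(4) qL[OF b] by (auto simp: P_def)
      show "compact ((\<lambda>s. s \<odot> q b) ` S)"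
        by (intro compact_continuous_image continuous_on_subset[OF continuous_on_conv_left])
          (auto simp: S_def compact_ultra_on)
      show "P ((\<lambda>s. s \<odot> q b) ` S)"
        unfolding P_def using S_conv by (auto simp flip: conv_assoc)
    qed (use \<open>dirac [] \<in> S\<close> in auto)
    then obtain s where "q a = s \<odot> q b"
      using qL[OF a] by blast
    then show ?thesis
      by (simp add: conv_assoc q_idem)
  qed
  moreover have "y \<in> ultra_on {x # t | t. t \<in> lists (insert x \<Sigma>)}"
    unfolding yt
  proof (rule conv_ultra_on)
    show "dirac [x] \<in> ultra_on {[x]}"
      by (rule dirac_ultra_on) auto
    show "t \<odot> w \<in> ultra_on (lists (insert x \<Sigma>))"
      using T_conv t w L ST unfolding T_def by blast
  qed auto
  ultimately show ?thesis
    using that unfolding q_def by blast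
qed

text \<open>
  An infinite variable word is a sequence \<open>V\<close> with values \<open>Inl a\<close> (a letter) and \<open>Inr j\<close> (the
  variable that occurs first at position \<open>j\<close>).
\<close>

definition fill :: "(nat \<Rightarrow> 'b) \<Rightarrow> (nat \<Rightarrow> 'b + nat) \<Rightarrow> nat \<Rightarrow> 'b list" where
  "fill b V n = map (\<lambda>i. case V i of Inl a \<Rightarrow> a | Inr j \<Rightarrow> b j) [0..<n]"

definition variable_word :: "'b set \<Rightarrow> (nat \<Rightarrow> 'b + nat) \<Rightarrow> nat \<Rightarrow> bool" where
  "variable_word \<Sigma> V n \<longleftrightarrow>
    (\<forall>i<n. case V i of Inl a \<Rightarrow> a \<in> \<Sigma> | Inr j \<Rightarrow> j \<le> i \<and> V j = Inr j)"

lemma fill_cong: "(\<And>i. i < n \<Longrightarrow> V i = W i) \<Longrightarrow> fill b V n = fill b W n"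
  by (auto simp: fill_def)

lemma fill_in_lists:
  assumes "variable_word \<Sigma> V n" "range b \<subseteq> \<Sigma>"
  shows "fill b V n \<in> lists \<Sigma>"
proof -
  have "(case V i of Inl a \<Rightarrow> a | Inr j \<Rightarrow> b j) \<in> \<Sigma>" if "i < n" for i
    using assms that by (auto simp: variable_word_def split: sum.splits)
  then show ?thesis
    by (auto simp: fill_def)
qed

lemma fill_add:
  "fill b V (n + k) = fill b V n @ map (\<lambda>i. case V (n + i) of Inl a \<Rightarrow> a | Inr j \<Rightarrow> b j) [0..<k]"
  by (induction k) (simp_all add: fill_def)

text \<open>The argument of Galvin and Glazer, with letters coded as \<open>Some a\<close> and the
  variable as \<open>None\<close>. The word is built block by block; each block is a variable word
  from a \<open>y\<close>-large set. The colour is controlled just before a first occurrence of a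
  variable, which is where \<open>dual_pigeonhole\<close> reads it.\<close>

theorem Carlson_Simpson:
  fixes \<Sigma> :: "'b set" and \<kappa> :: "'b list \<Rightarrow> bool"
  assumes \<Sigma>: "finite \<Sigma>" "\<Sigma> \<noteq> {}"
  obtains V c where "\<And>n. variable_word \<Sigma> V n" "\<And>n. \<exists>i\<ge>n. V i = Inr i"
    "\<And>i b. V i = Inr i \<Longrightarrow> range b \<subseteq> \<Sigma> \<Longrightarrow> \<kappa> (fill b V i) = c"
proof -
  define \<phi> where "\<phi> a = subst_letter None (Some a)" for a :: 'b
  obtain y where y: "y \<in> ultra_on {None # t | t. t \<in> lists (insert None (Some ` \<Sigma>))}"
    and idem: "\<And>a b. a \<in> Some ` \<Sigma> \<Longrightarrow> b \<in> Some ` \<Sigma> \<Longrightarrow>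
      pushf (subst_letter None a) y \<odot> pushf (subst_letter None b) y = pushf (subst_letter None a) y"
    by (rule left_variable_ultrafilter[of "Some ` \<Sigma>" None]) (use \<Sigma> in auto)
  define q where "q a = pushf (\<phi> a) y" for a
  have q_conv: "q a \<odot> q b = q a" if "a \<in> \<Sigma>" "b \<in> \<Sigma>" for a b
    using idem that by (simp add: q_def \<phi>_def)
  have q_on: "q a \<in> ultra_on (lists (Some ` \<Sigma>))" if "a \<in> \<Sigma>" for a
    unfolding q_def by (rule pushf_ultra_on[OF y])
      (use that in \<open>auto simp: \<phi>_def subst_letter_def\<close>)
  then have q: "q a \<in> ultra" if "a \<in> \<Sigma>" for a
    using that by (auto simp: ultra_on_def)
  have yu: "y \<in> ultra" "y {None # t | t. t \<in> lists (insert None (Some ` \<Sigma>))}"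
    using y by (auto simp: ultra_on_def)
  obtain a0 where a0: "a0 \<in> \<Sigma>"
    using \<Sigma> by blast
  define c where "c = q a0 {s. \<kappa> (map the s)}"
  define X where "X = {s. \<kappa> (map the s) = c}"
  have X: "q a0 X"
  proof (cases c)
    case True
    then show ?thesis by (simp add: X_def c_def)
  next
    case False
    then have "X = - {s. \<kappa> (map the s)}"
      by (auto simp: X_def)
    then show ?thesis
      using False ultra_Compl[OF q[OF a0]] by (simp add: c_def)
  qed
  \<comment> \<open>The words of \<open>X\<close> that \<open>q b\<close>-most words prolong within
    \<open>X\<close>, for every letter \<open>b\<close>. Because
    \<open>q b \<odot> q b' = q b\<close>, these prolongations even stay in
    \<open>Z\<close>.\<close>
  define Z where "Z = X \<inter> (\<Inter>b\<in>\<Sigma>. {s. q b {t. s @ t \<in> X}})"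
  have "q a0 {s. q b {t. s @ t \<in> X}}" if "b \<in> \<Sigma>" for b
    using X fun_cong[OF q_conv[OF a0 that], of X] by (simp add: conv_def)
  then have "q a0 (\<Inter>b\<in>\<Sigma>. {s. q b {t. s @ t \<in> X}})"
    by (rule ultra_INT[OF q[OF a0] \<Sigma>(1)])
  then have "q a0 Z"
    unfolding Z_def ultra_Int[OF q[OF a0]] using X by simp
  have Z_step: "q b {t. s @ t \<in> Z}" if "s \<in> Z" "b \<in> \<Sigma>" for s b
  proof -
    have "q b {t. s @ t \<in> X}"
      using that by (auto simp: Z_def)
    moreover have "q b {t. q b' {t'. (s @ t) @ t' \<in> X}}" if "b' \<in> \<Sigma>" for b'
    proof -
      have "(q b \<odot> q b') {t. s @ t \<in> X}"
        unfolding q_conv[OF \<open>b \<in> \<Sigma>\<close> that] by fact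
      then show ?thesis
        by (simp add: conv_def)
    qed
    then have "q b (\<Inter>b'\<in>\<Sigma>. {t. q b' {t'. (s @ t) @ t' \<in> X}})"
      by (rule ultra_INT[OF q[OF that(2)] \<Sigma>(1)])
    ultimately have "q b ({t. s @ t \<in> X} \<inter> (\<Inter>b'\<in>\<Sigma>. {t. q b' {t'. (s @ t) @ t' \<in> X}}))"
      by (simp add: ultra_Int q[OF that(2)])
    moreover have "{t. s @ t \<in> X} \<inter> (\<Inter>b'\<in>\<Sigma>. {t. q b' {t'. (s @ t) @ t' \<in> X}}) = {t. s @ t \<in> Z}"
      by (auto simp: Z_def)
    ultimately show ?thesis by simp
  qed
  define inv where "inv V n \<longleftrightarrow> variable_word \<Sigma> V n \<and>
    (\<forall>b. range b \<subseteq> \<Sigma> \<longrightarrow> map Some (fill b V n) \<in> Z \<and>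
      (\<forall>i<n. V i = Inr i \<longrightarrow> map Some (fill b V i) \<in> Z))" for V n
  have start: "\<exists>V n. inv V n"
  proof -
    have "q a0 (Z \<inter> lists (Some ` \<Sigma>))"
      using \<open>q a0 Z\<close> q_on[OF a0] by (auto simp: ultra_on_def ultra_Int)
    then obtain s where s: "s \<in> Z" "s \<in> lists (Some ` \<Sigma>)"
      using ultra_nonempty[OF q[OF a0]] by blast
    define V where "V i = (Inl (the (s ! i)) :: 'b + nat)" for i
    have mem: "s ! i \<in> Some ` \<Sigma>" if "i < length s" for i
      using s(2) that by (meson in_lists_conv_set nth_mem)
    have "map Some (fill b V (length s)) = s" for b
      by (rule nth_equalityI) (use mem in \<open>force simp: fill_def V_def\<close>)+
    moreover have "variable_word \<Sigma> V (length s)"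
      using mem by (force simp: variable_word_def V_def)
    ultimately show ?thesis
      using s unfolding inv_def by (intro exI[of _ V] exI[of _ "length s"]) (simp add: V_def)
  qed
  have step: "\<exists>W m. n < m \<and> inv W m \<and> (\<forall>i<n. W i = V i) \<and> W n = Inr n" if inv: "inv V n" for V n
  proof -
    \<comment> \<open>The positions below \<open>n\<close> have only finitely many fillings. Each
      \<open>q a\<close> is an image of the one ultrafilter \<open>y\<close>, so a single variable
      word \<open>v\<close> prolongs all of them within \<open>Z\<close> under every substitution.
      As \<open>v\<close> starts with \<open>None\<close>, the new variable first occurs at
      \<open>n\<close>.\<close>
    define F where "F = (\<lambda>b. map Some (fill b V n)) ` {b. range b \<subseteq> \<Sigma>}"
    have "fill b V n \<in> {xs. set xs \<subseteq> \<Sigma> \<and> length xs = n}" if "range b \<subseteq> \<Sigma>" for b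
      using inv that fill_in_lists[of \<Sigma> V n b] by (auto simp: inv_def fill_def)
    then have "F \<subseteq> map Some ` {xs. set xs \<subseteq> \<Sigma> \<and> length xs = n}"
      by (auto simp only: F_def)
    then have "finite F"
      using finite_imageI[OF finite_lists_length_eq[OF \<Sigma>(1)]] by (rule finite_subset)
    have "q a (\<Inter>s\<in>F. {t. s @ t \<in> Z})" if "a \<in> \<Sigma>" for a
      using inv by (intro ultra_INT[OF q[OF that] \<open>finite F\<close>] Z_step that) (auto simp: F_def inv_def)
    then have "y (\<Inter>a\<in>\<Sigma>. \<phi> a -` (\<Inter>s\<in>F. {t. s @ t \<in> Z}))"
      by (intro ultra_INT[OF yu(1) \<Sigma>(1)]) (simp only: q_def pushf_def)
    then have "y ((\<Inter>a\<in>\<Sigma>. \<phi> a -` (\<Inter>s\<in>F. {t. s @ t \<in> Z})) \<inter>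
        {None # t | t. t \<in> lists (insert None (Some ` \<Sigma>))})"
      using yu by (simp add: ultra_Int)
    from ultra_nonempty[OF yu(1) this]
    obtain v where v': "v \<in> (\<Inter>a\<in>\<Sigma>. \<phi> a -` (\<Inter>s\<in>F. {t. s @ t \<in> Z}))"
      and v_left: "v \<in> {None # t | t. t \<in> lists (insert None (Some ` \<Sigma>))}"
      by (elim ex_in_conv[THEN iffD2, THEN exE] IntE)
    have v: "s @ \<phi> a v \<in> Z" if "a \<in> \<Sigma>" "s \<in> F" for a s
      using v' that by simp
    have len: "length v > 0" "v ! 0 = None"
      using v_left by auto
    have "v \<in> lists (insert None (Some ` \<Sigma>))"
      using v_left by auto
    then have mem: "v ! i \<in> insert None (Some ` \<Sigma>)" if "i < length v" for i
      using that by (meson in_lists_conv_set nth_mem)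
    define W where "W i = (if i < n then V i else case v ! (i - n) of None \<Rightarrow> Inr n | Some a \<Rightarrow> Inl a)"
      for i
    have Wn: "W n = Inr n"
      using len by (simp add: W_def)
    have "variable_word \<Sigma> W (n + length v)"
      unfolding variable_word_def
    proof safe
      fix i assume i: "i < n + length v"
      show "case W i of Inl a \<Rightarrow> a \<in> \<Sigma> | Inr j \<Rightarrow> j \<le> i \<and> W j = Inr j"
      proof (cases "i < n")
        case True
        then have "case V i of Inl a \<Rightarrow> a \<in> \<Sigma> | Inr j \<Rightarrow> j \<le> i \<and> V j = Inr j"
          using inv by (simp add: inv_def variable_word_def)
        then show ?thesis
          using True by (cases "V i") (auto simp: W_def)
      next
        case False
        with i have "v ! (i - n) \<in> insert None (Some ` \<Sigma>)"
          by (intro mem) simp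
        then show ?thesis
          using False Wn by (cases "v ! (i - n)") (auto simp: W_def)
      qed
    qed
    moreover have "map Some (fill b W (n + length v)) \<in> Z" if b: "range b \<subseteq> \<Sigma>" for b
    proof -
      have "map Some (map (\<lambda>i. case W (n + i) of Inl a \<Rightarrow> a | Inr j \<Rightarrow> b j) [0..<length v]) = \<phi> (b n) v"
        unfolding \<phi>_def subst_letter_def
      proof (rule nth_equalityI)
        fix i assume "i < length (map Some (map (\<lambda>i. case W (n + i) of Inl a \<Rightarrow> a | Inr j \<Rightarrow> b j) [0..<length v]))"
        then have "i < length v"
          by simp
        then show "map Some (map (\<lambda>i. case W (n + i) of Inl a \<Rightarrow> a | Inr j \<Rightarrow> b j) [0..<length v]) ! i
            = map (\<lambda>c. if c = None then Some (b n) else c) v ! i"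
          by (cases "v ! i") (simp_all add: W_def)
      qed simp
      moreover have "fill b W n = fill b V n"
        by (rule fill_cong) (simp add: W_def)
      ultimately have "map Some (fill b W (n + length v)) = map Some (fill b V n) @ \<phi> (b n) v"
        by (simp add: fill_add)
      moreover have "b n \<in> \<Sigma>"
        using b by auto
      ultimately show ?thesis
        using v[of "b n" "map Some (fill b V n)"] b by (simp add: F_def)
    qed
    moreover have "map Some (fill b W i) \<in> Z"
      if b: "range b \<subseteq> \<Sigma>" and i: "i < n + length v" "W i = Inr i" for b i
    proof -
      have "i \<le> n"
        using i by (cases "v ! (i - n)") (auto simp: W_def split: if_splits)
      then have "fill b W i = fill b V i"
        by (intro fill_cong) (simp add: W_def)
      moreover have "map Some (fill b V i) \<in> Z"
        using inv b i \<open>i \<le> n\<close> by (cases "i = n") (simp_all add: inv_def W_def)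
      ultimately show ?thesis by simp
    qed
    ultimately have "inv W (n + length v)"
      by (simp add: inv_def)
    then show ?thesis
      using len Wn by (intro exI[of _ W] exI[of _ "n + length v"]) (simp add: W_def)
  qed
  have "\<exists>f. \<forall>k. inv (fst (f k)) (snd (f k)) \<and> (snd (f k) < snd (f (Suc k)) \<and>
      (\<forall>i<snd (f k). fst (f (Suc k)) i = fst (f k) i) \<and> fst (f (Suc k)) (snd (f k)) = Inr (snd (f k)))"
  proof (rule dependent_nat_choice)
    show "\<exists>s. inv (fst s) (snd s)"
      using start by auto
    fix s and k :: nat
    assume "inv (fst s) (snd s)"
    from step[OF this] show "\<exists>t. inv (fst t) (snd t) \<and> snd s < snd t \<and>
        (\<forall>i<snd s. fst t i = fst s i) \<and> fst t (snd s) = Inr (snd s)"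
      by auto
  qed
  then obtain f where f: "\<And>k. inv (fst (f k)) (snd (f k))" "\<And>k. snd (f k) < snd (f (Suc k))"
    "\<And>k i. i < snd (f k) \<Longrightarrow> fst (f (Suc k)) i = fst (f k) i"
    "\<And>k. fst (f (Suc k)) (snd (f k)) = Inr (snd (f k))"
    by blast
  have sm: "strict_mono (\<lambda>k. snd (f k))"
    using f(2) by (simp add: strict_mono_Suc_iff)
  have ge: "k \<le> snd (f k)" for k
    using strict_mono_imp_increasing[OF sm, of k] by simp
  have stable: "fst (f l) i = fst (f k) i" if "k \<le> l" "i < snd (f k)" for k l i
    using that(1)
  proof (induction rule: dec_induct)
    case (step m)
    have "i < snd (f m)"
      using that(2) strict_mono_less_eq[OF sm, of k m] step(1) by simp
    then have "fst (f (Suc m)) i = fst (f m) i" by (rule f(3))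
    then show ?case using step by simp
  qed simp
  define V where "V i = fst (f (Suc i)) i" for i
  have V: "V i = fst (f k) i" if "i < snd (f k)" for i k
    using stable[of k "Suc i" i] stable[of "Suc i" k i] that ge[of "Suc i"]
    by (cases "k \<le> Suc i") (auto simp: V_def)
  show ?thesis
  proof
    show "variable_word \<Sigma> V n" for n
      unfolding variable_word_def
    proof safe
      fix i
      have "i < snd (f (Suc i))" using ge[of "Suc i"] by simp
      then show "case V i of Inl a \<Rightarrow> a \<in> \<Sigma> | Inr j \<Rightarrow> j \<le> i \<and> V j = Inr j"
        using f(1)[of "Suc i"] V[of _ "Suc i"]
        by (cases "V i") (auto simp: inv_def variable_word_def)
    qed
    show "\<exists>i\<ge>n. V i = Inr i" for n
      using V[of "snd (f n)" "Suc n"] f(2,4)[of n] ge[of n] by auto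
    fix i and b :: "nat \<Rightarrow> 'b"
    assume i: "V i = Inr i" and b: "range b \<subseteq> \<Sigma>"
    show "\<kappa> (fill b V i) = c"
    proof -
      have lt: "i < snd (f (Suc i))" using ge[of "Suc i"] by simp
      have eq: "fill b V i = fill b (fst (f (Suc i))) i"
        using lt by (intro fill_cong V) simp
      have "map Some (fill b V i) \<in> Z"
        using f(1)[of "Suc i"] i b lt V[OF lt] unfolding eq inv_def by simp
      then show ?thesis
        by (simp add: Z_def X_def o_def)
    qed
  qed
qed

section \<open>Fusion\<close>

definition lead :: "(nat \<Rightarrow> nat \<Rightarrow> bool) \<Rightarrow> nat \<Rightarrow> bool" where
  "lead A x \<longleftrightarrow> (\<forall>y<x. \<not> A y x)"

definition leader :: "(nat \<Rightarrow> nat \<Rightarrow> bool) \<Rightarrow> nat \<Rightarrow> nat" where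
  "leader A z = (LEAST y. A y z)"

definition agree :: "nat \<Rightarrow> (nat \<Rightarrow> nat \<Rightarrow> bool) \<Rightarrow> (nat \<Rightarrow> nat \<Rightarrow> bool) \<Rightarrow> bool" where
  "agree M A B \<longleftrightarrow> (\<forall>i<M. \<forall>j<M. A i j \<longleftrightarrow> B i j)"

text \<open>\<open>basic_nbhd\<close> in terms of the pointwise order, in which coarser relations
  are larger; see \<open>basic_nbhd_eq\<close>.\<close>

definition nb :: "nat \<Rightarrow> (nat \<Rightarrow> nat \<Rightarrow> bool) \<Rightarrow> (nat \<Rightarrow> nat \<Rightarrow> bool) set" where
  "nb M B = {A \<in> Einf. B \<le> A \<and> agree M A B}"

lemma equivp_leader:
  assumes "equivp A"
  shows "A (leader A z) z" "lead A (leader A z)" "leader A z \<le> z"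
    "A x y \<longleftrightarrow> leader A x = leader A y" "lead A x \<longleftrightarrow> leader A x = x"
proof -
  have refl: "A u u" for u
    using assms by (rule equivp_reflp)
  show 1: "A (leader A z) z" for z
    unfolding leader_def by (rule LeastI[of _ z]) (rule refl)
  show le: "leader A z \<le> z" for z
    unfolding leader_def by (rule Least_le) (rule refl)
  have trans: "A u v \<Longrightarrow> A v w \<Longrightarrow> A u w" and sym: "A u v \<Longrightarrow> A v u" for u v w
    using assms by (auto intro: equivp_symp elim: equivp_transp)
  show lead: "lead A (leader A z)" for z
    unfolding lead_def
  proof safe
    fix y assume y: "y < leader A z" "A y (leader A z)"
    then have "A y z" using 1 trans by blast
    then have "leader A z \<le> y"
      unfolding leader_def by (rule Least_le)
    with y show False by simp
  qed
  show "A x y \<longleftrightarrow> leader A x = leader A y"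
  proof
    assume xy: "A x y"
    have "A u x \<longleftrightarrow> A u y" for u
      using xy trans sym by blast
    then show "leader A x = leader A y"
      by (simp add: leader_def)
  next
    assume "leader A x = leader A y"
    then show "A x y" using 1[of x] 1[of y] trans sym by metis
  qed
  show "lead A x \<longleftrightarrow> leader A x = x"
    using 1[of x] le[of x] lead[of x] unfolding lead_def by (metis le_neq_implies_less)
qed

text \<open>A class is named by its least element, so infinitely many classes means leaders beyond
  every bound. In this form the condition survives fusion, which freezes a new leader at each
  stage.\<close>

lemma Einf_iff: "A \<in> Einf \<longleftrightarrow> equivp A \<and> (\<forall>n. \<exists>x\<ge>n. lead A x)"
proof (cases "equivp A")
  case True
  have "classes A = (\<lambda>x. {y. A x y}) ` {x. lead A x}"
  proof -
    have "{y. A x y} = {y. A (leader A x) y}" for x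
      using equivp_leader(4,5)[OF True] equivp_leader(2)[OF True, of x] by auto
    moreover have "leader A x \<in> {x. lead A x}" for x
      using equivp_leader(2)[OF True] by simp
    ultimately have "{y. A x y} \<in> (\<lambda>x. {y. A x y}) ` {x. lead A x}" for x
      by (rule image_eqI)
    then show ?thesis
      by (auto simp: classes_def quotient_def)
  qed
  moreover have "inj_on (\<lambda>x. {y. A x y}) {x. lead A x}"
  proof (rule inj_onI)
    fix x y assume "x \<in> {x. lead A x}" "y \<in> {x. lead A x}" and eq: "{z. A x z} = {z. A y z}"
    then have "leader A x = x" "leader A y = y"
      using equivp_leader(5)[OF True] by auto
    moreover have "A x y"
      using eq equivp_reflp[OF True, of y] by auto
    ultimately show "x = y"
      using equivp_leader(4)[OF True] by simp
  qed
  ultimately have "finite (classes A) \<longleftrightarrow> finite {x. lead A x}"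
    by (simp add: finite_image_iff)
  then show ?thesis
    using True by (simp add: Einf_def infinite_nat_iff_unbounded_le)
qed (simp add: Einf_def)

lemma EinfD:
  assumes "A \<in> Einf"
  shows Einf_equivp: "equivp A" and Einf_refl: "A x x" and Einf_sym: "A x y \<Longrightarrow> A y x"
    and Einf_trans: "A x y \<Longrightarrow> A y z \<Longrightarrow> A x z" and Einf_lead: "\<exists>x\<ge>n. lead A x"
proof -
  show eq: "equivp A" and "\<exists>x\<ge>n. lead A x"
    using assms by (auto simp: Einf_iff)
  show "A x x" "A x y \<Longrightarrow> A y x" "A x y \<Longrightarrow> A y z \<Longrightarrow> A x z"
    using eq by (auto intro: equivp_reflp equivp_symp elim: equivp_transp)
qed

lemma kernel_in_Einf:
  assumes "\<And>n. \<exists>x\<ge>n. \<forall>y<x. r y \<noteq> r x"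
  shows "(\<lambda>x y. r x = r y) \<in> Einf"
proof -
  have "equivp (\<lambda>x y. r x = r y)"
    by (auto intro!: equivpI reflpI sympI transpI)
  then show ?thesis
    using assms by (simp add: Einf_iff lead_def)
qed

lemma coarsens_iff:
  assumes "A \<in> Einf" "B \<in> Einf"
  shows "coarsens A B \<longleftrightarrow> B \<le> A"
proof
  have cls: "C \<in> classes D \<longleftrightarrow> (\<exists>x. C = {y. D x y})" for C D
    by (auto simp: classes_def quotient_def)
  assume *: "coarsens A B"
  show "B \<le> A"
  proof (intro predicate2I)
    fix x y assume xy: "B x y"
    have "{z. A x z} \<in> classes A"
      by (auto simp: cls)
    then obtain S where S: "S \<subseteq> classes B" "{z. A x z} = \<Union>S"
      using * unfolding coarsens_def by blast
    have "x \<in> \<Union>S"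
      using S(2) Einf_refl[OF assms(1), of x] by blast
    then obtain w where w: "{z. B w z} \<in> S" "B w x"
      using S(1) by (auto simp: cls dest!: subsetD)
    then have "y \<in> \<Union>S"
      using xy Einf_trans[OF assms(2)] by blast
    then show "A x y"
      using S(2) by blast
  qed
next
  have cls: "C \<in> classes D \<longleftrightarrow> (\<exists>x. C = {y. D x y})" for C D
    by (auto simp: classes_def quotient_def)
  assume le: "B \<le> A"
  show "coarsens A B"
    unfolding coarsens_def
  proof
    fix C assume "C \<in> classes A"
    then obtain x where C: "C = {y. A x y}"
      by (auto simp: cls)
    have "C = \<Union>((\<lambda>y. {z. B y z}) ` C)"
    proof safe
      fix y assume "y \<in> C"
      then show "y \<in> \<Union>((\<lambda>y. {z. B y z}) ` C)"
        using Einf_refl[OF assms(2)] by blast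
    next
      fix y z assume "y \<in> C" "B y z"
      then show "z \<in> C"
        using C Einf_trans[OF assms(1)] predicate2D[OF le] by blast
    qed
    moreover have "(\<lambda>y. {z. B y z}) ` C \<subseteq> classes B"
      by (auto simp: cls)
    ultimately show "\<exists>S\<subseteq>classes B. C = \<Union>S"
      by blast
  qed
qed

lemma basic_nbhd_eq: "B \<in> Einf \<Longrightarrow> basic_nbhd M B = nb M B"
  by (auto simp: basic_nbhd_def nb_def agree_def coarsens_iff)

lemma agree_refl [simp]: "agree M A A"
  by (simp add: agree_def)

lemma agree_sym: "agree M A B \<Longrightarrow> agree M B A"
  by (simp add: agree_def)

lemma agree_trans: "agree M A B \<Longrightarrow> agree M B C \<Longrightarrow> agree M A C"
  by (simp add: agree_def)

lemma agree_mono: "agree M A B \<Longrightarrow> N \<le> M \<Longrightarrow> agree N A B"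
  by (simp add: agree_def)

lemma agreeD: "agree M A B \<Longrightarrow> i < M \<Longrightarrow> j < M \<Longrightarrow> A i j \<longleftrightarrow> B i j"
  by (simp add: agree_def)

lemma nbI: "A \<in> Einf \<Longrightarrow> B \<le> A \<Longrightarrow> agree M A B \<Longrightarrow> A \<in> nb M B"
  by (simp add: nb_def)

lemma nbD:
  assumes "A \<in> nb M B"
  shows "A \<in> Einf" "B \<le> A" "agree M A B"
  using assms by (auto simp: nb_def)

lemma nb_refl: "A \<in> Einf \<Longrightarrow> A \<in> nb M A"
  by (simp add: nb_def)

lemma nb_trans: "C \<in> nb M A \<Longrightarrow> A \<in> nb m B \<Longrightarrow> m \<le> M \<Longrightarrow> C \<in> nb m B"
  by (auto simp: nb_def intro: order_trans agree_trans agree_mono)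

lemma nb_mono: "C \<in> nb M A \<Longrightarrow> m \<le> M \<Longrightarrow> C \<in> nb m A"
  by (auto simp: nb_def intro: agree_mono)

lemma lead_antimono: "B \<le> A \<Longrightarrow> lead A x \<Longrightarrow> lead B x"
  unfolding lead_def by blast

lemma lead_agree: "agree M A B \<Longrightarrow> x < M \<Longrightarrow> lead A x \<longleftrightarrow> lead B x"
  unfolding lead_def agree_def by (metis order_less_trans)

definition next_lead :: "nat \<Rightarrow> (nat \<Rightarrow> nat \<Rightarrow> bool) \<Rightarrow> nat" where
  "next_lead M A = (LEAST x. M \<le> x \<and> lead A x)"

lemma next_lead:
  assumes "A \<in> Einf"
  shows "M \<le> next_lead M A" "lead A (next_lead M A)"
    "\<And>x. M \<le> x \<Longrightarrow> lead A x \<Longrightarrow> next_lead M A \<le> x"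
proof -
  obtain x where "M \<le> x" "lead A x"
    using Einf_lead[OF assms] by blast
  then have "M \<le> next_lead M A \<and> lead A (next_lead M A)"
    unfolding next_lead_def by (intro LeastI[of "\<lambda>x. M \<le> x \<and> lead A x" x] conjI)
  then show "M \<le> next_lead M A" "lead A (next_lead M A)" by auto
  show "next_lead M A \<le> x" if "M \<le> x" "lead A x" for x
    unfolding next_lead_def by (rule Least_le) (use that in blast)
qed

lemma next_lead_eqI:
  assumes "A \<in> Einf" "M \<le> x" "lead A x" "\<And>y. M \<le> y \<Longrightarrow> y < x \<Longrightarrow> \<not> lead A y"
  shows "next_lead M A = x"
  using next_lead[OF assms(1), of M] assms(2-4) by (meson le_neq_implies_less)

text \<open>When \<open>p\<close> is a coarsening of \<open>B\<close>, this is the finest coarsening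
  of \<open>B\<close> with the trace of \<open>p\<close> below \<open>M\<close>; its neighbourhood
  contains every coarsening with that trace. Only the finite trace matters, so \<open>p\<close> may
  be any relation that has it.\<close>

definition glue :: "nat \<Rightarrow> (nat \<Rightarrow> nat \<Rightarrow> bool) \<Rightarrow> (nat \<Rightarrow> nat \<Rightarrow> bool) \<Rightarrow> nat \<Rightarrow> nat \<Rightarrow> bool" where
  "glue M p B x y \<longleftrightarrow> B x y \<or> (\<exists>i<M. \<exists>j<M. B x i \<and> p i j \<and> B j y)"

lemma lead_glue: "lead B x \<Longrightarrow> M \<le> x \<Longrightarrow> lead (glue M p B) x"
  unfolding lead_def glue_def using not_less_iff_gr_or_eq by fastforce

lemma glue_cong: "agree M p q \<Longrightarrow> glue M p B = glue M q B"
  by (auto simp: glue_def agree_def fun_eq_iff)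

lemma glue:
  assumes A: "A \<in> Einf" and B: "B \<in> Einf" and le: "B \<le> A"
  shows "glue M A B \<in> Einf" "B \<le> glue M A B" "glue M A B \<le> A" "agree M (glue M A B) A"
    "A \<in> nb M (glue M A B)"
    "\<And>D. D \<in> Einf \<Longrightarrow> B \<le> D \<Longrightarrow> agree M D A \<Longrightarrow> D \<in> nb M (glue M A B)"
proof -
  note A' = Einf_refl[OF A] Einf_sym[OF A] Einf_trans[OF A]
  note B' = Einf_refl[OF B] Einf_sym[OF B] Einf_trans[OF B]
  show 1: "B \<le> glue M A B"
    by (auto simp: glue_def)
  have 2: "glue M A B \<le> D" if D: "D \<in> Einf" "B \<le> D" "agree M D A" for D
  proof (intro predicate2I)
    fix x y assume "glue M A B x y"
    then consider "B x y" | i j where "i < M" "j < M" "B x i" "A i j" "B j y"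
      by (auto simp: glue_def)
    then show "D x y"
    proof cases
      case 1
      then show ?thesis using D(2) by blast
    next
      case 2
      then have "D x i" "D i j" "D j y"
        using D by (auto simp: agree_def)
      then show ?thesis
        using Einf_trans[OF D(1)] by blast
    qed
  qed
  from 2[OF A le] show 3: "glue M A B \<le> A"
    by simp
  show 4: "agree M (glue M A B) A"
    unfolding agree_def
  proof safe
    fix i j assume ij: "i < M" "j < M"
    show "A i j" if "glue M A B i j"
      using 3 that by blast
    show "glue M A B i j" if "A i j"
      using ij that B'(1) unfolding glue_def by blast
  qed
  have "equivp (glue M A B)"
  proof (intro equivpI reflpI sympI transpI)
    show "glue M A B x x" for x
      using B'(1) by (simp add: glue_def)
    show "glue M A B y x" if "glue M A B x y" for x y
      using that B'(2) A'(2) unfolding glue_def by blast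
    fix x y z assume xy: "glue M A B x y" and yz: "glue M A B y z"
    show "glue M A B x z"
    proof (cases "B x y \<or> B y z")
      case True
      then show ?thesis
        using xy yz B'(3) unfolding glue_def by blast
    next
      case False
      then obtain i j k l where *: "i < M" "j < M" "B x i" "A i j" "B j y"
        "k < M" "l < M" "B y k" "A k l" "B l z"
        using xy yz unfolding glue_def by blast
      then have "A j k"
        using B'(3) le by blast
      then have "A i l"
        using * A'(3) by blast
      then show ?thesis
        using * unfolding glue_def by blast
    qed
  qed
  moreover have "\<exists>x\<ge>n. lead (glue M A B) x" for n
  proof -
    obtain x where x: "x \<ge> max n M" "lead B x"
      using Einf_lead[OF B] by blast
    then have "lead (glue M A B) x"
      by (intro lead_glue) auto
    then show ?thesis
      using x by (intro exI[of _ x]) auto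
  qed
  ultimately show 5: "glue M A B \<in> Einf"
    by (simp add: Einf_iff)
  show 6: "D \<in> nb M (glue M A B)" if "D \<in> Einf" "B \<le> D" "agree M D A" for D
    using that 2[OF that] agree_trans[OF that(3) agree_sym[OF 4]] by (simp add: nbI)
  show "A \<in> nb M (glue M A B)"
    using 6[OF A le] by simp
qed

text \<open>
  The relation \<open>B'\<close> keeps the \<open>B\<close>-classes that meet \<open>{..<M}\<close> apart and merges the others as \<open>C\<close> does; a
  \<open>B\<close>-class that \<open>C\<close> attaches to the initial segment is attached to the \<open>B\<close>-class of the least possible point.
\<close>

lemma amalgamation:
  assumes A: "A \<in> Einf" and B: "B \<in> Einf" and le: "B \<le> A" and C: "C \<in> nb M A"
  obtains B' where "B' \<in> nb M B" "\<And>D. D \<in> Einf \<Longrightarrow> B' \<le> D \<Longrightarrow> agree M D A \<Longrightarrow> D \<in> nb M C"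
proof -
  note C' = nbD[OF C]
  have BC: "B \<le> C"
    using le C'(2) by (rule order_trans)
  note LB = equivp_leader[OF Einf_equivp[OF B]] and LC = equivp_leader[OF Einf_equivp[OF C'(1)]]
  define r where "r x = (if leader B x < M then leader B x else leader C x)" for x
  define B' where "B' x y \<longleftrightarrow> r x = r y" for x y
  have lead_CB: "leader B (leader C x) = leader C x" for x
    using LC(2)[of x] lead_antimono[OF BC] LB(5) by blast
  have C_B: "leader C x = leader C y" if "leader B x = leader B y" for x y
    using that LB(4) LC(4) BC by blast
  have "C (leader B x) x" for x
    using LB(1) BC by blast
  then have C_lB: "leader C (leader B x) = leader C x" for x
    using LC(4) by simp
  have r_idem: "r (r x) = r x" for x
    using lead_CB[of x] LB(2,5) LC(2,5) by (auto simp: r_def)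
  have C_r: "C x (r x)" for x
    using LC(4) C_lB[of x] LC(2,5) by (auto simp: r_def)
  have "B' \<in> Einf"
  proof -
    have "\<exists>x\<ge>n. \<forall>y<x. r y \<noteq> r x" for n
    proof -
      obtain x where x: "x \<ge> max n M" "lead C x"
        using Einf_lead[OF C'(1)] by blast
      have "leader C x = x" "leader B x = x"
        using x LC(5) LB(5) lead_antimono[OF BC] by blast+
      then have "r x = x"
        by (simp add: r_def)
      moreover have "r y \<le> y" for y
        using LB(3)[of y] LC(3)[of y] by (simp add: r_def)
      ultimately show ?thesis
        using x by (metis leD max.boundedE)
    qed
    then show ?thesis
      unfolding B'_def by (rule kernel_in_Einf)
  qed
  moreover have "B \<le> B'"
  proof (intro predicate2I)
    fix x y assume "B x y"
    then have "leader B x = leader B y"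
      using LB(4) by blast
    with C_B[OF this] show "B' x y"
      by (simp add: B'_def r_def)
  qed
  moreover have "agree M B' B"
    unfolding agree_def
  proof safe
    fix i j assume "i < M" "j < M"
    then have "leader B i < M" "leader B j < M"
      using LB(3)[of i] LB(3)[of j] by auto
    then show "B' i j \<Longrightarrow> B i j" "B i j \<Longrightarrow> B' i j"
      using LB(4) by (auto simp: B'_def r_def)
  qed
  ultimately have "B' \<in> nb M B"
    by (rule nbI)
  moreover have "D \<in> nb M C" if D: "D \<in> Einf" "B' \<le> D" "agree M D A" for D
  proof (rule nbI[OF D(1)])
    have DC: "agree M D C"
      using D(3) agree_sym[OF C'(3)] by (rule agree_trans)
    then show "agree M D C" .
    have "B' x (r x)" for x
      by (simp add: B'_def r_idem)
    then have D_r: "D x (r x)" for x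
      using D(2) by blast
    show "C \<le> D"
    proof (intro predicate2I)
      fix x y assume xy: "C x y"
      have *: "leader C x = leader C y"
        using xy LC(4) by simp
      \<comment> \<open>Below \<open>M\<close> the relations \<open>D\<close> and \<open>C\<close>
        agree. If one of \<open>r x\<close>, \<open>r y\<close> is not below \<open>M\<close>, it is
        a \<open>C\<close>-leader, and as a \<open>C\<close>-leader never exceeds the corresponding
        \<open>B\<close>-leader, the other is the same point.\<close>
      have "D (r x) (r y)"
      proof (cases "r x < M \<and> r y < M")
        case True
        have "C (r x) (r y)"
          using C_r[of x] C_r[of y] xy Einf_sym[OF C'(1)] Einf_trans[OF C'(1)] by blast
        then show ?thesis
          using True DC by (simp add: agreeD)
      next
        case False
        have "leader C x \<le> leader B x" "leader C y \<le> leader B y"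
          using C_lB[of x] C_lB[of y] LC(3)[of "leader B x"] LC(3)[of "leader B y"] by auto
        then have "r x = r y"
          using False * by (auto simp: r_def split: if_splits)
        then show ?thesis
          using Einf_refl[OF D(1)] by simp
      qed
      then show "D x y"
        using D_r[of x] D_r[of y] Einf_sym[OF D(1)] Einf_trans[OF D(1)] by blast
    qed
  qed
  ultimately show ?thesis
    using that by blast
qed

section \<open>Finite traces and fusion sequences\<close>

definition pat :: "nat \<Rightarrow> (nat \<Rightarrow> nat \<Rightarrow> bool) \<Rightarrow> (nat \<times> nat) set" where
  "pat M A = {(i, j). i < M \<and> j < M \<and> A i j}"

lemma pat_eq_iff: "pat M A = pat M B \<longleftrightarrow> agree M A B"
  by (auto simp: pat_def agree_def)

lemma finite_pats: "finite (range (pat M))"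
proof (rule finite_subset)
  show "range (pat M) \<subseteq> Pow ({..<M} \<times> {..<M})"
    by (auto simp: pat_def)
qed auto

text \<open>The finitely many traces below \<open>M\<close> are treated in turn: shrink the largest
  coarsening with the given trace into \<open>R\<close>, and carry this back by
  \<open>amalgamation\<close>, which leaves \<open>B\<close> unchanged below \<open>M\<close>.
  Heredity of \<open>R\<close> protects the traces already treated.\<close>

lemma one_stage:
  assumes B: "B \<in> Einf"
    and her: "\<And>A C. A \<in> Einf \<Longrightarrow> B \<le> A \<Longrightarrow> R A \<Longrightarrow> C \<in> nb M A \<Longrightarrow> R C"
    and dense: "\<And>A. A \<in> Einf \<Longrightarrow> B \<le> A \<Longrightarrow> \<exists>C\<in>nb M A. R C"
  shows "\<exists>B'\<in>nb M B. \<forall>A\<in>Einf. B' \<le> A \<longrightarrow> R A"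
proof -
  have "\<exists>B'\<in>nb M B. \<forall>A\<in>Einf. B' \<le> A \<longrightarrow> pat M A \<in> S \<longrightarrow> R A" if "finite S" for S
    using that
  proof (induction S)
    case empty
    then show ?case using B nb_refl by blast
  next
    case (insert p S)
    then obtain B1 where B1: "B1 \<in> nb M B"
      and R1: "\<And>A. A \<in> Einf \<Longrightarrow> B1 \<le> A \<Longrightarrow> pat M A \<in> S \<Longrightarrow> R A"
      by blast
    show ?case
    proof (cases "\<exists>A\<in>Einf. B1 \<le> A \<and> pat M A = p")
      case False
      then show ?thesis
        using B1 R1 by blast
    next
      case True
      then obtain A where A: "A \<in> Einf" "B1 \<le> A" "pat M A = p"
        by blast
      note g = glue[where M = M, OF A(1) nbD(1)[OF B1] A(2)]
      have "B \<le> glue M A B1"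
        using nbD(2)[OF B1] g(2) by (rule order_trans)
      then obtain C where C: "C \<in> nb M (glue M A B1)" "R C"
        using dense[OF g(1)] by blast
      obtain B2 where B2: "B2 \<in> nb M B1"
        "\<And>D. D \<in> Einf \<Longrightarrow> B2 \<le> D \<Longrightarrow> agree M D (glue M A B1) \<Longrightarrow> D \<in> nb M C"
        using amalgamation[OF g(1) nbD(1)[OF B1] g(2) C(1)] by blast
      have "R D" if D: "D \<in> Einf" "B2 \<le> D" "pat M D \<in> insert p S" for D
      proof (cases "pat M D = p")
        case True
        then have "agree M D A"
          using A(3) by (simp flip: pat_eq_iff)
        then have "agree M D (glue M A B1)"
          using agree_sym[OF g(4)] by (rule agree_trans)
        then have "D \<in> nb M C"
          using B2(2) D by blast
        moreover have "B \<le> C"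
          using \<open>B \<le> glue M A B1\<close> nbD(2)[OF C(1)] by (rule order_trans)
        ultimately show ?thesis
          using her C nbD(1)[OF C(1)] by blast
      next
        case False
        then show ?thesis
          using R1 D order_trans[OF nbD(2)[OF B2(1)] D(2)] by blast
      qed
      then show ?thesis
        using nb_trans[OF B2(1) B1 order_refl] by blast
    qed
  qed
  from this[OF finite_pats[of M]] show ?thesis
    by simp
qed

text \<open>The limit is a union of relations frozen on growing initial segments. The leader between
  \<open>N k\<close> and \<open>N (Suc k)\<close> is frozen with them, which is why the limit keeps
  infinitely many classes.\<close>

lemma fusion_limit:
  assumes AE: "\<And>k. A k \<in> Einf" and AS: "\<And>k. A (Suc k) \<in> nb (N k) (A k)"
    and grow: "\<And>k. \<exists>x. N k \<le> x \<and> x < N (Suc k) \<and> lead (A (Suc k)) x"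
  shows "\<exists>L. \<forall>k. L \<in> nb (N k) (A k)"
proof -
  have N_less: "N k < N (Suc k)" for k
    using grow[of k] by auto
  then have sm: "strict_mono N"
    by (simp add: strict_mono_Suc_iff)
  have kN: "k \<le> N k" for k
    using strict_mono_imp_increasing[OF sm, of k] by simp
  have A_nb: "A l \<in> nb (N k) (A k)" if "k \<le> l" for k l
    using that
  proof (induction rule: dec_induct)
    case base
    then show ?case using nb_refl AE by blast
  next
    case (step n)
    have "N k \<le> N n"
      using strict_mono_less_eq[OF sm, of k n] step(1) by simp
    then show ?case
      using nb_trans[OF AS[of n] step(3)] by simp
  qed
  \<comment> \<open>As \<open>k \<le> N k\<close>, the pair is frozen from stage
    \<open>Suc (max i j)\<close> on.\<close>
  define L where "L i j = A (Suc (max i j)) i j" for i j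
  have L_eq: "L i j \<longleftrightarrow> A k i j" if "i < N k" "j < N k" for i j k
  proof -
    let ?n = "Suc (max i j)"
    have n: "i < N ?n" "j < N ?n"
      using kN[of ?n] by auto
    show ?thesis
    proof (cases "k \<le> ?n")
      case True
      then show ?thesis
        using agreeD[OF nbD(3)[OF A_nb[OF True]] that] by (simp add: L_def)
    next
      case False
      then show ?thesis
        using agreeD[OF nbD(3)[OF A_nb[of ?n k]] n] by (simp add: L_def)
    qed
  qed
  have big: "\<exists>k. i < N k \<and> j < N k \<and> h < N k \<and> n \<le> k" for i j h n
    using kN[of "Suc (i + j + h + n)"] by (intro exI[of _ "Suc (i + j + h + n)"]) auto
  have "equivp L"
  proof (intro equivpI reflpI sympI transpI)
    show "L i i" for i
      using Einf_refl[OF AE] by (simp add: L_def)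
    show "L j i" if "L i j" for i j
      using that Einf_sym[OF AE] by (simp add: L_def max.commute)
    fix i j h assume L: "L i j" "L j h"
    obtain k where k: "i < N k" "j < N k" "h < N k"
      using big by blast
    then have "A k i h"
      using L L_eq Einf_trans[OF AE[of k], of i j h] by simp
    then show "L i h"
      using L_eq k by simp
  qed
  have AL: "A k \<le> L" for k
  proof (intro predicate2I)
    fix i j assume *: "A k i j"
    obtain l where l: "i < N l" "j < N l" "k \<le> l"
      using big by blast
    have "A l i j"
      using * nbD(2)[OF A_nb[OF l(3)]] by blast
    then show "L i j"
      using L_eq l by simp
  qed
  have agree_L: "agree (N k) L (A k)" for k
    using L_eq by (simp add: agree_def)
  have "\<exists>x\<ge>n. lead L x" for n
  proof -
    obtain x where x: "N n \<le> x" "x < N (Suc n)" "lead (A (Suc n)) x"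
      using grow by blast
    then have "lead L x"
      using lead_agree[OF agree_L] by blast
    then show ?thesis
      using x kN[of n] by (intro exI[of _ x]) simp
  qed
  with \<open>equivp L\<close> have "L \<in> Einf"
    by (simp add: Einf_iff)
  then show ?thesis
    using AL agree_L by (intro exI[of _ L] allI nbI)
qed

text \<open>Each stage raises the height just past the next leader, so every leader
  \<open>x \<ge> m\<close> of the limit is met at height \<open>Suc x\<close>. Density is demanded
  at these heights alone because \<open>open_Ramsey\<close> has neighbourhoods decided only
  there.\<close>

lemma fusion:
  assumes B: "B \<in> Einf"
    and her: "\<And>M A C. A \<in> Einf \<Longrightarrow> B \<le> A \<Longrightarrow> Q M A \<Longrightarrow> C \<in> nb M A \<Longrightarrow> Q M C"
    and dense: "\<And>M A. A \<in> Einf \<Longrightarrow> B \<le> A \<Longrightarrow> M = m \<or> (\<exists>x\<ge>m. M = Suc x \<and> lead B x) \<Longrightarrow> \<exists>C\<in>nb M A. Q M C"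
  shows "\<exists>L\<in>nb m B. Q m L \<and> (\<forall>x\<ge>m. lead L x \<longrightarrow> Q (Suc x) L)"
proof -
  define inv where "inv s \<longleftrightarrow> snd s \<in> nb m B \<and> Q (fst s) (snd s) \<and> m \<le> fst s" for s
  define step where "step s t \<longleftrightarrow> fst t = Suc (next_lead (fst s) (snd s)) \<and> snd t \<in> nb (fst t) (snd s)" for s t
  have start: "\<exists>C. inv (m, C)"
    using dense[OF B order_refl, of m] by (auto simp: inv_def)
  have ex_step: "\<exists>t. inv t \<and> step s t" if "inv s" for s
  proof -
    have s: "snd s \<in> nb m B" "m \<le> fst s"
      using that by (auto simp: inv_def)
    define x where "x = next_lead (fst s) (snd s)"
    have x: "fst s \<le> x" "lead (snd s) x"
      unfolding x_def using next_lead[OF nbD(1)[OF s(1)]] by auto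
    then have "\<exists>y\<ge>m. Suc x = Suc y \<and> lead B y"
      using s lead_antimono[OF nbD(2)[OF s(1)] x(2)] by (intro exI[of _ x]) simp
    then obtain C where C: "C \<in> nb (Suc x) (snd s)" "Q (Suc x) C"
      using dense[OF nbD(1,2)[OF s(1)], of "Suc x"] by blast
    have "inv (Suc x, C)" "step s (Suc x, C)"
      using C s x nb_trans[OF C(1) s(1)] by (auto simp: inv_def step_def x_def)
    then show ?thesis by blast
  qed
  obtain C0 where C0: "inv (m, C0)"
    using start by blast
  have "\<exists>f. \<forall>k. (inv (f k) \<and> (k = 0 \<longrightarrow> f k = (m, C0))) \<and> step (f k) (f (Suc k))"
  proof (rule dependent_nat_choice)
    show "\<exists>s. inv s \<and> (0 = 0 \<longrightarrow> s = (m, C0))" using C0 by auto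
    fix s and k :: nat
    assume "inv s \<and> (k = 0 \<longrightarrow> s = (m, C0))"
    then show "\<exists>t. (inv t \<and> (Suc k = 0 \<longrightarrow> t = (m, C0))) \<and> step s t"
      using ex_step by auto
  qed
  then obtain f where f: "\<And>k. inv (f k)" "\<And>k. step (f k) (f (Suc k))" "f 0 = (m, C0)"
    by auto
  define N where "N k = fst (f k)" for k
  define A where "A k = snd (f k)" for k
  have A0: "A k \<in> nb m B" and QA: "Q (N k) (A k)" and mN: "m \<le> N k" for k
    using f(1)[of k] by (auto simp: inv_def A_def N_def)
  have NS: "N (Suc k) = Suc (next_lead (N k) (A k))" and AS: "A (Suc k) \<in> nb (N (Suc k)) (A k)" for k
    using f(2)[of k] by (auto simp: step_def A_def N_def)
  have N_less: "N k < N (Suc k)" for k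
    using NS[of k] next_lead(1)[OF nbD(1)[OF A0[of k]], of "N k"] by simp
  then have kN: "k \<le> N k" for k
    using strict_mono_imp_increasing[of N k] by (simp add: strict_mono_Suc_iff)
  have "\<exists>L. \<forall>k. L \<in> nb (N k) (A k)"
  proof (rule fusion_limit)
    show "A k \<in> Einf" for k
      using nbD(1)[OF A0] .
    show "A (Suc k) \<in> nb (N k) (A k)" for k
      using nb_mono[OF AS] N_less[of k] by simp
    show "\<exists>x. N k \<le> x \<and> x < N (Suc k) \<and> lead (A (Suc k)) x" for k
      using next_lead[OF nbD(1)[OF A0[of k]], of "N k"] NS[of k] lead_agree[OF nbD(3)[OF AS[of k]]]
      by (intro exI[of _ "next_lead (N k) (A k)"]) simp
  qed
  then obtain L where L_nb: "\<And>k. L \<in> nb (N k) (A k)"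
    by blast
  have "L \<in> nb m B"
    using nb_trans[OF L_nb[of 0] A0 mN] .
  moreover have Q: "Q (N k) L" for k
    using her[OF nbD(1,2)[OF A0] QA L_nb] .
  moreover have "N 0 = m"
    using f(3) by (simp add: N_def)
  moreover have "Q (Suc x) L" if x: "x \<ge> m" "lead L x" for x
  proof -
    \<comment> \<open>\<open>k\<close> is the stage that passes \<open>x\<close>. A leader of
      \<open>L\<close> is a leader of \<open>A k\<close>, so the height \<open>N (Suc k)\<close>,
      placed just above the next leader, cannot skip \<open>x\<close>.\<close>
    define k where "k = (LEAST k. x < N (Suc k))"
    have "x < N (Suc x)" using kN[of "Suc x"] by simp
    then have k: "x < N (Suc k)"
      unfolding k_def by (rule LeastI)
    have "N k \<le> x"
    proof (cases k)
      case 0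
      then show ?thesis using x \<open>N 0 = m\<close> by simp
    next
      case (Suc j)
      then have "\<not> x < N (Suc j)"
        using not_less_Least[of j "\<lambda>k. x < N (Suc k)"] by (simp add: k_def)
      then show ?thesis using Suc by simp
    qed
    moreover have "lead (A k) x"
      using lead_antimono[OF nbD(2)[OF L_nb] x(2)] .
    ultimately have "next_lead (N k) (A k) \<le> x"
      using next_lead(3)[OF nbD(1)[OF A0]] by blast
    then have "Suc x = N (Suc k)"
      using NS[of k] k by simp
    then show ?thesis using Q by metis
  qed
  ultimately show ?thesis by metis
qed

text \<open>Fusion for the property that \<open>R M\<close> holds at all coarsenings;
  \<open>one_stage\<close> supplies its density.\<close>

lemma fusion_all:
  assumes B: "B \<in> Einf"
    and her: "\<And>M A C. A \<in> Einf \<Longrightarrow> B \<le> A \<Longrightarrow> R M A \<Longrightarrow> C \<in> nb M A \<Longrightarrow> R M C"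
    and dense: "\<And>M A. A \<in> Einf \<Longrightarrow> B \<le> A \<Longrightarrow> M = m \<or> (\<exists>x\<ge>m. M = Suc x \<and> lead B x) \<Longrightarrow> \<exists>C\<in>nb M A. R M C"
  shows "\<exists>L\<in>nb m B. \<forall>A\<in>Einf. L \<le> A \<longrightarrow> R m A \<and> (\<forall>x\<ge>m. lead L x \<longrightarrow> R (Suc x) A)"
proof -
  have "\<exists>L\<in>nb m B. (\<forall>A\<in>Einf. L \<le> A \<longrightarrow> R m A) \<and>
      (\<forall>x\<ge>m. lead L x \<longrightarrow> (\<forall>A\<in>Einf. L \<le> A \<longrightarrow> R (Suc x) A))"
  proof (rule fusion[OF B, of "\<lambda>M L. \<forall>A\<in>Einf. L \<le> A \<longrightarrow> R M A"])
    fix M C D assume C: "\<forall>A\<in>Einf. C \<le> A \<longrightarrow> R M A" and D: "D \<in> nb M C"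
    then show "\<forall>A\<in>Einf. D \<le> A \<longrightarrow> R M A"
      using nbD(2)[OF D] order_trans by blast
  next
    fix M A assume A: "A \<in> Einf" "B \<le> A" and M: "M = m \<or> (\<exists>x\<ge>m. M = Suc x \<and> lead B x)"
    show "\<exists>C\<in>nb M A. \<forall>D\<in>Einf. C \<le> D \<longrightarrow> R M D"
    proof (rule one_stage[OF A(1)])
      show "R M C" if "D \<in> Einf" "A \<le> D" "R M D" "C \<in> nb M D" for C D
        using her[OF that(1) order_trans[OF A(2) that(2)] that(3,4)] .
      show "\<exists>C\<in>nb M D. R M C" if "D \<in> Einf" "A \<le> D" for D
        using dense[OF that(1) order_trans[OF A(2) that(2)] M] .
    qed
  qed
  then obtain L where "L \<in> nb m B" "\<forall>A\<in>Einf. L \<le> A \<longrightarrow> R m A"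
    "\<forall>x\<ge>m. lead L x \<longrightarrow> (\<forall>A\<in>Einf. L \<le> A \<longrightarrow> R (Suc x) A)"
    by auto
  then show ?thesis
    by (intro bexI[of _ L] ballI impI conjI allI) simp_all
qed

section \<open>Open Ramsey sets\<close>

text \<open>A coarsening is described by moving leaders downwards. A leader fixed by
  \<open>r\<close> is then still least in its class, so unboundedly many fixed leaders leave
  infinitely many classes.\<close>

lemma quotient_in_nb:
  assumes A: "A \<in> Einf" and r_le: "\<And>z. lead A z \<Longrightarrow> r z \<le> z" and r_id: "\<And>z. z < M \<Longrightarrow> r z = z"
    and unbounded: "\<And>n. \<exists>x\<ge>n. lead A x \<and> r x = x"
  shows "(\<lambda>x y. r (leader A x) = r (leader A y)) \<in> nb M A"
proof (rule nbI)
  note LA = equivp_leader[OF Einf_equivp[OF A]]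
  have "\<exists>x\<ge>n. \<forall>y<x. r (leader A y) \<noteq> r (leader A x)" for n
  proof -
    obtain x where x: "x \<ge> n" "lead A x" "r x = x"
      using unbounded by blast
    have "r (leader A y) \<noteq> r (leader A x)" if "y < x" for y
    proof -
      have "r (leader A y) \<le> leader A y" "leader A y \<le> y"
        using LA(2,3) r_le by auto
      then have "r (leader A y) < x"
        using that by simp
      moreover have "leader A x = x"
        using x LA(5) by simp
      ultimately show ?thesis
        using x(3) by simp
    qed
    then show ?thesis
      using x(1) by blast
  qed
  then show "(\<lambda>x y. r (leader A x) = r (leader A y)) \<in> Einf"
    by (rule kernel_in_Einf)
  show "A \<le> (\<lambda>x y. r (leader A x) = r (leader A y))"
  proof (intro predicate2I)
    fix x y assume "A x y"
    then have "leader A x = leader A y" using LA(4) by blast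
    then show "r (leader A x) = r (leader A y)" by simp
  qed
  show "agree M (\<lambda>x y. r (leader A x) = r (leader A y)) A"
    unfolding agree_def
  proof (intro allI impI)
    fix i j assume "i < M" "j < M"
    then have "r (leader A i) = leader A i" "r (leader A j) = leader A j"
      using LA(3)[of i] LA(3)[of j] by (auto intro!: r_id)
    then show "r (leader A i) = r (leader A j) \<longleftrightarrow> A i j"
      using LA(4)[of i j] by simp
  qed
qed

text \<open>\<open>H\<close> sees \<open>C\<close> only up to its first new leader, and there
  \<open>C\<close> is a finite word: letter \<open>i\<close> is the old class that absorbs the
  \<open>i\<close>-th new class of \<open>A\<close>. A variable word from
  \<open>Carlson_Simpson\<close> is then a coarsening \<open>A'\<close>, and filling its variables
  gives the words of the members of \<open>nb M A'\<close>.\<close>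

lemma dual_pigeonhole:
  assumes A: "A \<in> Einf"
    and H: "\<And>C D. C \<in> nb M A \<Longrightarrow> D \<in> nb M A \<Longrightarrow> agree (Suc (next_lead M C)) C D \<Longrightarrow> H C = H D"
  shows "\<exists>A'\<in>nb M A. (\<forall>C\<in>nb M A'. H C) \<or> (\<forall>C\<in>nb M A'. \<not> H C)"
proof (cases "M = 0")
  case True
  \<comment> \<open>Without old classes the alphabet is empty, but then the first new leader is
    \<open>0\<close> and \<open>H\<close> sees a single point.\<close>
  have "H C = H A" if C: "C \<in> nb M A" for C
  proof (rule H[OF C nb_refl[OF A]])
    have "next_lead 0 C = 0"
      using nbD(1)[OF C] by (rule next_lead_eqI) (auto simp: lead_def)
    then show "agree (Suc (next_lead M C)) C A"
      using True Einf_refl[OF nbD(1)[OF C]] Einf_refl[OF A] by (simp add: agree_def)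
  qed
  then show ?thesis
    using nb_refl[OF A] by blast
next
  case False
  note LA = equivp_leader[OF Einf_equivp[OF A]]
  define S where "S = {x. M \<le> x \<and> lead A x}"
  have "infinite S"
    using Einf_lead[OF A] unfolding S_def infinite_nat_iff_unbounded_le
    by (metis max.boundedE mem_Collect_eq)
  define e where "e = enumerate S"
  have sm: "strict_mono e"
    unfolding e_def using \<open>infinite S\<close> by (rule strict_mono_enumerate)
  have range_e: "range e = S"
    unfolding e_def using \<open>infinite S\<close> by (rule range_enumerate)
  have e_lead: "lead A (e i)" and e_ge: "M \<le> e i" for i
    using range_e by (auto simp: S_def)
  have e_ex: "\<exists>i. z = e i" if "M \<le> z" "lead A z" for z
    using that range_e by (auto simp: S_def)
  have inv_e [simp]: "inv e (e i) = i" for i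
    using strict_mono_imp_inj_on[OF sm] by simp
  have e_le: "e i \<le> e j \<longleftrightarrow> i \<le> j" and e_less: "e i < e j \<longleftrightarrow> i < j" for i j
    using strict_mono_less_eq[OF sm] strict_mono_less[OF sm] by auto
  have e_self: "n \<le> e n" for n
    using strict_mono_imp_increasing[OF sm] by simp
  define \<Sigma> where "\<Sigma> = {x. x < M \<and> lead A x}"
  have \<Sigma>: "finite \<Sigma>" "0 \<in> \<Sigma>"
    using False by (auto simp: \<Sigma>_def lead_def)
  \<comment> \<open>New classes with index at least the length of \<open>w\<close> stay as they are,
    so \<open>e (length w)\<close> is the first new leader of \<open>Cw w\<close>.\<close>
  define \<rho> where "\<rho> w z = (if M \<le> z \<and> inv e z < length w then w ! (inv e z) else z)"
    for w :: "nat list" and z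
  define Cw where "Cw w = (\<lambda>x y. \<rho> w (leader A x) = \<rho> w (leader A y))" for w
  have Cw: "Cw w \<in> nb M A" if w: "w \<in> lists \<Sigma>" for w
    unfolding Cw_def
  proof (rule quotient_in_nb[OF A])
    show "\<rho> w z \<le> z" if z: "lead A z" for z
    proof (cases "M \<le> z \<and> inv e z < length w")
      case True
      then have "w ! (inv e z) \<in> \<Sigma>"
        using w by (meson in_lists_conv_set nth_mem)
      then show ?thesis
        using True by (simp add: \<rho>_def \<Sigma>_def)
    qed (auto simp: \<rho>_def)
    show "\<rho> w z = z" if "z < M" for z
      using that by (simp add: \<rho>_def)
    show "\<exists>x\<ge>n. lead A x \<and> \<rho> w x = x" for n
      using e_self[of "max n (length w)"] e_lead
      by (intro exI[of _ "e (max n (length w))"]) (simp add: \<rho>_def)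
  qed
  obtain V c where V: "\<And>n. variable_word \<Sigma> V n" and V_inf: "\<And>n. \<exists>i\<ge>n. V i = Inr i"
    and V_c: "\<And>i b. V i = Inr i \<Longrightarrow> range b \<subseteq> \<Sigma> \<Longrightarrow> H (Cw (fill b V i)) = c"
    using \<Sigma> by (auto intro: Carlson_Simpson[of \<Sigma> "\<lambda>w. H (Cw w)"])
  have V_at: "case V i of Inl a \<Rightarrow> a \<in> \<Sigma> | Inr j \<Rightarrow> j \<le> i \<and> V j = Inr j" for i
    using V[of "Suc i", unfolded variable_word_def, rule_format, of i] by simp
  have VL: "a \<in> \<Sigma>" if "V i = Inl a" for i a
    using V_at[of i] that by simp
  have VR: "j \<le> i \<and> V j = Inr j" if "V i = Inr j" for i j
    using V_at[of i] that by simp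
  define r where "r z = (if M \<le> z then case V (inv e z) of Inl a \<Rightarrow> a | Inr j \<Rightarrow> e j else z)" for z
  have r_e: "r (e i) = (case V i of Inl a \<Rightarrow> a | Inr j \<Rightarrow> e j)" for i
    using e_ge by (simp add: r_def)
  have r_\<Sigma>: "r a = a" if "a \<in> \<Sigma>" for a
    using that by (simp add: r_def \<Sigma>_def)
  define A' where "A' = (\<lambda>x y. r (leader A x) = r (leader A y))"
  have A'_lead: "A' x y \<longleftrightarrow> r x = r y" if "lead A x" "lead A y" for x y
    using that LA(5) by (simp add: A'_def)
  have A': "A' \<in> nb M A"
    unfolding A'_def
  proof (rule quotient_in_nb[OF A])
    show "r z \<le> z" if z: "lead A z" for z
    proof (cases "M \<le> z")
      case True
      then obtain i where i: "z = e i"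
        using e_ex z by blast
      show ?thesis
      proof (cases "V i")
        case (Inl a)
        then show ?thesis
          using VL[OF Inl] True i by (simp add: r_e \<Sigma>_def)
      next
        case (Inr j)
        then show ?thesis
          using VR[OF Inr] i by (simp add: r_e e_le)
      qed
    qed (simp add: r_def)
    show "r z = z" if "z < M" for z
      using that by (simp add: r_def)
    show "\<exists>x\<ge>n. lead A x \<and> r x = x" for n
    proof -
      obtain i where "i \<ge> n" "V i = Inr i"
        using V_inf by blast
      then show ?thesis
        using e_self[of i] e_lead by (intro exI[of _ "e i"]) (simp add: r_e)
    qed
  qed
  have "H C = c" if C: "C \<in> nb M A'" for C
  proof -
    have CA: "C \<in> nb M A"
      using nb_trans[OF C A'] by simp
    note C' = nbD[OF CA] and LC = equivp_leader[OF Einf_equivp[OF nbD(1)[OF CA]]]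
    define x where "x = next_lead M C"
    have x: "M \<le> x" "lead C x" and x_least: "\<And>y. M \<le> y \<Longrightarrow> lead C y \<Longrightarrow> x \<le> y"
      unfolding x_def using next_lead[OF C'(1)] by auto
    have xA': "lead A' x"
      using lead_antimono[OF nbD(2)[OF C] x(2)] .
    have xA: "lead A x"
      using lead_antimono[OF nbD(2)[OF A'] xA'] .
    obtain q where q: "x = e q"
      using e_ex[OF x(1) xA] by blast
    \<comment> \<open>A letter or an older variable at position \<open>q\<close> would make
      \<open>A'\<close> join \<open>x\<close> to a smaller point.\<close>
    have Vq: "V q = Inr q"
    proof (cases "V q")
      case (Inl a)
      then have a: "a < M" "lead A a" "r a = a"
        using VL[OF Inl] r_\<Sigma> by (auto simp: \<Sigma>_def)
      then have "A' a x"
        using A'_lead[OF a(2) xA] Inl by (simp add: q r_e)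
      then show ?thesis
        using xA' a x(1) by (simp add: lead_def)
    next
      case (Inr j)
      then have j: "j \<le> q" "V j = Inr j"
        using VR by auto
      then have "A' (e j) x"
        using A'_lead[OF e_lead xA] Inr by (simp add: q r_e)
      then have "\<not> e j < x"
        using xA' by (auto simp: lead_def)
      then show ?thesis
        using j Inr by (simp add: q e_less)
    qed
    have lead_\<Sigma>: "leader C a = a" if "a \<in> \<Sigma>" for a
      using that lead_agree[OF C'(3), of a] LC(5) by (simp add: \<Sigma>_def)
    \<comment> \<open>Variable \<open>j\<close> is filled by the old class to which \<open>C\<close>
      attaches \<open>e j\<close>. The default \<open>0\<close>, an old leader because
      \<open>M > 0\<close>, serves those \<open>e j\<close> that are not attached to an old class;
      their variables do not occur before position \<open>q\<close>.\<close>
    define b where "b j = (if leader C (e j) < M then leader C (e j) else 0)" for j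
    have b: "range b \<subseteq> \<Sigma>"
      using \<Sigma>(2) lead_antimono[OF C'(2) LC(2)] by (auto simp: b_def \<Sigma>_def)
    define w where "w = fill b V q"
    have w: "w \<in> lists \<Sigma>" "length w = q"
      unfolding w_def using fill_in_lists[OF V b] by (auto simp: fill_def)
    have key: "leader C y = \<rho> w (leader A y)" if y: "y \<le> x" for y
    proof -
      define z where "z = leader A y"
      have z: "lead A z" "z \<le> x"
        unfolding z_def using LA(2,3)[of y] y by auto
      have "C z y"
        unfolding z_def using LA(1) C'(2) by blast
      then have yz: "leader C y = leader C z"
        using LC(4) by simp
      show ?thesis
      proof (cases "M \<le> z")
        case False
        then have "z \<in> \<Sigma>"
          using z by (simp add: \<Sigma>_def)
        then show ?thesis
          using lead_\<Sigma> False yz by (simp add: \<rho>_def flip: z_def)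
      next
        case True
        then obtain i where i: "z = e i"
          using e_ex z by blast
        then have "i \<le> q"
          using z q e_le by simp
        show ?thesis
        proof (cases "i = q")
          case True
          then have "leader C z = z"
            using x(2) LC(5) i q by simp
          then show ?thesis
            using yz w True by (simp add: \<rho>_def i flip: z_def)
        next
          case False
          then have "i < q"
            using \<open>i \<le> q\<close> by simp
          then have \<rho>: "\<rho> w z = (case V i of Inl a \<Rightarrow> a | Inr j \<Rightarrow> b j)"
            using w e_ge by (simp add: \<rho>_def i w_def fill_def)
          have "leader C z = \<rho> w z"
          proof (cases "V i")
            case (Inl a)
            then have a: "a \<in> \<Sigma>" "lead A a"
              using VL[OF Inl] by (auto simp: \<Sigma>_def)
            then have "A' z a"
              using A'_lead[OF z(1) a(2)] Inl r_\<Sigma> by (simp add: i r_e)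
            then have "C z a"
              using nbD(2)[OF C] by blast
            then have "leader C z = leader C a"
              using LC(4) by simp
            then show ?thesis
              using lead_\<Sigma>[OF a(1)] Inl by (simp add: \<rho>)
          next
            case (Inr j)
            then have j: "j \<le> i" "V j = Inr j"
              using VR by auto
            then have "A' z (e j)"
              using A'_lead[OF z(1) e_lead] Inr by (simp add: i r_e)
            then have "C z (e j)"
              using nbD(2)[OF C] by blast
            then have "leader C z = leader C (e j)"
              using LC(4) by simp
            moreover have "leader C (e j) \<le> e j" "e j < x"
              using LC(3) j \<open>i < q\<close> q e_less by auto
            then have "leader C (e j) < M"
              using x_least[OF _ LC(2)[of "e j"]] by (meson leD le_less_trans not_le)
            ultimately show ?thesis
              using Inr by (simp add: \<rho> b_def)
          qed
          then show ?thesis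
            using yz by (simp flip: z_def)
        qed
      qed
    qed
    have "H C = H (Cw w)"
    proof (rule H[OF CA Cw[OF w(1)]])
      show "agree (Suc (next_lead M C)) C (Cw w)"
        unfolding agree_def x_def[symmetric]
      proof (intro allI impI)
        fix i j assume "i < Suc x" "j < Suc x"
        then show "C i j = Cw w i j"
          using LC(4)[of i j] key[of i] key[of j] by (simp add: Cw_def)
      qed
    qed
    also have "\<dots> = c"
      unfolding w_def using V_c[OF Vq b] .
    finally show ?thesis .
  qed
  then show ?thesis
    using A' by (intro bexI[of _ A']) auto
qed

text \<open>Combinatorial forcing in the manner of Galvin--Prikry and Ellentuck;
  \<open>G M A\<close> certifies that \<open>nb M A\<close> lies in the open set. A neighbourhood is
  accepted if all its members have certificates and rejected if no shrinking of it at the same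
  height is accepted. The pigeonhole principle makes rejection pass on to the next leader.\<close>

theorem open_Ramsey:
  fixes G :: "nat \<Rightarrow> (nat \<Rightarrow> nat \<Rightarrow> bool) \<Rightarrow> bool"
  assumes G: "\<And>M N A C. A \<in> Einf \<Longrightarrow> G M A \<Longrightarrow> M \<le> N \<Longrightarrow> C \<in> nb M A \<Longrightarrow> G N C"
    and B: "B \<in> Einf"
  shows "\<exists>B'\<in>nb m B. (\<forall>A\<in>nb m B'. \<exists>M. G M A) \<or> (\<forall>A\<in>nb m B'. \<forall>M. \<not> G M A)"
proof -
  define acc where "acc M A \<longleftrightarrow> (\<forall>C\<in>nb M A. \<exists>N. G N C)" for M A
  define rej where "rej M A \<longleftrightarrow> (\<forall>C\<in>nb M A. \<not> acc M C)" for M A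
  have acc_nb: "acc M C" if "acc M A" "C \<in> nb M A" for M A C
    using that nb_trans unfolding acc_def by blast
  have rej_nb: "rej M C" if "rej M A" "C \<in> nb M A" for M A C
    using that nb_trans unfolding rej_def by blast
  have not_both: "\<not> (acc M A \<and> rej M A)" if "A \<in> Einf" for M A
    using nb_refl[OF that] unfolding rej_def by blast
  obtain B1 where B1: "B1 \<in> nb m B" and
    dec: "\<And>A. A \<in> Einf \<Longrightarrow> B1 \<le> A \<Longrightarrow> acc m A \<or> rej m A"
    "\<And>A x. A \<in> Einf \<Longrightarrow> B1 \<le> A \<Longrightarrow> m \<le> x \<Longrightarrow> lead B1 x \<Longrightarrow> acc (Suc x) A \<or> rej (Suc x) A"
  proof -
    have "\<exists>L\<in>nb m B. \<forall>A\<in>Einf. L \<le> A \<longrightarrow> (acc m A \<or> rej m A) \<and>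
        (\<forall>x\<ge>m. lead L x \<longrightarrow> acc (Suc x) A \<or> rej (Suc x) A)"
    proof (rule fusion_all[OF B])
      show "acc M C \<or> rej M C" if "acc M A \<or> rej M A" "C \<in> nb M A" for M A C
        using that acc_nb rej_nb by blast
      show "\<exists>C\<in>nb M A. acc M C \<or> rej M C" if "A \<in> Einf" for M A
        using nb_refl[OF that] unfolding rej_def by blast
    qed
    then show ?thesis using that by blast
  qed
  \<comment> \<open>The heights at which \<open>B1\<close> decides. Leaders of coarsenings are
    leaders of \<open>B1\<close>, so \<open>Suc (next_lead M C)\<close> is again such a
    height.\<close>
  define sp where "sp M \<longleftrightarrow> M = m \<or> (\<exists>x\<ge>m. M = Suc x \<and> lead B1 x)" for M
  have dec': "acc M A \<or> rej M A" if "A \<in> Einf" "B1 \<le> A" "sp M" for M A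
    using that dec unfolding sp_def by blast
  have sp_ge: "m \<le> M" if "sp M" for M
    using that unfolding sp_def by auto
  define R where "R M A \<longleftrightarrow> acc M A \<or> rej M A \<and> (\<forall>C\<in>nb M A. rej (Suc (next_lead M C)) C)" for M A
  have "\<exists>L\<in>nb m B1. \<forall>A\<in>Einf. L \<le> A \<longrightarrow> R m A \<and> (\<forall>x\<ge>m. lead L x \<longrightarrow> R (Suc x) A)"
  proof (rule fusion_all[OF nbD(1)[OF B1]])
    show "R M C" if "R M A" "C \<in> nb M A" for M A C
      using that acc_nb[of M A C] rej_nb[of M A C] nb_trans[OF _ that(2) order_refl] unfolding R_def by blast
    show "\<exists>C\<in>nb M A. R M C" if A: "A \<in> Einf" "B1 \<le> A"
      and M: "M = m \<or> (\<exists>x\<ge>m. M = Suc x \<and> lead B1 x)" for M A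
    proof (cases "acc M A")
      case True
      then show ?thesis
        using nb_refl[OF A(1)] unfolding R_def by blast
    next
      case False
      have sp: "sp M"
        using M by (simp add: sp_def)
      have rejA: "rej M A"
        using False dec'[OF A sp] by blast
      have sp_next: "sp (Suc (next_lead M C))" and B1C: "B1 \<le> C" if C: "C \<in> nb M A" for C
      proof -
        show le: "B1 \<le> C"
          using A(2) nbD(2)[OF C] by (rule order_trans)
        show "sp (Suc (next_lead M C))"
          unfolding sp_def using next_lead(1,2)[OF nbD(1)[OF C], of M] sp_ge[OF sp] lead_antimono[OF le]
          by (intro disjI2 exI[of _ "next_lead M C"]) auto
      qed
      \<comment> \<open>Rejection at the next height depends only on the trace there:
        \<open>C\<close> and \<open>D\<close> lie in the neighbourhood of one glued relation, which
        is decided as a whole.\<close>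
      have cong: "rej (Suc (next_lead M C)) C = rej (Suc (next_lead M D)) D"
        if C: "C \<in> nb M A" and D: "D \<in> nb M A" and agr: "agree (Suc (next_lead M C)) C D" for C D
      proof -
        define x where "x = next_lead M C"
        have x: "M \<le> x" "lead C x" and x_least: "\<And>y. M \<le> y \<Longrightarrow> lead C y \<Longrightarrow> x \<le> y"
          unfolding x_def using next_lead[OF nbD(1)[OF C]] by auto
        have "next_lead M D = x"
        proof (rule next_lead_eqI[OF nbD(1)[OF D] x(1)])
          show "lead D x"
            using lead_agree[OF agr, of x] x(2) by (simp add: x_def)
          show "\<not> lead D y" if "M \<le> y" "y < x" for y
            using lead_agree[OF agr, of y] x_least[of y] that by (auto simp: x_def)
        qed
        moreover note g = glue[where M = "Suc x", OF nbD(1)[OF C] A(1) nbD(2)[OF C]]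
        have DE: "D \<in> nb (Suc x) (glue (Suc x) C A)" and CE: "C \<in> nb (Suc x) (glue (Suc x) C A)"
          using g(5) g(6)[OF nbD(1,2)[OF D] agree_sym[OF agr[folded x_def]]] by auto
        have "acc (Suc x) (glue (Suc x) C A) \<or> rej (Suc x) (glue (Suc x) C A)"
          using dec'[OF g(1) order_trans[OF A(2) g(2)] sp_next[OF C, folded x_def]] .
        then have "rej (Suc x) C = rej (Suc x) D"
          using acc_nb[OF _ DE] acc_nb[OF _ CE] rej_nb[OF _ DE] rej_nb[OF _ CE]
            not_both[OF nbD(1)[OF C]] not_both[OF nbD(1)[OF D]] by blast
        ultimately show ?thesis
          by (simp flip: x_def)
      qed
      obtain A' where A': "A' \<in> nb M A" and hom: "(\<forall>C\<in>nb M A'. rej (Suc (next_lead M C)) C) \<or>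
          (\<forall>C\<in>nb M A'. \<not> rej (Suc (next_lead M C)) C)"
        using dual_pigeonhole[where H = "\<lambda>C. rej (Suc (next_lead M C)) C" and M = M, OF A(1) cong] by blast
      from hom show ?thesis
      proof
        assume "\<forall>C\<in>nb M A'. rej (Suc (next_lead M C)) C"
        then have "R M A'"
          using rej_nb[OF rejA A'] by (simp add: R_def)
        then show ?thesis
          using A' by blast
      next
        \<comment> \<open>Now each \<open>C\<close> is accepted at its own next height, so
          \<open>A'\<close> is accepted at \<open>M\<close>, although \<open>A\<close> is rejected
          there.\<close>
        assume *: "\<forall>C\<in>nb M A'. \<not> rej (Suc (next_lead M C)) C"
        have "\<exists>N. G N C" if C: "C \<in> nb M A'" for C
        proof -
          have CA: "C \<in> nb M A"
            using nb_trans[OF C A'] by simp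
          have "acc (Suc (next_lead M C)) C"
            using dec'[OF nbD(1)[OF CA] B1C[OF CA] sp_next[OF CA]] * C by blast
          then show ?thesis
            using nb_refl[OF nbD(1)[OF CA]] unfolding acc_def by blast
        qed
        then have "acc M A'"
          by (simp add: acc_def)
        then show ?thesis
          using rejA A' unfolding rej_def by blast
      qed
    qed
  qed
  then obtain B2 where B2: "B2 \<in> nb m B1"
    and R_m: "\<And>A. A \<in> Einf \<Longrightarrow> B2 \<le> A \<Longrightarrow> R m A"
    and R_Suc: "\<And>A x. A \<in> Einf \<Longrightarrow> B2 \<le> A \<Longrightarrow> m \<le> x \<Longrightarrow> lead B2 x \<Longrightarrow> R (Suc x) A"
    by blast
  have B2B: "B2 \<in> nb m B"
    using nb_trans[OF B2 B1 order_refl] .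
  show ?thesis
  proof (cases "acc m B2")
    case True
    then show ?thesis
      using B2B unfolding acc_def by blast
  next
    case False
    have rej2: "rej m B2"
      using dec(1)[OF nbD(1,2)[OF B2]] False by blast
    have "\<not> G M C" if C: "C \<in> nb m B2" for M C
    proof
      assume GC: "G M C"
      note CE = nbD(1)[OF C]
      \<comment> \<open>Rejection climbs along the leaders of \<open>C\<close>, whereas a
        certificate for \<open>C\<close> makes it accepted as soon as the height exceeds that of the
        certificate.\<close>
      have rej_all: "rej (Suc x) C" if "m \<le> x" "lead C x" for x
        using that
      proof (induction x rule: less_induct)
        case (less x)
        show ?case
        proof (cases "\<exists>y<x. m \<le> y \<and> lead C y")
          case False
          then have nl: "next_lead m C = x"
            using less.prems by (intro next_lead_eqI[OF CE]) auto
          have "rej m C"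
            using rej_nb[OF rej2 C] .
          then have "\<forall>D\<in>nb m C. rej (Suc (next_lead m D)) D"
            using R_m[OF CE nbD(2)[OF C]] not_both[OF CE] unfolding R_def by blast
          then show ?thesis
            using nb_refl[OF CE] nl by metis
        next
          case True
          define y where "y = Max {y. y < x \<and> m \<le> y \<and> lead C y}"
          have fin: "finite {y. y < x \<and> m \<le> y \<and> lead C y}"
            by simp
          have "y \<in> {y. y < x \<and> m \<le> y \<and> lead C y}"
            unfolding y_def using True by (intro Max_in fin) auto
          then have y: "y < x" "m \<le> y" "lead C y"
            by auto
          have nl: "next_lead (Suc y) C = x"
          proof (rule next_lead_eqI[OF CE])
            show "\<not> lead C z" if z: "Suc y \<le> z" "z < x" for z
            proof
              assume "lead C z"
              then have "z \<le> y"
                unfolding y_def using z y by (intro Max_ge fin) simp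
              then show False using z by simp
            qed
          qed (use y less.prems in auto)
          have "rej (Suc y) C"
            using less.IH[OF y] .
          moreover have "R (Suc y) C"
            using R_Suc[OF CE nbD(2)[OF C] y(2)] lead_antimono[OF nbD(2)[OF C] y(3)] by blast
          ultimately have "\<forall>D\<in>nb (Suc y) C. rej (Suc (next_lead (Suc y) D)) D"
            using not_both[OF CE] unfolding R_def by blast
          then show ?thesis
            using nb_refl[OF CE] nl by metis
        qed
      qed
      obtain x where x: "max m M \<le> x" "lead C x"
        using Einf_lead[OF CE] by blast
      have "G (Suc x) D" if D: "D \<in> nb (Suc x) C" for D
        using G[OF CE GC _ nb_mono[OF D], of "Suc x"] x by simp
      then have "acc (Suc x) C"
        unfolding acc_def by blast
      then show False
        using rej_all[of x] x not_both[OF CE] by auto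
    qed
    then show ?thesis
      using B2B by blast
  qed
qed

section \<open>Persistent properties and the Ramsey ideal\<close>

definition persistent :: "((nat \<Rightarrow> nat \<Rightarrow> bool) \<Rightarrow> bool) \<Rightarrow> bool" where
  "persistent K \<longleftrightarrow> (\<forall>B\<in>Einf. \<forall>m. \<exists>B'\<in>nb m B. K B')"

text \<open>The fusion meets the first \<open>M\<close> requirements at height \<open>M\<close>, and
  the heights are unbounded. The closure of the ideal, and of negligible relations, under countable
  unions comes from here.\<close>

lemma persistent_all:
  assumes her: "\<And>n A B. A \<in> Einf \<Longrightarrow> B \<in> Einf \<Longrightarrow> B \<le> A \<Longrightarrow> K n B \<Longrightarrow> K n A"
    and pers: "\<And>n :: nat. persistent (K n)"
  shows "persistent (\<lambda>B. \<forall>n. K n B)"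
  unfolding persistent_def
proof (intro ballI allI)
  fix B m assume B: "B \<in> Einf"
  have dense: "\<exists>C\<in>nb M A. \<forall>n<k. K n C" if "A \<in> Einf" for A M and k :: nat
  proof (induction k)
    case 0
    then show ?case using nb_refl[OF that] by blast
  next
    case (Suc k)
    then obtain C where C: "C \<in> nb M A" "\<forall>n<k. K n C"
      by blast
    obtain D where D: "D \<in> nb M C" "K k D"
      using pers nbD(1)[OF C(1)] unfolding persistent_def by blast
    have "K n D" if "n < Suc k" for n
      using that D C her[OF nbD(1)[OF D(1)] nbD(1)[OF C(1)] nbD(2)[OF D(1)]] by (cases "n = k") auto
    then show ?case
      using nb_trans[OF D(1) C(1) order_refl] by blast
  qed
  have "\<exists>L\<in>nb m B. (\<forall>n<m. K n L) \<and> (\<forall>x\<ge>m. lead L x \<longrightarrow> (\<forall>n<Suc x. K n L))"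
  proof (rule fusion[OF B])
    show "\<forall>n<M. K n C" if "A \<in> Einf" "\<forall>n<M. K n A" "C \<in> nb M A" for M A C
      using that her[OF nbD(1)[OF that(3)] that(1) nbD(2)[OF that(3)]] by blast
    show "\<exists>C\<in>nb M A. \<forall>n<M. K n C" if "A \<in> Einf" for M A
      using dense[OF that] .
  qed
  then obtain L where L: "L \<in> nb m B" "\<And>x n. x \<ge> m \<Longrightarrow> lead L x \<Longrightarrow> n < Suc x \<Longrightarrow> K n L"
    by blast
  have "K n L" for n
  proof -
    obtain x where "max m n \<le> x" "lead L x"
      using Einf_lead[OF nbD(1)[OF L(1)]] by blast
    then show ?thesis
      using L(2)[of x n] by simp
  qed
  then show "\<exists>L\<in>nb m B. \<forall>n. K n L"
    using L(1) by blast
qed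

text \<open>The hypothesis shrinks one neighbourhood; \<open>one_stage\<close> extends the avoidance
  to coarsenings with any trace below \<open>m\<close>. It turns the definition of the ideal into a
  statement about all coarsenings.\<close>

lemma persistent_avoid:
  assumes "\<And>B m. B \<in> Einf \<Longrightarrow> \<exists>B'\<in>nb m B. nb m B' \<inter> X = {}"
  shows "persistent (\<lambda>B. \<forall>A\<in>Einf. B \<le> A \<longrightarrow> A \<notin> X)"
  unfolding persistent_def
proof (intro ballI allI)
  fix B m assume B: "B \<in> Einf"
  have "\<exists>B'\<in>nb m B. \<forall>A\<in>Einf. B' \<le> A \<longrightarrow> nb m A \<inter> X = {}"
  proof (rule one_stage[OF B])
    show "nb m C \<inter> X = {}" if "nb m A \<inter> X = {}" "C \<in> nb m A" for A C
      using that nb_trans[OF _ that(2) order_refl] by blast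
  qed (use assms in blast)
  then show "\<exists>B'\<in>nb m B. \<forall>A\<in>Einf. B' \<le> A \<longrightarrow> A \<notin> X"
    using nb_refl by blast
qed

lemma Ramsey_ideal_iff:
  "X \<in> Ramsey_ideal \<longleftrightarrow> X \<subseteq> Einf \<and> persistent (\<lambda>B. \<forall>A\<in>Einf. B \<le> A \<longrightarrow> A \<notin> X)"
proof
  assume "X \<in> Ramsey_ideal"
  then have X: "X \<subseteq> Einf" "\<And>B m. B \<in> Einf \<Longrightarrow> \<exists>B'\<in>basic_nbhd m B. basic_nbhd m B' \<inter> X = {}"
    unfolding Ramsey_ideal_def by auto
  have "\<exists>B'\<in>nb m B. nb m B' \<inter> X = {}" if "B \<in> Einf" for B m
    using X(2)[OF that, of m] basic_nbhd_eq[OF that] basic_nbhd_eq nbD(1) by metis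
  with X(1) show "X \<subseteq> Einf \<and> persistent (\<lambda>B. \<forall>A\<in>Einf. B \<le> A \<longrightarrow> A \<notin> X)"
    using persistent_avoid by blast
next
  assume X: "X \<subseteq> Einf \<and> persistent (\<lambda>B. \<forall>A\<in>Einf. B \<le> A \<longrightarrow> A \<notin> X)"
  have "\<exists>B'\<in>basic_nbhd m B. basic_nbhd m B' \<inter> X = {}" if B: "B \<in> Einf" for B m
  proof -
    obtain B' where B': "B' \<in> nb m B" "\<forall>A\<in>Einf. B' \<le> A \<longrightarrow> A \<notin> X"
      using X B unfolding persistent_def by blast
    then have "nb m B' \<inter> X = {}"
      unfolding nb_def by blast
    then show ?thesis
      using B'(1) by (intro bexI[of _ B'])
        (simp_all add: basic_nbhd_eq[OF B] basic_nbhd_eq[OF nbD(1)[OF B'(1)]])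
  qed
  with X show "X \<in> Ramsey_ideal"
    unfolding Ramsey_ideal_def by blast
qed

lemma sigma_ideal_Ramsey_ideal: "sigma_ideal_on Einf Ramsey_ideal"
  unfolding sigma_ideal_on_def
proof (intro conjI ballI allI impI)
  show "Ramsey_ideal \<subseteq> Pow Einf"
    by (auto simp: Ramsey_ideal_def)
  show "{} \<in> Ramsey_ideal"
    using nb_refl by (auto simp: Ramsey_ideal_iff persistent_def)
  show "T \<in> Ramsey_ideal" if "S \<in> Ramsey_ideal" "T \<subseteq> S" for S T
  proof -
    have S: "S \<subseteq> Einf" "\<forall>B\<in>Einf. \<forall>m. \<exists>B'\<in>nb m B. \<forall>A\<in>Einf. B' \<le> A \<longrightarrow> A \<notin> S"
      using that(1) by (auto simp: Ramsey_ideal_iff persistent_def)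
    have "\<exists>B'\<in>nb m B. \<forall>A\<in>Einf. B' \<le> A \<longrightarrow> A \<notin> T" if "B \<in> Einf" for B m
      using S(2)[rule_format, OF that, of m] \<open>T \<subseteq> S\<close> by blast
    then show ?thesis
      using S(1) that(2) by (auto simp: Ramsey_ideal_iff persistent_def)
  qed
  show "(\<Union>n. S n) \<in> Ramsey_ideal" if "range S \<subseteq> Ramsey_ideal" for S :: "nat \<Rightarrow> _"
  proof -
    have S: "S n \<subseteq> Einf" "persistent (\<lambda>B. \<forall>A\<in>Einf. B \<le> A \<longrightarrow> A \<notin> S n)" for n
      using subsetD[OF that, of "S n"] by (auto simp: Ramsey_ideal_iff)
    have "persistent (\<lambda>B. \<forall>n. \<forall>A\<in>Einf. B \<le> A \<longrightarrow> A \<notin> S n)"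
      by (rule persistent_all[OF _ S(2)]) (blast intro: order_trans)
    moreover have "(\<lambda>B. \<forall>n. \<forall>A\<in>Einf. B \<le> A \<longrightarrow> A \<notin> S n) = (\<lambda>B. \<forall>A\<in>Einf. B \<le> A \<longrightarrow> A \<notin> (\<Union>n. S n))"
      by auto
    ultimately show ?thesis
      using S(1) by (simp add: Ramsey_ideal_iff UN_subset_iff)
  qed
qed

text \<open>For an open set that meets every neighbourhood the second alternative of
  \<open>open_Ramsey\<close> is impossible.\<close>

lemma persistent_dense:
  assumes G: "\<And>M N A C. A \<in> Einf \<Longrightarrow> G M A \<Longrightarrow> M \<le> N \<Longrightarrow> C \<in> nb M A \<Longrightarrow> G N C"
    and dense: "\<And>M A. A \<in> Einf \<Longrightarrow> \<exists>N. \<exists>C\<in>nb M A. G N C"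
  shows "persistent (\<lambda>B. \<forall>A\<in>Einf. B \<le> A \<longrightarrow> (\<exists>M. G M A))"
proof -
  have "persistent (\<lambda>B. \<forall>A\<in>Einf. B \<le> A \<longrightarrow> A \<notin> {A. \<forall>M. \<not> G M A})"
  proof (rule persistent_avoid)
    fix B m assume B: "B \<in> Einf"
    obtain B' where B': "B' \<in> nb m B"
      and alt: "(\<forall>A\<in>nb m B'. \<exists>M. G M A) \<or> (\<forall>A\<in>nb m B'. \<forall>M. \<not> G M A)"
      using open_Ramsey[of G B m, OF _ B] G by blast
    have "\<not> (\<forall>A\<in>nb m B'. \<forall>M. \<not> G M A)"
      using dense[OF nbD(1)[OF B']] by blast
    with alt have "nb m B' \<inter> {A. \<forall>M. \<not> G M A} = {}"
      by blast
    with B' show "\<exists>B'\<in>nb m B. nb m B' \<inter> {A. \<forall>M. \<not> G M A} = {}"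
      by blast
  qed
  then show ?thesis by simp
qed

section \<open>Negligible relations\<close>

definition kills :: "((nat \<Rightarrow> nat \<Rightarrow> bool) \<times> (nat \<Rightarrow> nat \<Rightarrow> bool)) set \<Rightarrow> (nat \<Rightarrow> nat \<Rightarrow> bool) \<Rightarrow> bool" where
  "kills P B \<longleftrightarrow> (\<forall>A\<in>Einf. \<forall>A'\<in>Einf. B \<le> A \<longrightarrow> B \<le> A' \<longrightarrow> (A, A') \<in> P \<longrightarrow> A \<le> A')"

definition negligible_rel :: "((nat \<Rightarrow> nat \<Rightarrow> bool) \<times> (nat \<Rightarrow> nat \<Rightarrow> bool)) set \<Rightarrow> bool" where
  "negligible_rel P \<longleftrightarrow> persistent (kills P)"

lemma kills_antimono: "B \<le> B' \<Longrightarrow> kills P B \<Longrightarrow> kills P B'"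
  unfolding kills_def by (meson order_trans)

lemma kills_subset: "P \<subseteq> Q \<Longrightarrow> kills Q B \<Longrightarrow> kills P B"
  unfolding kills_def by blast

lemma negligible_rel_subset: "negligible_rel Q \<Longrightarrow> P \<subseteq> Q \<Longrightarrow> negligible_rel P"
  unfolding negligible_rel_def persistent_def using kills_subset by meson

lemma negligible_rel_empty: "negligible_rel {}"
  unfolding negligible_rel_def persistent_def kills_def using nb_refl by blast

lemma negligible_rel_UN:
  assumes "countable I" "\<And>i. i \<in> I \<Longrightarrow> negligible_rel (P i)"
  shows "negligible_rel (\<Union>i\<in>I. P i)"
proof (cases "I = {}")
  case True
  then show ?thesis by (simp add: negligible_rel_empty)
next
  case False
  define Q where "Q n = P (from_nat_into I n)" for n
  have "persistent (\<lambda>B. \<forall>n. kills (Q n) B)"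
  proof (rule persistent_all)
    show "persistent (kills (Q n))" for n
      using assms(2) from_nat_into[OF False, of n] by (simp add: Q_def negligible_rel_def)
  qed (use kills_antimono in blast)
  moreover have "kills (\<Union>i\<in>I. P i) B" if "\<forall>n. kills (Q n) B" for B
  proof -
    have "kills (P i) B" if i: "i \<in> I" for i
      using \<open>\<forall>n. kills (Q n) B\<close> from_nat_into_surj[OF assms(1) i] unfolding Q_def by metis
    then show ?thesis
      unfolding kills_def by blast
  qed
  ultimately show ?thesis
    unfolding negligible_rel_def persistent_def by meson
qed

text \<open>\<open>Q\<close> may depend on \<open>B'\<close>: the countable cover of the small
  pieces is found only after \<open>B\<close> has been shrunk.\<close>

lemma negligible_rel_locally:
  assumes "\<And>B m. B \<in> Einf \<Longrightarrow> \<exists>B'\<in>nb m B. \<exists>Q. negligible_rel Q \<and>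
    (\<forall>A\<in>Einf. \<forall>A'\<in>Einf. B' \<le> A \<longrightarrow> B' \<le> A' \<longrightarrow> (A, A') \<in> P \<longrightarrow> (A, A') \<in> Q)"
  shows "negligible_rel P"
  unfolding negligible_rel_def persistent_def
proof (intro ballI allI)
  fix B m assume "B \<in> Einf"
  from assms[OF this, of m] obtain B' Q where B': "B' \<in> nb m B" "negligible_rel Q"
    and Q: "\<And>A A'. A \<in> Einf \<Longrightarrow> A' \<in> Einf \<Longrightarrow> B' \<le> A \<Longrightarrow> B' \<le> A' \<Longrightarrow> (A, A') \<in> P \<Longrightarrow> (A, A') \<in> Q"
    by meson
  obtain C where C: "C \<in> nb m B'" "kills Q C"
    using B' nbD(1)[OF B'(1)] unfolding negligible_rel_def persistent_def by blast
  have "kills P C"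
    using C(2) Q order_trans[OF nbD(2)[OF C(1)]] unfolding kills_def by meson
  then show "\<exists>C\<in>nb m B. kills P C"
    using nb_trans[OF C(1) B'(1) order_refl] by blast
qed

text \<open>The second components of \<open>P\<close> are read continuously from the first ones, after shrinking.\<close>

definition decided :: "((nat \<Rightarrow> nat \<Rightarrow> bool) \<times> (nat \<Rightarrow> nat \<Rightarrow> bool)) set \<Rightarrow> bool" where
  "decided P \<longleftrightarrow> (\<forall>M. \<forall>A\<in>Einf. \<exists>C\<in>nb M A. \<exists>c. \<forall>D D'. (D, D') \<in> P \<longrightarrow> D \<in> nb M C \<longrightarrow> agree M D' c)"

text \<open>Up to \<open>e\<close>, the only point in a new class of \<open>B\<close> is
  \<open>e\<close> itself. Both \<open>D\<close> and \<open>q\<close> attach it to \<open>x\<close>,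
  so \<open>h\<close> carries every question below \<open>Suc e\<close> to points below
  \<open>M\<close>.\<close>

lemma agree_next_lead:
  assumes B: "B \<in> Einf" and D: "D \<in> Einf" "B \<le> D" and q: "q \<in> Einf" "B \<le> q"
    and agr: "agree M D q" and e: "e = next_lead M B" and x: "x < M" "D e x" "q e x"
  shows "agree (Suc e) D q"
proof -
  note LB = equivp_leader[OF Einf_equivp[OF B]]
  define h where "h a = (if leader B a < M then leader B a else x)" for a
  have h_less: "h a < M" for a
    using x by (simp add: h_def)
  have rel: "R a (h a)" if R: "R \<in> Einf" "B \<le> R" "R e x" and a: "a \<le> e" for R a
  proof (cases "leader B a < M")
    case True
    have "R (leader B a) a"
      using LB(1) R(2) by blast
    then show ?thesis
      using True Einf_sym[OF R(1)] by (simp add: h_def)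
  next
    case False
    then have "e \<le> leader B a"
      using next_lead(3)[OF B _ LB(2), of M a] e by simp
    then have "leader B a = e" "a = e"
      using LB(3)[of a] a by auto
    then show ?thesis
      using False R(3) by (simp add: h_def)
  qed
  have eq: "R a b \<longleftrightarrow> R (h a) (h b)" if R: "R \<in> Einf" "B \<le> R" "R e x" and a: "a \<le> e" "b \<le> e" for R a b
    using rel[OF R a(1)] rel[OF R a(2)] Einf_sym[OF R(1)] Einf_trans[OF R(1)] by blast
  show ?thesis
    unfolding agree_def
  proof (intro allI impI)
    fix a b assume "a < Suc e" "b < Suc e"
    then have "a \<le> e" "b \<le> e" by auto
    then have "D a b \<longleftrightarrow> D (h a) (h b)" "q a b \<longleftrightarrow> q (h a) (h b)"
      using eq[OF D x(2)] eq[OF q x(3)] by blast+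
    then show "D a b \<longleftrightarrow> q a b"
      using agreeD[OF agr h_less h_less] by blast
  qed
qed

lemma merge_next:
  assumes B: "B \<in> Einf" and x: "x < M"
  obtains q where "q \<in> nb M B" "q (next_lead M B) x"
    "\<And>D. D \<in> Einf \<Longrightarrow> B \<le> D \<Longrightarrow> D (next_lead M B) x \<Longrightarrow> q \<le> D"
proof -
  define e where "e = next_lead M B"
  have e: "M \<le> e" "lead B e"
    unfolding e_def using next_lead[OF B] by auto
  note LB = equivp_leader[OF Einf_equivp[OF B]]
  define r where "r z = (if z = e then leader B x else z)" for z
  define q where "q = (\<lambda>a b. r (leader B a) = r (leader B b))"
  have lx: "leader B x < M"
    using LB(3)[of x] x by simp
  have "q \<in> nb M B"
    unfolding q_def
  proof (rule quotient_in_nb[OF B])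
    show "r z \<le> z" for z
      using lx e by (simp add: r_def)
    show "r z = z" if "z < M" for z
      using that e by (simp add: r_def)
    show "\<exists>y\<ge>n. lead B y \<and> r y = y" for n
    proof -
      obtain y where "y \<ge> max n (Suc e)" "lead B y"
        using Einf_lead[OF B] by blast
      then show ?thesis
        by (intro exI[of _ y]) (simp add: r_def)
    qed
  qed
  moreover have "leader B e = e"
    using e(2) LB(5) by simp
  then have "q e x"
    using lx e by (simp add: q_def r_def)
  moreover have "q \<le> D" if D: "D \<in> Einf" "B \<le> D" "D e x" for D
  proof (intro predicate2I)
    fix a b assume "q a b"
    then have ab: "r (leader B a) = r (leader B b)"
      by (simp add: q_def)
    have *: "D c (r (leader B c))" for c
    proof -
      have 1: "D (leader B c) c" "D (leader B x) x"
        using LB(1) D(2) by blast+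
      show ?thesis
      proof (cases "leader B c = e")
        case True
        then have "D c e" "D e (leader B x)"
          using 1 D(3) Einf_sym[OF D(1)] Einf_trans[OF D(1)] by metis+
        then show ?thesis
          using True Einf_trans[OF D(1)] by (auto simp: r_def)
      next
        case False
        then show ?thesis
          using 1 Einf_sym[OF D(1)] by (simp add: r_def)
      qed
    qed
    show "D a b"
      using *[of a] *[of b] ab Einf_sym[OF D(1)] Einf_trans[OF D(1)] by metis
  qed
  ultimately show ?thesis
    using that by (simp add: e_def)
qed

text \<open>
  The first new class \<open>e\<close> of \<open>B\<close> may be merged with \<open>x\<close> or with \<open>y\<close>. As \<open>A0\<close> does not separate \<open>x\<close>
  from \<open>y\<close>, coarsenings \<open>A\<close> of either merger look alike up to \<open>e\<close>, so that the position of \<open>e\<close> in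
  \<open>A'\<close> is decided beforehand. Choosing the merger after the decision contradicts it.
\<close>

lemma decided_separate:
  assumes dec: "decided P" and B: "B \<in> Einf" and A0: "A0 \<in> Einf" "B \<le> A0"
    and xy: "x < M" "y < M" "A0 x y"
  shows "\<exists>B'\<in>nb M B. \<forall>A\<in>Einf. \<forall>A'\<in>Einf. B' \<le> A \<longrightarrow> B' \<le> A' \<longrightarrow> (A, A') \<in> P \<longrightarrow>
    agree M A A0 \<longrightarrow> A' x y"
proof -
  define e where "e = next_lead M B"
  have e: "M \<le> e" "lead B e"
    unfolding e_def using next_lead[OF B] by auto
  \<comment> \<open>Gluing the trace of \<open>A0\<close> onto \<open>B\<close> leaves
    \<open>e\<close> the first new leader. So the decision taken over \<open>q\<close> concerns the
    very class that \<open>B\<close> is still free to move.\<close>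
  define A1 where "A1 = glue M A0 B"
  have A1: "A1 \<in> Einf" "B \<le> A1" "agree M A1 A0"
    unfolding A1_def using glue[OF A0(1) B A0(2)] by auto
  have "next_lead M A1 = e"
  proof (rule next_lead_eqI[OF A1(1) e(1)])
    show "lead A1 e"
      unfolding A1_def using e(2,1) by (rule lead_glue)
    show "\<not> lead A1 z" if "M \<le> z" "z < e" for z
      using that lead_antimono[OF A1(2)] next_lead(3)[OF B, of M z] by (auto simp: e_def)
  qed
  then obtain q where q: "q \<in> nb M A1" "q e x"
    using merge_next[OF A1(1) xy(1)] by metis
  have qE: "q \<in> Einf" and Bq: "B \<le> q" and qA0: "agree M q A0"
    using nbD[OF q(1)] A1 by (auto intro: order_trans agree_trans)
  obtain C c where C: "C \<in> nb (Suc e) q"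
    and c: "\<And>D D'. (D, D') \<in> P \<Longrightarrow> D \<in> nb (Suc e) C \<Longrightarrow> agree (Suc e) D' c"
    using dec qE unfolding decided_def by meson
  \<comment> \<open>If \<open>c\<close> joins \<open>e\<close> to \<open>x\<close>, the merger with
    \<open>y\<close> forces \<open>A'\<close> to join \<open>e\<close> to both. If not, the merger
    with \<open>x\<close> contradicts \<open>c\<close>, and no related pair is left.\<close>
  define u where "u = (if c e x then y else x)"
  have u: "u < M"
    using xy by (simp add: u_def)
  have A0u: "A0 x u"
    using xy(3) Einf_refl[OF A0(1)] by (simp add: u_def)
  obtain Bu where Bu: "Bu \<in> nb M B" "Bu e u" "\<And>D. D \<in> Einf \<Longrightarrow> B \<le> D \<Longrightarrow> D e u \<Longrightarrow> Bu \<le> D"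
    using merge_next[OF B u] unfolding e_def by metis
  have "q x u"
    using agreeD[OF qA0 xy(1) u] A0u by simp
  then have "Bu \<le> q"
    using Bu(3)[OF qE Bq] q(2) Einf_trans[OF qE] by blast
  then obtain B' where B': "B' \<in> nb (Suc e) Bu"
    "\<And>D. D \<in> Einf \<Longrightarrow> B' \<le> D \<Longrightarrow> agree (Suc e) D q \<Longrightarrow> D \<in> nb (Suc e) C"
    using amalgamation[OF qE nbD(1)[OF Bu(1)] _ C] by metis
  have BuB': "Bu \<le> B'"
    using nbD(2)[OF B'(1)] .
  have "A' x y" if A: "A \<in> Einf" "B' \<le> A" and A': "A' \<in> Einf" "B' \<le> A'"
    and P: "(A, A') \<in> P" and agr: "agree M A A0" for A A'
  proof -
    have eu: "A e u" "A' e u"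
      using Bu(2) BuB' A(2) A'(2) by blast+
    have "A x u"
      using agreeD[OF agr xy(1) u] A0u by simp
    then have Aex: "A e x"
      using eu(1) Einf_sym[OF A(1)] Einf_trans[OF A(1)] by blast
    have "B \<le> A"
      using nbD(2)[OF Bu(1)] BuB' A(2) by (meson order_trans)
    then have "agree (Suc e) A q"
      using agree_next_lead[OF B A(1) _ qE Bq agree_trans[OF agr agree_sym[OF qA0]] e_def xy(1) Aex q(2)]
      by blast
    then have "A \<in> nb (Suc e) C"
      using B'(2) A by blast
    then have "agree (Suc e) A' c"
      using c P by blast
    then have "A' e x \<longleftrightarrow> c e x"
      by (rule agreeD) (use e xy in auto)
    then have "A' e x" "A' e y"
      using eu(2) by (auto simp: u_def split: if_splits)
    then show "A' x y"
      using Einf_sym[OF A'(1)] Einf_trans[OF A'(1)] by blast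
  qed
  moreover have "B' \<in> nb M B"
    using nb_trans[OF nb_mono[OF B'(1)] Bu(1) order_refl] e by simp
  ultimately show ?thesis
    by blast
qed

text \<open>Below \<open>M\<close> there are finitely many triples of a trace and two points;
  \<open>decided_separate\<close> treats them one after another, and fusion lets \<open>M\<close>
  grow.\<close>

lemma decided_negligible:
  assumes dec: "decided P"
  shows "negligible_rel P"
  unfolding negligible_rel_def persistent_def
proof (intro ballI allI)
  fix B m assume B: "B \<in> Einf"
  define Q where "Q M B \<longleftrightarrow> (\<forall>A\<in>Einf. \<forall>A'\<in>Einf. B \<le> A \<longrightarrow> B \<le> A' \<longrightarrow> (A, A') \<in> P \<longrightarrow>
    (\<forall>x<M. \<forall>y<M. A x y \<longrightarrow> A' x y))" for M B
  have Q_step: "\<exists>C\<in>nb M B. \<forall>A\<in>Einf. \<forall>A'\<in>Einf. C \<le> A \<longrightarrow> C \<le> A' \<longrightarrow> (A, A') \<in> P \<longrightarrow>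
      (\<forall>(p, x, y)\<in>S. pat M A = p \<longrightarrow> x < M \<longrightarrow> y < M \<longrightarrow> A x y \<longrightarrow> A' x y)"
    if "finite S" and B: "B \<in> Einf" for S M B
    using that(1)
  proof (induction S)
    case empty
    then show ?case using nb_refl[OF B] by blast
  next
    case (insert s S)
    then obtain C where C: "C \<in> nb M B" and CS: "\<And>A A'. A \<in> Einf \<Longrightarrow> A' \<in> Einf \<Longrightarrow> C \<le> A \<Longrightarrow> C \<le> A' \<Longrightarrow>
        (A, A') \<in> P \<Longrightarrow> \<forall>(p, x, y)\<in>S. pat M A = p \<longrightarrow> x < M \<longrightarrow> y < M \<longrightarrow> A x y \<longrightarrow> A' x y"
      by meson
    obtain p x y where s: "s = (p, x, y)"
      by (cases s)
    show ?case
    proof (cases "\<exists>A0\<in>Einf. C \<le> A0 \<and> pat M A0 = p \<and> x < M \<and> y < M \<and> A0 x y")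
      case False
      have "\<forall>(p, x, y)\<in>insert s S. pat M A = p \<longrightarrow> x < M \<longrightarrow> y < M \<longrightarrow> A x y \<longrightarrow> A' x y"
        if "A \<in> Einf" "A' \<in> Einf" "C \<le> A" "C \<le> A'" "(A, A') \<in> P" for A A'
        using CS[OF that] False that(1,3) s by auto
      then show ?thesis
        using C by blast
    next
      case True
      then obtain A0 where A0: "A0 \<in> Einf" "C \<le> A0" "pat M A0 = p" "x < M" "y < M" "A0 x y"
        by blast
      obtain D where D: "D \<in> nb M C" and sep: "\<And>A A'. A \<in> Einf \<Longrightarrow> A' \<in> Einf \<Longrightarrow> D \<le> A \<Longrightarrow> D \<le> A' \<Longrightarrow>
          (A, A') \<in> P \<Longrightarrow> agree M A A0 \<Longrightarrow> A' x y"
        using decided_separate[OF dec nbD(1)[OF C] A0(1,2,4,5,6)] by blast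
      have "\<forall>(p, x, y)\<in>insert s S. pat M A = p \<longrightarrow> x < M \<longrightarrow> y < M \<longrightarrow> A x y \<longrightarrow> A' x y"
        if A: "A \<in> Einf" "A' \<in> Einf" "D \<le> A" "D \<le> A'" "(A, A') \<in> P" for A A'
      proof -
        have "C \<le> A" "C \<le> A'"
          using nbD(2)[OF D] A(3,4) by (auto intro: order_trans)
        then show ?thesis
          using CS[OF A(1,2) _ _ A(5)] sep[OF A] A0(3) s by (auto simp flip: pat_eq_iff)
      qed
      then show ?thesis
        using nb_trans[OF D C order_refl] by blast
    qed
  qed
  have "\<exists>L\<in>nb m B. Q m L \<and> (\<forall>x\<ge>m. lead L x \<longrightarrow> Q (Suc x) L)"
  proof (rule fusion[OF B])
    show "Q M C" if "Q M A" "C \<in> nb M A" for M A C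
      using that(1) order_trans[OF nbD(2)[OF that(2)]] unfolding Q_def by meson
    show "\<exists>C\<in>nb M A. Q M C" if A: "A \<in> Einf" for M A
    proof -
      have "finite (range (pat M) \<times> {..<M} \<times> {..<M})"
        using finite_pats by blast
      from Q_step[OF this A, of M] obtain C where C: "C \<in> nb M A"
        and CS: "\<And>D D'. D \<in> Einf \<Longrightarrow> D' \<in> Einf \<Longrightarrow> C \<le> D \<Longrightarrow> C \<le> D' \<Longrightarrow> (D, D') \<in> P \<Longrightarrow>
          \<forall>(p, x, y)\<in>range (pat M) \<times> {..<M} \<times> {..<M}. pat M D = p \<longrightarrow> x < M \<longrightarrow> y < M \<longrightarrow> D x y \<longrightarrow> D' x y"
        by meson
      have "Q M C"
        unfolding Q_def
      proof (intro ballI allI impI)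
        fix D D' x y
        assume D: "D \<in> Einf" "D' \<in> Einf" "C \<le> D" "C \<le> D'" "(D, D') \<in> P" and xy: "x < M" "y < M" "D x y"
        then have "(pat M D, x, y) \<in> range (pat M) \<times> {..<M} \<times> {..<M}"
          by simp
        from CS[OF D, rule_format, OF this] show "D' x y"
          using xy by simp
      qed
      with C show ?thesis by blast
    qed
  qed
  then obtain L where L: "L \<in> nb m B" "\<And>x. x \<ge> m \<Longrightarrow> lead L x \<Longrightarrow> Q (Suc x) L"
    by blast
  have "A \<le> A'" if A: "A \<in> Einf" "A' \<in> Einf" "L \<le> A" "L \<le> A'" "(A, A') \<in> P" for A A'
  proof (intro predicate2I)
    fix x y assume xy: "A x y"
    obtain z where z: "max m (max x y) \<le> z" "lead L z"
      using Einf_lead[OF nbD(1)[OF L(1)]] by blast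
    then have "x < Suc z" "y < Suc z" "Q (Suc z) L"
      using L(2)[of z] by auto
    then show "A' x y"
      using A xy unfolding Q_def by blast
  qed
  then show "\<exists>B'\<in>nb m B. kills P B'"
    using L(1) unfolding kills_def by blast
qed

section \<open>Analytic relations\<close>

text \<open>Closedness in the product topology, stated through finite approximations; the last
  coordinate is a witness in Baire space.\<close>

definition limit_closed ::
  "((nat \<Rightarrow> nat \<Rightarrow> bool) \<times> (nat \<Rightarrow> nat \<Rightarrow> bool) \<times> (nat \<Rightarrow> nat)) set \<Rightarrow> bool" where
  "limit_closed F \<longleftrightarrow> (\<forall>A A' z. (\<forall>n. \<exists>D D' w. agree n D A \<and> agree n D' A' \<and> (\<forall>i<n. w i = z i) \<and>
    (D, D', w) \<in> F) \<longrightarrow> (A, A', z) \<in> F)"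

definition analytic_rel :: "((nat \<Rightarrow> nat \<Rightarrow> bool) \<times> (nat \<Rightarrow> nat \<Rightarrow> bool)) set \<Rightarrow> bool" where
  "analytic_rel S \<longleftrightarrow> (\<exists>F. limit_closed F \<and> S = {(A, A'). \<exists>z. (A, A', z) \<in> F})"

text \<open>Closed relations are analytic, with every sequence as a witness.\<close>

lemma analytic_relI:
  assumes "\<And>A A'. (A, A') \<notin> S \<Longrightarrow>
    \<exists>n. \<forall>D D'. agree n D A \<longrightarrow> agree n D' A' \<longrightarrow> (D, D') \<notin> S"
  shows "analytic_rel S"
  unfolding analytic_rel_def
proof (intro exI conjI)
  show "limit_closed {(A, A', z). (A, A') \<in> S}"
    unfolding limit_closed_def
  proof (intro allI impI)
    fix A A' z
    assume *: "\<forall>n. \<exists>D D' w. agree n D A \<and> agree n D' A' \<and> (\<forall>i<n. w i = z i) \<and>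
      (D, D', w) \<in> {(A, A', z). (A, A') \<in> S}"
    have "(A, A') \<in> S"
    proof (rule ccontr)
      assume "(A, A') \<notin> S"
      from assms[OF this] obtain n where "\<And>D D'. agree n D A \<Longrightarrow> agree n D' A' \<Longrightarrow> (D, D') \<notin> S"
        by blast
      then show False
        using *[rule_format, of n] by auto
    qed
    then show "(A, A', z) \<in> {(A, A', z). (A, A') \<in> S}"
      by simp
  qed
  show "S = {(A, A'). \<exists>z. (A, A', z) \<in> {(A, A', z). (A, A') \<in> S}}"
    by auto
qed

text \<open>The first entry of a witness names the index; the remaining ones are a witness for that
  member.\<close>

lemma analytic_rel_UN:
  assumes "\<And>n :: nat. analytic_rel (S n)"
  shows "analytic_rel (\<Union>n. S n)"
proof -
  have "\<forall>n. \<exists>F. limit_closed F \<and> S n = {(A, A'). \<exists>z. (A, A', z) \<in> F}"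
    using assms unfolding analytic_rel_def by blast
  from choice[OF this] obtain F
    where F: "\<And>n. limit_closed (F n)" and S: "\<And>n. S n = {(A, A'). \<exists>z. (A, A', z) \<in> F n}"
    by blast
  define U where "U = {(A, A', z). (A, A', \<lambda>i. z (Suc i)) \<in> F (z 0)}"
  have "limit_closed U"
    unfolding limit_closed_def
  proof (intro allI impI)
    fix A A' z
    assume *: "\<forall>n. \<exists>D D' w. agree n D A \<and> agree n D' A' \<and> (\<forall>i<n. w i = z i) \<and> (D, D', w) \<in> U"
    have "\<exists>D D' w. agree n D A \<and> agree n D' A' \<and> (\<forall>i<n. w i = z (Suc i)) \<and> (D, D', w) \<in> F (z 0)" for n
    proof -
      obtain D D' w where w: "agree (Suc n) D A" "agree (Suc n) D' A'" "\<forall>i<Suc n. w i = z i" "(D, D', w) \<in> U"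
        using * by blast
      then have "agree n D A" "agree n D' A'" "\<forall>i<n. w (Suc i) = z (Suc i)" "(D, D', \<lambda>i. w (Suc i)) \<in> F (z 0)"
        by (simp_all add: U_def agree_def)
      then show ?thesis
        by (intro exI[of _ D] exI[of _ D'] exI[of _ "\<lambda>i. w (Suc i)"]) simp
    qed
    then have "(A, A', \<lambda>i. z (Suc i)) \<in> F (z 0)"
      using F[of "z 0", unfolded limit_closed_def, rule_format, of A A' "\<lambda>i. z (Suc i)"] by blast
    then show "(A, A', z) \<in> U"
      by (simp add: U_def)
  qed
  moreover have "(A, A') \<in> (\<Union>n. S n) \<longleftrightarrow> (\<exists>z. (A, A', z) \<in> U)" for A A'
  proof
    assume "(A, A') \<in> (\<Union>n. S n)"
    then obtain n z where "(A, A', z) \<in> F n"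
      by (auto simp: S)
    then have "(A, A', case_nat n z) \<in> U"
      by (simp add: U_def)
    then show "\<exists>z. (A, A', z) \<in> U"
      by blast
  next
    assume "\<exists>z. (A, A', z) \<in> U"
    then obtain z where "(A, A', \<lambda>i. z (Suc i)) \<in> F (z 0)"
      by (auto simp: U_def)
    then have "(A, A') \<in> S (z 0)"
      unfolding S by blast
    then show "(A, A') \<in> (\<Union>n. S n)"
      by blast
  qed
  ultimately show ?thesis
    unfolding analytic_rel_def by (intro exI[of _ U]) auto
qed

lemma bounded_image: "\<exists>l. \<forall>i<(n :: nat). f i < (l :: nat)"
proof -
  have "finite (f ` {..<n})" by simp
  then show ?thesis
    unfolding finite_nat_set_iff_bounded by auto
qed

lemma bounded_image2: "\<exists>l. \<forall>i<(n :: nat). \<forall>j<n. f i j < (l :: nat)"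
proof -
  have "\<forall>i. \<exists>l. \<forall>j<n. f i j < l"
    using bounded_image by blast
  from choice[OF this] obtain l where l: "\<And>i j. j < n \<Longrightarrow> f i j < l i"
    by blast
  obtain k where "\<forall>i<n. l i < k"
    using bounded_image by blast
  then show ?thesis
    using l by (meson less_trans)
qed

text \<open>One witness interleaves witnesses for all members through the pairing function;
  \<open>l\<close> bounds the entries that a finite part of one component uses.\<close>

lemma analytic_rel_INT:
  assumes "\<And>n :: nat. analytic_rel (S n)"
  shows "analytic_rel (\<Inter>n. S n)"
proof -
  have "\<forall>n. \<exists>F. limit_closed F \<and> S n = {(A, A'). \<exists>z. (A, A', z) \<in> F}"
    using assms unfolding analytic_rel_def by blast
  from choice[OF this] obtain F
    where F: "\<And>n. limit_closed (F n)" and S: "\<And>n. S n = {(A, A'). \<exists>z. (A, A', z) \<in> F n}"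
    by blast
  define U where "U = {(A, A', z). \<forall>k. (A, A', \<lambda>i. z (prod_encode (k, i))) \<in> F k}"
  have "limit_closed U"
    unfolding limit_closed_def
  proof (intro allI impI)
    fix A A' z
    assume *: "\<forall>n. \<exists>D D' w. agree n D A \<and> agree n D' A' \<and> (\<forall>i<n. w i = z i) \<and> (D, D', w) \<in> U"
    have "(A, A', \<lambda>i. z (prod_encode (k, i))) \<in> F k" for k
    proof -
      have "\<exists>D D' w. agree n D A \<and> agree n D' A' \<and> (\<forall>i<n. w i = z (prod_encode (k, i))) \<and> (D, D', w) \<in> F k" for n
      proof -
        obtain l where l: "\<forall>i<n. prod_encode (k, i) < l"
          using bounded_image[of n "\<lambda>i. prod_encode (k, i)"] by blast
        obtain D D' w where w: "agree (n + l) D A" "agree (n + l) D' A'" "\<forall>i<n + l. w i = z i" "(D, D', w) \<in> U"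
          using *[rule_format, of "n + l"] by blast
        then have "agree n D A" "agree n D' A'" "\<forall>i<n. w (prod_encode (k, i)) = z (prod_encode (k, i))"
          "(D, D', \<lambda>i. w (prod_encode (k, i))) \<in> F k"
          using l by (auto simp: U_def agree_def)
        then show ?thesis
          by (intro exI[of _ D] exI[of _ D'] exI[of _ "\<lambda>i. w (prod_encode (k, i))"]) simp
      qed
      then show ?thesis
        using F[of k, unfolded limit_closed_def, rule_format, of A A' "\<lambda>i. z (prod_encode (k, i))"] by blast
    qed
    then show "(A, A', z) \<in> U"
      by (simp add: U_def)
  qed
  moreover have "(A, A') \<in> (\<Inter>n. S n) \<longleftrightarrow> (\<exists>z. (A, A', z) \<in> U)" for A A'
  proof
    assume "(A, A') \<in> (\<Inter>n. S n)"
    then have "\<forall>n. \<exists>z. (A, A', z) \<in> F n"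
      by (auto simp: S)
    from choice[OF this] obtain z where z: "\<And>n. (A, A', z n) \<in> F n"
      by blast
    have "(A, A', \<lambda>m. case prod_decode m of (k, i) \<Rightarrow> z k i) \<in> U"
      using z by (simp add: U_def)
    then show "\<exists>z. (A, A', z) \<in> U"
      by blast
  next
    assume "\<exists>z. (A, A', z) \<in> U"
    then obtain z where "\<And>k. (A, A', \<lambda>i. z (prod_encode (k, i))) \<in> F k"
      by (auto simp: U_def)
    then have "(A, A') \<in> S k" for k
      unfolding S by blast
    then show "(A, A') \<in> (\<Inter>n. S n)"
      by blast
  qed
  ultimately show ?thesis
    unfolding analytic_rel_def by (intro exI[of _ U]) auto
qed

lemma analytic_rel_Int: "analytic_rel S \<Longrightarrow> analytic_rel T \<Longrightarrow> analytic_rel (S \<inter> T)"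
proof -
  assume "analytic_rel S" "analytic_rel T"
  then have "analytic_rel (\<Inter>n :: nat. if n = 0 then S else T)"
    by (intro analytic_rel_INT) simp
  moreover have "(\<Inter>n :: nat. if n = 0 then S else T) = S \<inter> T"
  proof (intro equalityI subsetI IntI)
    fix x assume x: "x \<in> (\<Inter>n :: nat. if n = 0 then S else T)"
    show "x \<in> S" "x \<in> T"
      using INT_D[OF x, of 0] INT_D[OF x, of 1] by simp_all
  qed auto
  ultimately show ?thesis by simp
qed

section \<open>Borel relations are analytic\<close>

lemma open_fun_finite:
  fixes U :: "('a \<Rightarrow> 'b::topological_space) set"
  assumes "open U" "f \<in> U"
  obtains I X where "finite I" "\<And>i. open (X i)" "\<And>i. f i \<in> X i"
    "\<And>g. (\<And>i. i \<in> I \<Longrightarrow> g i \<in> X i) \<Longrightarrow> g \<in> U"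
proof -
  have "openin (product_topology (\<lambda>i. euclidean) UNIV) U"
    using assms(1) by (simp add: open_fun_def)
  then obtain X where X: "f \<in> Pi\<^sub>E UNIV X" "\<And>i. open (X i)" "finite {i. X i \<noteq> UNIV}" "Pi\<^sub>E UNIV X \<subseteq> U"
    using product_topology_open_contains_basis[of "\<lambda>i. euclidean" UNIV U f] assms(2) by auto
  show ?thesis
  proof (rule that[OF X(3,2)])
    show "f i \<in> X i" for i
      using X(1) by auto
    show "g \<in> U" if "\<And>i. i \<in> {i. X i \<noteq> UNIV} \<Longrightarrow> g i \<in> X i" for g
    proof -
      have "g i \<in> X i" for i
        using that by (cases "X i = UNIV") auto
      then show ?thesis
        using X(4) by auto
    qed
  qed
qed

text \<open>The topology is an iterated product: finitely many rows are constrained, and in each of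
  them finitely many entries. A common bound on all these indices is the height.\<close>

lemma open_rel_agree:
  fixes U :: "(nat \<Rightarrow> nat \<Rightarrow> bool) set"
  assumes "open U" "A \<in> U"
  shows "\<exists>n. \<forall>D. agree n D A \<longrightarrow> D \<in> U"
proof -
  obtain I X where I: "finite I" "\<And>i. open (X i)" "\<And>i. A i \<in> X i"
    "\<And>D. (\<And>i. i \<in> I \<Longrightarrow> D i \<in> X i) \<Longrightarrow> D \<in> U"
    using open_fun_finite[OF assms] by metis
  have "\<exists>J. finite J \<and> (\<forall>d. (\<forall>j\<in>J. d j = A i j) \<longrightarrow> d \<in> X i)" for i
  proof -
    obtain J Y where "finite J" "\<And>j. open (Y j)" "\<And>j. A i j \<in> Y j"
      "\<And>d. (\<And>j. j \<in> J \<Longrightarrow> d j \<in> Y j) \<Longrightarrow> d \<in> X i"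
      using open_fun_finite[OF I(2) I(3)] by metis
    then show ?thesis
      by (intro exI[of _ J]) auto
  qed
  then obtain J where J: "\<And>i. finite (J i)" "\<And>i d. (\<forall>j\<in>J i. d j = A i j) \<Longrightarrow> d \<in> X i"
    by metis
  have "finite (I \<union> (\<Union>i\<in>I. J i))"
    using I(1) J(1) by blast
  then obtain n where n: "\<And>k. k \<in> I \<union> (\<Union>i\<in>I. J i) \<Longrightarrow> k < n"
    using finite_nat_set_iff_bounded by meson
  have "D \<in> U" if "agree n D A" for D
  proof (rule I(4))
    fix i assume "i \<in> I"
    then show "D i \<in> X i"
      using that n by (intro J(2)) (auto simp: agree_def)
  qed
  then show ?thesis by blast
qed

lemma open_pair_agree:
  fixes U :: "((nat \<Rightarrow> nat \<Rightarrow> bool) \<times> (nat \<Rightarrow> nat \<Rightarrow> bool)) set"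
  assumes "open U" "(A, A') \<in> U"
  shows "\<exists>n. \<forall>D D'. agree n D A \<longrightarrow> agree n D' A' \<longrightarrow> (D, D') \<in> U"
proof -
  obtain V W where VW: "open V" "open W" "A \<in> V" "A' \<in> W" "V \<times> W \<subseteq> U"
    using open_prod_elim[OF assms] by (metis mem_Times_iff fst_conv snd_conv)
  obtain n k where n: "\<And>D. agree n D A \<Longrightarrow> D \<in> V" and k: "\<And>D. agree k D A' \<Longrightarrow> D \<in> W"
    using open_rel_agree[OF VW(1,3)] open_rel_agree[OF VW(2,4)] by blast
  have "(D, D') \<in> U" if "agree (max n k) D A" "agree (max n k) D' A'" for D D'
    using n[OF agree_mono[OF that(1)]] k[OF agree_mono[OF that(2)]] VW(5) by auto
  then show ?thesis by blast
qed

lemma analytic_rel_countable_UN: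
  assumes "countable I" "\<And>i. i \<in> I \<Longrightarrow> analytic_rel (S i)"
  shows "analytic_rel (\<Union>i\<in>I. S i)"
proof (cases "I = {}")
  case True
  then show ?thesis
    by (auto intro: analytic_relI)
next
  case False
  have "(\<Union>i\<in>I. S i) = (\<Union>i\<in>range (from_nat_into I). S i)"
    by (simp only: range_from_nat_into[OF False assms(1)])
  then have "(\<Union>i\<in>I. S i) = (\<Union>n. S (from_nat_into I n))"
    by (simp add: image_image)
  then show ?thesis
    using analytic_rel_UN[of "\<lambda>n. S (from_nat_into I n)"] assms(2) from_nat_into[OF False] by simp
qed

lemma analytic_rel_open:
  assumes "open U"
  shows "analytic_rel U"
proof -
  define T where "T = (\<lambda>(n, p, p'). {(D, D'). pat n D = p \<and> pat n D' = p'})"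
  define I where "I = {(n, p, p') \<in> UNIV \<times> Collect finite \<times> Collect finite. T (n, p, p') \<subseteq> U}"
  have "countable (UNIV \<times> Collect finite \<times> Collect finite :: (nat \<times> (nat \<times> nat) set \<times> (nat \<times> nat) set) set)"
    by (intro countable_SIGMA countable_Collect_finite) auto
  then have "countable I"
    by (rule countable_subset[rotated]) (auto simp: I_def)
  moreover have "analytic_rel (T i)" for i
  proof (rule analytic_relI)
    fix A A' assume "(A, A') \<notin> T i"
    moreover obtain n p p' where "i = (n, p, p')"
      by (cases i)
    ultimately show "\<exists>n. \<forall>D D'. agree n D A \<longrightarrow> agree n D' A' \<longrightarrow> (D, D') \<notin> T i"
      by (intro exI[of _ n]) (auto simp: T_def simp flip: pat_eq_iff)
  qed
  moreover have "U = (\<Union>i\<in>I. T i)"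
  proof
    show "U \<subseteq> (\<Union>i\<in>I. T i)"
    proof safe
      fix A A' assume "(A, A') \<in> U"
      from open_pair_agree[OF assms this] obtain n
        where n: "\<And>D D'. agree n D A \<Longrightarrow> agree n D' A' \<Longrightarrow> (D, D') \<in> U"
        by blast
      have "finite (pat n D)" for D
        by (rule finite_subset[of _ "{..<n} \<times> {..<n}"]) (auto simp: pat_def)
      then have "(n, pat n A, pat n A') \<in> I"
        using n by (auto simp: I_def T_def pat_eq_iff)
      moreover have "(A, A') \<in> T (n, pat n A, pat n A')"
        by (simp add: T_def)
      ultimately show "(A, A') \<in> (\<Union>i\<in>I. T i)"
        by blast
    qed
    show "(\<Union>i\<in>I. T i) \<subseteq> U"
      by (auto simp: I_def)
  qed
  ultimately show ?thesis
    using analytic_rel_countable_UN by metis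
qed

text \<open>Analytic relations are not closed under complements, so the induction carries
  \<open>S\<close> together with \<open>- S\<close>.\<close>

lemma analytic_rel_borel:
  assumes "S \<in> sets borel"
  shows "analytic_rel S"
proof -
  have "S \<in> sigma_sets UNIV {S. open S}"
    using assms by (simp add: borel_def)
  then have "analytic_rel S \<and> analytic_rel (- S)"
  proof (induction S)
    case (Basic U)
    then have "analytic_rel (- U)"
      using open_pair_agree[of U] by (intro analytic_relI) auto
    then show ?case
      using Basic analytic_rel_open by blast
  next
    case Empty
    then show ?case
      using analytic_rel_open[of "{}"] analytic_rel_open[of UNIV] by simp
  next
    case (Compl S)
    then show ?case
      by (simp add: Compl_eq_Diff_UNIV[symmetric])
  next
    case (Union S)
    then show ?case
      using analytic_rel_UN[of S] analytic_rel_INT[of "\<lambda>n. - S n"] by (simp add: Compl_UN)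
  qed
  then show ?thesis ..
qed

text \<open>\<open>E\<close> is Borel relative to \<open>Einf \<times> Einf\<close>, so that product
  must be analytic itself. Being an equivalence is a closed condition; leaders beyond every
  \<open>n\<close> are a countable intersection of countable unions of closed conditions.\<close>

lemma analytic_Einf: "analytic_rel (Einf \<times> Einf)"
proof -
  define \<E> where "\<E> = {(A, A'). equivp (A :: nat \<Rightarrow> nat \<Rightarrow> bool) \<and> equivp (A' :: nat \<Rightarrow> nat \<Rightarrow> bool)}"
  define \<L> where "\<L> n x = {(A, A' :: nat \<Rightarrow> nat \<Rightarrow> bool). n \<le> x \<and> lead A x}" for n x
  define \<L>' where "\<L>' n x = {(A :: nat \<Rightarrow> nat \<Rightarrow> bool, A'). n \<le> x \<and> lead A' x}" for n x
  have "analytic_rel \<E>"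
  proof (rule analytic_relI)
    have *: "\<exists>n. \<forall>D. agree n D A \<longrightarrow> \<not> equivp D" if A: "\<not> equivp A" for A
    proof -
      have "\<exists>i j k. \<not> (A i i \<and> (A i j \<longrightarrow> A j i) \<and> (A i j \<longrightarrow> A j k \<longrightarrow> A i k))"
        using A by (metis equivpI reflpI sympI transpI)
      then obtain i j k where *: "\<not> (A i i \<and> (A i j \<longrightarrow> A j i) \<and> (A i j \<longrightarrow> A j k \<longrightarrow> A i k))"
        by blast
      have "\<not> equivp D" if D: "agree (Suc (i + j + k)) D A" for D
      proof
        assume "equivp D"
        then have "D i i \<and> (D i j \<longrightarrow> D j i) \<and> (D i j \<longrightarrow> D j k \<longrightarrow> D i k)"
          by (meson equivp_reflp equivp_symp equivp_transp)
        then show False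
          using * by (simp add: agreeD[OF D])
      qed
      then show ?thesis by blast
    qed
    fix A A' assume "(A, A') \<notin> \<E>"
    then show "\<exists>n. \<forall>D D'. agree n D A \<longrightarrow> agree n D' A' \<longrightarrow> (D, D') \<notin> \<E>"
      using *[of A] *[of A'] by (auto simp: \<E>_def)
  qed
  moreover have "analytic_rel (\<L> n x)" "analytic_rel (\<L>' n x)" for n x
  proof -
    show "analytic_rel (\<L> n x)"
      by (rule analytic_relI) (use lead_agree in \<open>auto simp: \<L>_def intro!: exI[of _ "Suc x"]\<close>)
    show "analytic_rel (\<L>' n x)"
      by (rule analytic_relI) (use lead_agree in \<open>auto simp: \<L>'_def intro!: exI[of _ "Suc x"]\<close>)
  qed
  then have "analytic_rel (\<Inter>n. \<Union>x. \<L> n x)" "analytic_rel (\<Inter>n. \<Union>x. \<L>' n x)"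
    by (auto intro!: analytic_rel_INT analytic_rel_UN)
  ultimately have "analytic_rel (\<E> \<inter> (\<Inter>n. \<Union>x. \<L> n x) \<inter> (\<Inter>n. \<Union>x. \<L>' n x))"
    by (intro analytic_rel_Int)
  moreover have "\<E> \<inter> (\<Inter>n. \<Union>x. \<L> n x) \<inter> (\<Inter>n. \<Union>x. \<L>' n x) = Einf \<times> Einf"
    by (auto simp: \<E>_def \<L>_def \<L>'_def Einf_iff)
  ultimately show ?thesis by simp
qed

section \<open>Small and bad pieces\<close>

text \<open>Joins the witness with the entries of \<open>A'\<close>, so that one finite list
  approximates both. The first component is left to neighbourhoods.\<close>

definition code :: "(nat \<Rightarrow> nat \<Rightarrow> bool) \<Rightarrow> (nat \<Rightarrow> nat) \<Rightarrow> nat \<Rightarrow> nat \<times> bool" where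
  "code A z n = (z n, A (fst (prod_decode n)) (snd (prod_decode n)))"

definition piece ::
  "((nat \<Rightarrow> nat \<Rightarrow> bool) \<times> (nat \<Rightarrow> nat \<Rightarrow> bool) \<times> (nat \<Rightarrow> nat)) set \<Rightarrow> (nat \<times> bool) list \<Rightarrow>
    ((nat \<Rightarrow> nat \<Rightarrow> bool) \<times> (nat \<Rightarrow> nat \<Rightarrow> bool)) set" where
  "piece F t = {(A, A'). \<exists>z. (A, A', z) \<in> F \<and> (\<forall>n<length t. t ! n = code A' z n)}"

definition extends :: "'a list \<Rightarrow> 'a list \<Rightarrow> bool" where
  "extends t t' \<longleftrightarrow> (\<exists>s. s \<noteq> [] \<and> t' = t @ s)"

text \<open>Incompatible codes might differ in the witness alone. Opposite values at one entry make
  the relations \<open>A'\<close> themselves differ, as is needed for counting the members of a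
  class.\<close>

definition separated where
  "separated F t1 t2 \<longleftrightarrow> (\<exists>i j. (\<forall>A A'. (A, A') \<in> piece F t1 \<longrightarrow> A' i j) \<and>
    (\<forall>A A'. (A, A') \<in> piece F t2 \<longrightarrow> \<not> A' i j))"

definition small where
  "small F M C t \<longleftrightarrow> negligible_rel (piece F t \<inter> nb M C \<times> UNIV)"

text \<open>All greater heights and all smaller neighbourhoods are included, so that badness is
  hereditary.\<close>

definition bad where
  "bad F M C t \<longleftrightarrow> (\<forall>N\<ge>M. \<forall>D\<in>nb M C. \<not> small F N D t)"

lemma nb_subset: "D \<in> nb M C \<Longrightarrow> M \<le> N \<Longrightarrow> nb N D \<subseteq> nb M C"
  using nb_trans by blast

lemma small_nb: "small F M C t \<Longrightarrow> M \<le> N \<Longrightarrow> D \<in> nb M C \<Longrightarrow> small F N D t"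
  unfolding small_def by (erule negligible_rel_subset) (use nb_subset in blast)

lemma bad_nb: "bad F M C t \<Longrightarrow> M \<le> N \<Longrightarrow> D \<in> nb M C \<Longrightarrow> bad F N D t"
  unfolding bad_def using nb_subset by (meson order_trans subsetD)

lemma piece_agree:
  "\<exists>l. \<forall>D D' t. l \<le> length t \<longrightarrow> t = map (code A' z) [0..<length t] \<longrightarrow>
    (D, D') \<in> piece F t \<longrightarrow> agree n D' A'"
proof -
  obtain l where l: "\<forall>i<n. \<forall>j<n. prod_encode (i, j) < l"
    using bounded_image2[of n "\<lambda>i j. prod_encode (i, j)"] by blast
  have "agree n D' A'" if t: "l \<le> length t" "t = map (code A' z) [0..<length t]" and D: "(D, D') \<in> piece F t"
    for D D' t
    unfolding agree_def
  proof (intro allI impI)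
    fix i j assume "i < n" "j < n"
    then have *: "prod_encode (i, j) < length t"
      using l t(1) by (meson less_le_trans)
    obtain w where "\<forall>n<length t. t ! n = code D' w n"
      using D by (auto simp: piece_def)
    then have "t ! prod_encode (i, j) = code D' w (prod_encode (i, j))"
      using * by blast
    moreover have "t ! prod_encode (i, j) = code A' z (prod_encode (i, j))"
      using t(2) * by (metis add_0 diff_zero length_map length_upt nth_map nth_upt)
    ultimately show "D' i j = A' i j"
      by (simp add: code_def)
  qed
  then show ?thesis
    by blast
qed

text \<open>For one code the alternative is hereditary, and dense because a neighbourhood that is
  not bad contains a small one. The codes are countable in number.\<close>

lemma small_or_bad: "persistent (\<lambda>B. \<forall>t. \<forall>A\<in>Einf. B \<le> A \<longrightarrow> (\<exists>M. small F M A t \<or> bad F M A t))"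
proof -
  define K where "K t B \<longleftrightarrow> (\<forall>A\<in>Einf. B \<le> A \<longrightarrow> (\<exists>M. small F M A t \<or> bad F M A t))" for t B
  have "persistent (K t)" for t
    unfolding K_def
  proof (rule persistent_dense)
    show "small F N C t \<or> bad F N C t" if "small F M A t \<or> bad F M A t" "M \<le> N" "C \<in> nb M A" for M N A C
      using that small_nb bad_nb by blast
    show "\<exists>N. \<exists>C\<in>nb M A. small F N C t \<or> bad F N C t" if "A \<in> Einf" for M A
      using nb_refl[OF that] unfolding bad_def by blast
  qed
  have "persistent (\<lambda>B. \<forall>n. K (from_nat n) B)"
  proof (rule persistent_all)
    show "K (from_nat n) A" if "B \<le> A" "K (from_nat n) B" for n A B
      using that(2) order_trans[OF that(1)] unfolding K_def by meson
  qed fact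
  moreover have "(\<forall>n. K (from_nat n) B) \<longleftrightarrow> (\<forall>t. K t B)" for B
    using surj_from_nat by (metis surj_def)
  ultimately show ?thesis
    by (simp add: K_def)
qed

text \<open>
  Uncountably many sets \<open>nb M A\<close> can be small; modulo coarsening only the countably many largest ones
  matter.
\<close>

lemma negligible_small: "negligible_rel {(A, A'). (A, A') \<in> piece F t \<and> (\<exists>M. small F M A t)}"
proof (rule negligible_rel_locally)
  fix B m assume B: "B \<in> Einf"
  have "\<exists>L\<in>nb m B. \<forall>A\<in>Einf. L \<le> A \<longrightarrow> (small F m A t \<or> (\<forall>C\<in>nb m A. \<not> small F m C t)) \<and>
        (\<forall>x\<ge>m. lead L x \<longrightarrow> small F (Suc x) A t \<or> (\<forall>C\<in>nb (Suc x) A. \<not> small F (Suc x) C t))"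
    proof (rule fusion_all[OF B])
      show "small F M C t \<or> (\<forall>D\<in>nb M C. \<not> small F M D t)"
        if "small F M A t \<or> (\<forall>D\<in>nb M A. \<not> small F M D t)" "C \<in> nb M A" for M A C
        using that small_nb[of F M A t M C] nb_subset[OF that(2) order_refl] by blast
      show "\<exists>C\<in>nb M A. small F M C t \<or> (\<forall>D\<in>nb M C. \<not> small F M D t)" if "A \<in> Einf" for M A
        using nb_refl[OF that] by blast
    qed
  then obtain L where L: "L \<in> nb m B"
    and dec0: "\<forall>A\<in>Einf. L \<le> A \<longrightarrow> (small F m A t \<or> (\<forall>C\<in>nb m A. \<not> small F m C t)) \<and>
        (\<forall>x\<ge>m. lead L x \<longrightarrow> small F (Suc x) A t \<or> (\<forall>C\<in>nb (Suc x) A. \<not> small F (Suc x) C t))"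
    by (rule bexE)
  have dec: "small F (Suc x) A t \<or> (\<forall>C\<in>nb (Suc x) A. \<not> small F (Suc x) C t)"
    if "A \<in> Einf" "L \<le> A" "m \<le> x" "lead L x" for A x
    using dec0[rule_format, OF that(1,2)] that(3,4) by simp
  define g where "g = (\<lambda>(M, p). glue M (\<lambda>i j. (i, j) \<in> p) L)"
  define I where "I = {(M, p). finite p \<and> small F M (g (M, p)) t}"
  define Q where "Q = (\<Union>(M, p)\<in>I. piece F t \<inter> nb M (g (M, p)) \<times> UNIV)"
  have "countable ((UNIV :: nat set) \<times> (Collect finite :: (nat \<times> nat) set set))"
    by (intro countable_SIGMA countable_Collect_finite) auto
  then have "countable I"
    by (rule countable_subset[rotated]) (auto simp: I_def)
  then have "negligible_rel Q"
    unfolding Q_def by (rule negligible_rel_UN) (auto simp: I_def small_def)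
  moreover have "(A, A') \<in> Q" if A: "A \<in> Einf" "L \<le> A"
    and P: "(A, A') \<in> piece F t" and M: "small F M A t" for A A' M
  proof -
    obtain x where x: "max m M \<le> x" "lead A x"
      using Einf_lead[OF A(1)] by blast
    have leadL: "lead L x"
      using lead_antimono[OF A(2) x(2)] .
    define p where "p = pat (Suc x) A"
    have "agree (Suc x) (\<lambda>i j. (i, j) \<in> p) A"
      by (auto simp: p_def pat_def agree_def)
    then have g: "g (Suc x, p) = glue (Suc x) A L"
      unfolding g_def by (simp add: glue_cong)
    note gl = glue[where M = "Suc x", OF A(1) nbD(1)[OF L] A(2)]
    have "small F (Suc x) A t"
      using small_nb[OF M _ nb_refl[OF A(1)]] x(1) by simp
    \<comment> \<open>The neighbourhood of the glued relation contains the small one of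
      \<open>A\<close>, so by the decision it is small itself. It serves all \<open>A\<close> with
      this trace.\<close>
    then have "small F (Suc x) (g (Suc x, p)) t"
      using dec[OF gl(1,2) _ leadL] gl(5) x(1) unfolding g by auto
    moreover have "finite p"
      unfolding p_def by (rule finite_subset[of _ "{..<Suc x} \<times> {..<Suc x}"]) (auto simp: pat_def)
    ultimately have "(Suc x, p) \<in> I"
      by (simp add: I_def)
    moreover have "(A, A') \<in> piece F t \<inter> nb (Suc x) (g (Suc x, p)) \<times> UNIV"
      using P gl(5) unfolding g by simp
    ultimately show ?thesis
      unfolding Q_def by blast
  qed
  then have "\<forall>A\<in>Einf. \<forall>A'\<in>Einf. L \<le> A \<longrightarrow> L \<le> A' \<longrightarrow>
      (A, A') \<in> {(A, A'). (A, A') \<in> piece F t \<and> (\<exists>M. small F M A t)} \<longrightarrow> (A, A') \<in> Q"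
    by blast
  ultimately show "\<exists>B'\<in>nb m B. \<exists>Q. negligible_rel Q \<and> (\<forall>A\<in>Einf. \<forall>A'\<in>Einf. B' \<le> A \<longrightarrow> B' \<le> A' \<longrightarrow>
      (A, A') \<in> {(A, A'). (A, A') \<in> piece F t \<and> (\<exists>M. small F M A t)} \<longrightarrow> (A, A') \<in> Q)"
    using L by blast
qed

text \<open>
  If no two separated refinements of \<open>t\<close> are bad together, then each \<open>A\<close> has at most one partner \<open>A'\<close>
  all of whose approximations are bad at \<open>A\<close>, and open Ramsey sets decide this partner.
\<close>

lemma bad_split:
  assumes C0: "C0 \<in> Einf" and bad0: "bad F M0 C0 t"
  shows "\<exists>N\<ge>M0. \<exists>C\<in>nb M0 C0. \<exists>t1 t2. extends t t1 \<and> extends t t2 \<and> separated F t1 t2 \<and>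
    bad F N C t1 \<and> bad F N C t2"
proof (rule ccontr)
  assume neg: "\<not> ?thesis"
  have no_sep: "\<not> separated F t1 t2" if "bad F N D t1" "bad F N' D t2" "D \<in> nb M0 C0"
    "extends t t1" "extends t t2" for N N' D t1 t2
  proof
    assume sep: "separated F t1 t2"
    have D: "D \<in> Einf" using nbD(1)[OF that(3)] .
    let ?N = "max M0 (max N N')"
    have "bad F ?N D t1" "bad F ?N D t2"
      using that(1,2) nb_refl[OF D] by (auto intro: bad_nb)
    then show False
      using neg that(3-5) sep by (meson max.cobounded1)
  qed
  define P where "P = {(A, A'). A \<in> nb M0 C0 \<and>
    (\<forall>n. \<exists>t' M. extends t t' \<and> (\<forall>D D'. (D, D') \<in> piece F t' \<longrightarrow> agree n D' A') \<and> bad F M A t')}"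
  \<comment> \<open>\<open>c\<close> is a height with a trace, and \<open>G c N D\<close> says that
    some refinement bad at \<open>D\<close> forces this trace on the second component. Heredity of
    badness makes \<open>open_Ramsey\<close> applicable.\<close>
  define G where "G c N D \<longleftrightarrow> M0 \<le> N \<and> D \<in> nb M0 C0 \<and> (\<exists>t'. extends t t' \<and>
    (\<forall>X X'. (X, X') \<in> piece F t' \<longrightarrow> pat (fst c) X' = snd c) \<and> bad F N D t')" for c N D
  have "decided P"
    unfolding decided_def
  proof (intro allI ballI)
    fix M A assume A: "A \<in> Einf"
    have "\<exists>C\<in>nb M A. \<forall>p\<in>S. (\<forall>D\<in>nb M C. \<exists>N. G (M, p) N D) \<or> (\<forall>D\<in>nb M C. \<forall>N. \<not> G (M, p) N D)"
      if "finite S" for S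
      using that
    proof (induction S)
      case empty
      then show ?case using nb_refl[OF A] by blast
    next
      case (insert p S)
      then obtain C where C: "C \<in> nb M A"
        and CS: "\<forall>p\<in>S. (\<forall>D\<in>nb M C. \<exists>N. G (M, p) N D) \<or> (\<forall>D\<in>nb M C. \<forall>N. \<not> G (M, p) N D)"
        by blast
      have G_nb: "G (M, p) N' D'" if "G (M, p) N D" "N \<le> N'" "D' \<in> nb N D" for N N' D D'
      proof -
        obtain t' where t': "extends t t'" "\<forall>X X'. (X, X') \<in> piece F t' \<longrightarrow> pat M X' = p" "bad F N D t'"
          and N: "M0 \<le> N" "D \<in> nb M0 C0"
          using \<open>G (M, p) N D\<close> by (auto simp: G_def)
        have "bad F N' D' t'" "D' \<in> nb M0 C0" "M0 \<le> N'"
          using bad_nb[OF t'(3) that(2,3)] nb_trans[OF that(3) N(2,1)] N(1) that(2) by auto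
        then show ?thesis
          using t' by (auto simp: G_def)
      qed
      obtain C' where C': "C' \<in> nb M C"
        and "(\<forall>D\<in>nb M C'. \<exists>N. G (M, p) N D) \<or> (\<forall>D\<in>nb M C'. \<forall>N. \<not> G (M, p) N D)"
        using open_Ramsey[of "G (M, p)" C M, OF _ nbD(1)[OF C]] G_nb by blast
      moreover have "nb M C' \<subseteq> nb M C"
        using nb_subset[OF C' order_refl] .
      ultimately have "\<forall>q\<in>insert p S. (\<forall>D\<in>nb M C'. \<exists>N. G (M, q) N D) \<or> (\<forall>D\<in>nb M C'. \<forall>N. \<not> G (M, q) N D)"
        using CS by blast
      then show ?case
        using nb_trans[OF C' C order_refl] by blast
    qed
    from this[OF finite_pats[of M]] obtain C where C: "C \<in> nb M A" and alt: "\<And>p. p \<in> range (pat M) \<Longrightarrow>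
        (\<forall>D\<in>nb M C. \<exists>N. G (M, p) N D) \<or> (\<forall>D\<in>nb M C. \<forall>N. \<not> G (M, p) N D)"
      by blast
    have G_P: "\<exists>N. G (M, pat M D') N D" if "(D, D') \<in> P" for D D'
    proof -
      have D: "D \<in> nb M0 C0" and "\<forall>n. \<exists>t' N. extends t t' \<and>
          (\<forall>X X'. (X, X') \<in> piece F t' \<longrightarrow> agree n X' D') \<and> bad F N D t'"
        using \<open>(D, D') \<in> P\<close> by (simp_all add: P_def)
      then obtain t' N where t': "extends t t'" "\<forall>X X'. (X, X') \<in> piece F t' \<longrightarrow> agree M X' D'" "bad F N D t'"
        by blast
      have "bad F (max M0 N) D t'"
        using t'(3) nb_refl[OF nbD(1)[OF D]] by (auto intro: bad_nb)
      then have "G (M, pat M D') (max M0 N) D"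
        unfolding G_def using D t'(1,2) by (auto simp: pat_eq_iff)
      then show ?thesis ..
    qed
    have unique: "pat M D' = p" if G: "G (M, p) N D" and P: "(D, D') \<in> P" for N D D' p
    proof (rule ccontr)
      assume ne: "pat M D' \<noteq> p"
      obtain t1 where t1: "extends t t1" "\<And>X X'. (X, X') \<in> piece F t1 \<Longrightarrow> pat M X' = p" "bad F N D t1"
        and D: "D \<in> nb M0 C0"
        using G by (auto simp: G_def)
      obtain t2 N2 where t2: "extends t t2" "\<And>X X'. (X, X') \<in> piece F t2 \<Longrightarrow> pat M X' = pat M D'" "bad F N2 D t2"
      proof -
        have "\<forall>n. \<exists>t' N. extends t t' \<and> (\<forall>X X'. (X, X') \<in> piece F t' \<longrightarrow> agree n X' D') \<and> bad F N D t'"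
          using P by (simp add: P_def)
        from this[rule_format, of M] show ?thesis
          using that unfolding pat_eq_iff by blast
      qed
      obtain i j where ij: "(i, j) \<in> pat M D' \<longleftrightarrow> (i, j) \<notin> p"
        using ne by auto
      have *: "X' i j \<longleftrightarrow> (i, j) \<in> q" if "pat M X' = q" "i < M" "j < M" for X' q
        using that by (auto simp: pat_def)
      show False
      proof (cases "i < M \<and> j < M")
        case True
        have s1: "X' i j \<longleftrightarrow> (i, j) \<in> p" if "(X, X') \<in> piece F t1" for X X'
          using * t1(2)[OF that] True by blast
        have s2: "X' i j \<longleftrightarrow> (i, j) \<notin> p" if "(X, X') \<in> piece F t2" for X X'
          using * t2(2)[OF that] True ij by blast
        have "separated F t1 t2 \<or> separated F t2 t1"
          unfolding separated_def using s1 s2 by (cases "(i, j) \<in> p") blast+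
        then show False
          using no_sep t1(1,3) t2(1,3) D by blast
      next
        case False
        then have "(i, j) \<in> p" "(i, j) \<notin> pat M D'"
          using ij by (auto simp: pat_def)
        have "(i, j) \<notin> pat M X" for X
          using False by (auto simp: pat_def)
        \<comment> \<open>Here \<open>p\<close> is not a trace of height \<open>M\<close>; a piece
          that forces it is empty, hence small.\<close>
        then have "piece F t1 = {}"
          using t1(2) \<open>(i, j) \<in> p\<close> by fastforce
        then have "small F N D t1"
          by (simp add: small_def negligible_rel_empty)
        then show False
          using t1(3) nb_refl[OF nbD(1)[OF D]] unfolding bad_def by blast
      qed
    qed
    show "\<exists>C\<in>nb M A. \<exists>c. \<forall>D D'. (D, D') \<in> P \<longrightarrow> D \<in> nb M C \<longrightarrow> agree M D' c"
    proof (cases "\<exists>D D'. (D, D') \<in> P \<and> D \<in> nb M C")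
      case False
      then show ?thesis using C by blast
    next
      case True
      then obtain D D' where D: "(D, D') \<in> P" "D \<in> nb M C" by blast
      then have all: "\<forall>E\<in>nb M C. \<exists>N. G (M, pat M D') N E"
        using G_P[OF D(1)] alt by blast
      have "agree M E' D'" if "(E, E') \<in> P" "E \<in> nb M C" for E E'
        using all that unique unfolding pat_eq_iff[symmetric] by blast
      then show ?thesis
        using C by blast
    qed
  qed
  then have "negligible_rel P"
    by (rule decided_negligible)
  \<comment> \<open>After shrinking by \<open>small_or_bad\<close>, a pair that lies in no small
    piece has only bad approximations, which is membership in \<open>P\<close>.\<close>
  define Q where "Q = P \<union> (\<Union>t'. {(A, A'). (A, A') \<in> piece F t' \<and> (\<exists>M. small F M A t')})"
  have "negligible_rel Q"
  proof -
    have "negligible_rel (\<Union>t'\<in>UNIV. {(A, A'). (A, A') \<in> piece F t' \<and> (\<exists>M. small F M A t')})"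
      by (intro negligible_rel_UN negligible_small) auto
    then have "negligible_rel (\<Union>b\<in>UNIV. if b then P
        else (\<Union>t'. {(A, A'). (A, A') \<in> piece F t' \<and> (\<exists>M. small F M A t')}))"
      using \<open>negligible_rel P\<close> by (intro negligible_rel_UN) auto
    then show ?thesis
      by (rule negligible_rel_subset) (auto simp: Q_def)
  qed
  have "negligible_rel (piece F t \<inter> nb M0 C0 \<times> UNIV)"
  proof (rule negligible_rel_locally)
    fix B m assume B: "B \<in> Einf"
    from small_or_bad[of F, unfolded persistent_def, THEN bspec, OF B, THEN spec, of m]
    obtain B' where B': "B' \<in> nb m B"
      and sb0: "\<forall>t. \<forall>A\<in>Einf. B' \<le> A \<longrightarrow> (\<exists>M. small F M A t \<or> bad F M A t)"
      by (rule bexE)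
    have sb: "\<exists>M. small F M A t \<or> bad F M A t" if "A \<in> Einf" "B' \<le> A" for t A
      using sb0 that by simp
    have "(A, A') \<in> Q" if A: "A \<in> Einf" "B' \<le> A" and P: "(A, A') \<in> piece F t" "A \<in> nb M0 C0" for A A'
    proof (rule ccontr)
      assume nQ: "(A, A') \<notin> Q"
      obtain z where z: "(A, A', z) \<in> F" "\<And>n. n < length t \<Longrightarrow> t ! n = code A' z n"
        using P by (auto simp: piece_def)
      have "(A, A') \<in> P"
        unfolding P_def
      proof (intro CollectI case_prodI conjI allI P(2))
        fix n
        obtain l where l: "\<And>D D' t. l \<le> length t \<Longrightarrow> t = map (code A' z) [0..<length t] \<Longrightarrow>
            (D, D') \<in> piece F t \<Longrightarrow> agree n D' A'"
          using piece_agree[of A' z F n] by blast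
        \<comment> \<open>Length \<open>l\<close> pins \<open>A'\<close> down below
          \<open>n\<close>; one more entry keeps the extension proper.\<close>
        define t' where "t' = map (code A' z) [0..<length t + Suc l]"
        have "t' = t @ map (code A' z) [length t..<length t + Suc l]"
        proof -
          have "t = map (code A' z) [0..<length t]"
            by (rule nth_equalityI) (auto simp: z(2))
          then show ?thesis
            unfolding t'_def upt_add_eq_append[OF zero_le] map_append by simp
        qed
        then have ext: "extends t t'"
          unfolding extends_def
          by (intro exI[of _ "map (code A' z) [length t..<length t + Suc l]"]) (simp del: upt_Suc)
        have "(A, A') \<in> piece F t'"
          unfolding piece_def t'_def using z(1)
          by (intro CollectI case_prodI exI[of _ z]) (simp del: upt_Suc)
        then have "\<not> small F M A t'" for M
          using nQ unfolding Q_def by blast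
        then obtain M where M: "bad F M A t'"
          using sb[OF A] by blast
        have "agree n D' A'" if "(D, D') \<in> piece F t'" for D D'
          using l[of t' D D'] that by (simp add: t'_def del: upt_Suc)
        then show "\<exists>t' M. extends t t' \<and> (\<forall>D D'. (D, D') \<in> piece F t' \<longrightarrow> agree n D' A') \<and> bad F M A t'"
          using ext M by blast
      qed
      then show False
        using nQ by (simp add: Q_def)
    qed
    then show "\<exists>B'\<in>nb m B. \<exists>Q. negligible_rel Q \<and> (\<forall>A\<in>Einf. \<forall>A'\<in>Einf. B' \<le> A \<longrightarrow> B' \<le> A' \<longrightarrow>
        (A, A') \<in> piece F t \<inter> nb M0 C0 \<times> UNIV \<longrightarrow> (A, A') \<in> Q)"
      using B' \<open>negligible_rel Q\<close> by blast
  qed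
  then have "small F M0 C0 t"
    by (simp add: small_def)
  then show False
    using bad0 nb_refl[OF C0] unfolding bad_def by blast
qed

text \<open>A level of the tree must be bad over one common neighbourhood. Codes are split one by
  one; badness of the others survives each shrinking.\<close>

lemma bad_split_all:
  assumes "finite U" and C: "C \<in> Einf" and bad: "\<And>u. u \<in> U \<Longrightarrow> bad F M C (\<tau> u)"
  shows "\<exists>N\<ge>M. \<exists>C'\<in>nb M C. \<exists>\<tau>1 \<tau>2. \<forall>u\<in>U. extends (\<tau> u) (\<tau>1 u) \<and> extends (\<tau> u) (\<tau>2 u) \<and>
    separated F (\<tau>1 u) (\<tau>2 u) \<and> bad F N C' (\<tau>1 u) \<and> bad F N C' (\<tau>2 u)"
  using assms(1,3)
proof (induction U)
  case empty
  then show ?case using nb_refl[OF C] by blast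
next
  case (insert v U)
  then obtain N C' \<tau>1 \<tau>2 where N: "M \<le> N" and C': "C' \<in> nb M C"
    and U: "\<And>u. u \<in> U \<Longrightarrow> extends (\<tau> u) (\<tau>1 u) \<and> extends (\<tau> u) (\<tau>2 u) \<and>
      separated F (\<tau>1 u) (\<tau>2 u) \<and> bad F N C' (\<tau>1 u) \<and> bad F N C' (\<tau>2 u)"
    by (metis insertCI)
  have "bad F N C' (\<tau> v)"
    using insert.prems N C' by (auto intro: bad_nb)
  from bad_split[OF nbD(1)[OF C'] this] obtain N' D t1 t2 where D: "N \<le> N'" "D \<in> nb N C'"
    and v: "extends (\<tau> v) t1" "extends (\<tau> v) t2" "separated F t1 t2" "bad F N' D t1" "bad F N' D t2"
    by blast
  have "\<forall>u\<in>insert v U. extends (\<tau> u) ((\<tau>1(v := t1)) u) \<and> extends (\<tau> u) ((\<tau>2(v := t2)) u) \<and>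
      separated F ((\<tau>1(v := t1)) u) ((\<tau>2(v := t2)) u) \<and>
      bad F N' D ((\<tau>1(v := t1)) u) \<and> bad F N' D ((\<tau>2(v := t2)) u)"
    using U v insert.hyps bad_nb[OF _ D] by auto
  moreover have "M \<le> N'" "D \<in> nb M C"
    using N D nb_trans[OF D(2) C'] by auto
  ultimately show ?case by blast
qed

section \<open>Countable sections and canonization\<close>

lemma uncountable_nat_bool: "uncountable (UNIV :: (nat \<Rightarrow> bool) set)"
proof
  assume "countable (UNIV :: (nat \<Rightarrow> bool) set)"
  then obtain g :: "nat \<Rightarrow> nat \<Rightarrow> bool" where "range g = UNIV"
    using range_from_nat_into[of "UNIV :: (nat \<Rightarrow> bool) set"] by blast
  then obtain n where "g n = (\<lambda>n. \<not> g n n)"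
    by (metis rangeE UNIV_I)
  then show False
    by (metis (full_types))
qed

lemma extends_chain:
  assumes "\<And>k. extends (t k) (t (Suc k))"
  shows "k \<le> length (t k)" "k \<le> l \<Longrightarrow> n < length (t k) \<Longrightarrow> t l ! n = t k ! n"
proof -
  have less: "length (t k) < length (t (Suc k))" for k
    using assms[of k] by (auto simp: extends_def)
  then show "k \<le> length (t k)"
    using strict_mono_imp_increasing[of "\<lambda>k. length (t k)"] by (simp add: strict_mono_Suc_iff)
  assume "k \<le> l" and n: "n < length (t k)"
  then have "n < length (t l) \<and> t l ! n = t k ! n"
  proof (induction rule: dec_induct)
    case (step l)
    then show ?case
      using assms[of l] by (auto simp: extends_def nth_append)
  qed simp
  then show "t l ! n = t k ! n" ..
qed

lemma bad_step:
  assumes C: "C \<in> Einf" and bad: "\<And>u. length u = k \<Longrightarrow> bad F M C (\<tau> u)"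
  shows "\<exists>N D \<tau>'. D \<in> nb M C \<and> (\<exists>x. M \<le> x \<and> x < N \<and> lead D x) \<and>
    (\<forall>v. length v = Suc k \<longrightarrow> bad F N D (\<tau>' v)) \<and>
    (\<forall>u. length u = k \<longrightarrow> (\<forall>b. extends (\<tau> u) (\<tau>' (u @ [b]))) \<and>
      separated F (\<tau>' (u @ [True])) (\<tau>' (u @ [False])))"
proof -
  have "finite {u :: bool list. length u = k}"
    using finite_lists_length_eq[of "UNIV :: bool set" k] by simp
  from bad_split_all[OF this C, of F M \<tau>] bad obtain N D \<tau>1 \<tau>2 where N: "M \<le> N" and D: "D \<in> nb M C"
    and *: "\<forall>u\<in>{u. length u = k}. extends (\<tau> u) (\<tau>1 u) \<and> extends (\<tau> u) (\<tau>2 u) \<and>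
      separated F (\<tau>1 u) (\<tau>2 u) \<and> bad F N D (\<tau>1 u) \<and> bad F N D (\<tau>2 u)"
    by auto
  have DE: "D \<in> Einf"
    using nbD(1)[OF D] .
  define \<tau>' where "\<tau>' v = (if last v then \<tau>1 (butlast v) else \<tau>2 (butlast v))" for v
  define x where "x = next_lead N D"
  have x: "N \<le> x" "lead D x"
    unfolding x_def using next_lead[OF DE] by auto
  \<comment> \<open>The height goes just past a new leader of \<open>D\<close>, as
    \<open>fusion_limit\<close> demands.\<close>
  show ?thesis
  proof (rule exI[of _ "Suc x"], rule exI[of _ D], rule exI[of _ \<tau>'], intro conjI allI impI D)
    show "\<exists>y. M \<le> y \<and> y < Suc x \<and> lead D y"
      using N x by (intro exI[of _ x]) simp
    show "bad F (Suc x) D (\<tau>' v)" if "length v = Suc k" for v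
    proof -
      have "bad F N D (\<tau>' v)"
        using * that by (simp add: \<tau>'_def)
      then show ?thesis
        using x(1) nb_refl[OF DE] by (auto intro: bad_nb)
    qed
  qed (use * in \<open>simp_all add: \<tau>'_def\<close>)
qed

text \<open>A perfect tree of bad pieces along a fusion sequence with limit \<open>L\<close> gives \<open>L\<close> uncountably many partners.\<close>

lemma countable_sections_negligible:
  assumes F: "limit_closed F" and E: "E = {(A, A'). \<exists>z. (A, A', z) \<in> F}"
    and count: "\<And>A. countable {A'. (A, A') \<in> E}"
  shows "negligible_rel E"
proof (cases "\<exists>M. \<exists>C\<in>Einf. bad F M C []")
  case False
  \<comment> \<open>With nothing bad anywhere, \<open>small_or_bad\<close> makes the empty code
    small at every coarsening of a suitable \<open>B'\<close>.\<close>
  have E_piece: "E = piece F []"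
    by (auto simp: E piece_def)
  show ?thesis
  proof (rule negligible_rel_locally)
    fix B m assume B: "B \<in> Einf"
    from small_or_bad[of F, unfolded persistent_def, THEN bspec, OF B, THEN spec, of m]
    obtain B' where B': "B' \<in> nb m B"
      and sb: "\<forall>t. \<forall>A\<in>Einf. B' \<le> A \<longrightarrow> (\<exists>M. small F M A t \<or> bad F M A t)"
      by (rule bexE)
    have "(A, A') \<in> {(A, A'). (A, A') \<in> piece F [] \<and> (\<exists>M. small F M A [])}"
      if "A \<in> Einf" "B' \<le> A" "(A, A') \<in> E" for A A'
      using sb[rule_format, OF that(1,2), of "[]"] False that(1,3) E_piece by auto
    then show "\<exists>B'\<in>nb m B. \<exists>Q. negligible_rel Q \<and> (\<forall>A\<in>Einf. \<forall>A'\<in>Einf. B' \<le> A \<longrightarrow> B' \<le> A' \<longrightarrow>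
        (A, A') \<in> E \<longrightarrow> (A, A') \<in> Q)"
      using B' negligible_small[of F "[]"] by blast
  qed
next
  case True
  then obtain M0 C0 where C0: "C0 \<in> Einf" "bad F M0 C0 []" by blast
  define inv where "inv k s \<longleftrightarrow> fst (snd s) \<in> Einf \<and>
      (\<forall>u. length u = k \<longrightarrow> bad F (fst s) (fst (snd s)) (snd (snd s) u))"
    for k and s :: "nat \<times> (nat \<Rightarrow> nat \<Rightarrow> bool) \<times> (bool list \<Rightarrow> (nat \<times> bool) list)"
  define step where "step k s s' \<longleftrightarrow> fst (snd s') \<in> nb (fst s) (fst (snd s)) \<and>
      (\<exists>x. fst s \<le> x \<and> x < fst s' \<and> lead (fst (snd s')) x) \<and>
      (\<forall>u. length u = k \<longrightarrow> (\<forall>b. extends (snd (snd s) u) (snd (snd s') (u @ [b]))) \<and>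
        separated F (snd (snd s') (u @ [True])) (snd (snd s') (u @ [False])))"
    for k and s s' :: "nat \<times> (nat \<Rightarrow> nat \<Rightarrow> bool) \<times> (bool list \<Rightarrow> (nat \<times> bool) list)"
  have "\<exists>f. \<forall>k. inv k (f k) \<and> step k (f k) (f (Suc k))"
  proof (rule dependent_nat_choice)
    show "\<exists>s. inv 0 s"
      using C0 by (intro exI[of _ "(M0, C0, \<lambda>u. [])"]) (simp add: inv_def)
    fix s k assume "inv k s"
    moreover obtain M C \<tau> where s: "s = (M, C, \<tau>)"
      by (cases s)
    ultimately have C: "C \<in> Einf" and bad: "\<And>u. length u = k \<Longrightarrow> bad F M C (\<tau> u)"
      by (auto simp: inv_def)
    from bad_step[of C k F M \<tau>, OF C bad] obtain N D \<tau>' where D: "D \<in> nb M C"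
      "(\<exists>x. M \<le> x \<and> x < N \<and> lead D x) \<and> (\<forall>v. length v = Suc k \<longrightarrow> bad F N D (\<tau>' v)) \<and>
      (\<forall>u. length u = k \<longrightarrow> (\<forall>b. extends (\<tau> u) (\<tau>' (u @ [b]))) \<and>
        separated F (\<tau>' (u @ [True])) (\<tau>' (u @ [False])))"
      by auto
    show "\<exists>s'. inv (Suc k) s' \<and> step k s s'"
      using D nbD(1)[OF D(1)] by (intro exI[of _ "(N, D, \<tau>')"]) (simp add: inv_def step_def s)
  qed
  then obtain f where f: "\<And>k. inv k (f k)" "\<And>k. step k (f k) (f (Suc k))"
    by blast
  define M where "M k = fst (f k)" for k
  define C where "C k = fst (snd (f k))" for k
  define \<tau> where "\<tau> k = snd (snd (f k))" for k
  have CE: "C k \<in> Einf" and bad: "length u = k \<Longrightarrow> bad F (M k) (C k) (\<tau> k u)" for k u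
    using f(1)[of k] by (auto simp: inv_def C_def M_def \<tau>_def)
  have CS: "C (Suc k) \<in> nb (M k) (C k)" and grow: "\<exists>x. M k \<le> x \<and> x < M (Suc k) \<and> lead (C (Suc k)) x"
    and ext: "length u = k \<Longrightarrow> extends (\<tau> k u) (\<tau> (Suc k) (u @ [b]))"
    and sep: "length u = k \<Longrightarrow> separated F (\<tau> (Suc k) (u @ [True])) (\<tau> (Suc k) (u @ [False]))" for k u b
    using f(2)[of k] by (auto simp: step_def C_def M_def \<tau>_def)
  obtain L where L: "\<And>k. L \<in> nb (M k) (C k)"
    using fusion_limit[of C M, OF CE CS grow] by blast
  have "M k < M (Suc k)" for k
    using grow[of k] by auto
  then have kM: "k \<le> M k" for k
    using strict_mono_imp_increasing[of M] by (simp add: strict_mono_Suc_iff)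
  define t where "t b k = \<tau> k (map b [0..<k])" for b :: "nat \<Rightarrow> bool" and k
  \<comment> \<open>\<open>y b\<close> is the infinite code along the branch \<open>b\<close>;
    \<open>Z b\<close> and \<open>P b\<close> are the witness and the relation it encodes.\<close>
  define y where "y b n = t b (Suc n) ! n" for b n
  define Z where "Z b n = fst (y b n)" for b n
  define P where "P b i j = snd (y b (prod_encode (i, j)))" for b i j
  have t_ext: "extends (t b k) (t b (Suc k))" for b k
    using ext[of "map b [0..<k]" k "b k"] by (simp add: t_def)
  note len = extends_chain(1)[of "t b" for b, OF t_ext]
  have t_y: "t b k ! n = y b n" if "n < length (t b k)" for b k n
    using extends_chain(2)[of "t b", OF t_ext, of k "max k (Suc n)" n]
      extends_chain(2)[of "t b", OF t_ext, of "Suc n" "max k (Suc n)" n] that len[of "Suc n" b]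
    by (simp add: y_def)
  have code_y: "code (P b) (Z b) n = y b n" for b n
    by (simp add: code_def P_def Z_def)
  have in_F: "(L, P b, Z b) \<in> F" for b
  proof -
    have "\<exists>D D' w. agree n D L \<and> agree n D' (P b) \<and> (\<forall>i<n. w i = Z b i) \<and> (D, D', w) \<in> F" for n
    proof -
      obtain l where l: "\<forall>i<n. \<forall>j<n. prod_encode (i, j) < l"
        using bounded_image2[of n "\<lambda>i j. prod_encode (i, j)"] by blast
      define k where "k = max n l"
      \<comment> \<open>A piece that is not small is nonempty. Its members approximate
        \<open>(L, P b, Z b)\<close>, which therefore lies in \<open>F\<close>.\<close>
      have "\<not> small F (M k) (C k) (t b k)"
        using bad[of "map b [0..<k]" k] nb_refl[OF CE[of k]] unfolding bad_def t_def by simp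
      then have "piece F (t b k) \<inter> nb (M k) (C k) \<times> UNIV \<noteq> {}"
        using negligible_rel_empty unfolding small_def by metis
      then obtain D D' w where D: "D \<in> nb (M k) (C k)" "(D, D', w) \<in> F"
        and w: "\<And>n. n < length (t b k) \<Longrightarrow> t b k ! n = code D' w n"
        by (auto simp: piece_def)
      have k: "n \<le> M k" "n \<le> length (t b k)" "l \<le> length (t b k)"
        using kM[of k] len[of k b] by (auto simp: k_def)
      have "agree n D L"
        using agree_mono[OF agree_trans[OF nbD(3)[OF D(1)] agree_sym[OF nbD(3)[OF L]]] k(1)] .
      moreover have "w i = Z b i" if "i < n" for i
      proof -
        have "y b i = code D' w i"
          using t_y[of i b k] w[of i] k that by simp
        then show ?thesis
          by (simp add: Z_def code_def)
      qed
      moreover have "agree n D' (P b)"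
        unfolding agree_def
      proof (intro allI impI)
        fix i j assume "i < n" "j < n"
        then have "prod_encode (i, j) < length (t b k)"
          using l k(3) by (meson less_le_trans)
        then have "y b (prod_encode (i, j)) = code D' w (prod_encode (i, j))"
          using t_y w by metis
        then show "D' i j = P b i j"
          by (simp add: P_def code_def)
      qed
      ultimately show ?thesis
        using D(2) by blast
    qed
    then show ?thesis
      using F unfolding limit_closed_def by blast
  qed
  have in_piece: "(L, P b) \<in> piece F (t b k)" for b k
    using in_F[of b] t_y[of _ b k] code_y[of b] by (auto simp: piece_def)
  have "inj P"
  proof (rule injI, rule ccontr)
    fix b b' assume eq: "P b = P b'" and ne: "b \<noteq> b'"
    define k where "k = (LEAST k. b k \<noteq> b' k)"
    have "\<exists>k. b k \<noteq> b' k"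
      using ne by auto
    then have k: "b k \<noteq> b' k"
      unfolding k_def by (rule LeastI_ex)
    have "b i = b' i" if "i < k" for i
      using not_less_Least[of i "\<lambda>k. b k \<noteq> b' k"] that by (simp add: k_def)
    then have u: "map b [0..<k] = map b' [0..<k]"
      by simp
    \<comment> \<open>At their first difference the two branches enter separated halves of one node,
      which excludes \<open>P b = P b'\<close>.\<close>
    obtain i j where ij: "\<And>A A'. (A, A') \<in> piece F (\<tau> (Suc k) (map b [0..<k] @ [True])) \<Longrightarrow> A' i j"
      "\<And>A A'. (A, A') \<in> piece F (\<tau> (Suc k) (map b [0..<k] @ [False])) \<Longrightarrow> \<not> A' i j"
      using sep[of "map b [0..<k]" k] unfolding separated_def by auto
    have "t b (Suc k) = \<tau> (Suc k) (map b [0..<k] @ [b k])"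
      by (simp add: t_def)
    moreover have "t b' (Suc k) = \<tau> (Suc k) (map b [0..<k] @ [b' k])"
      unfolding u by (simp add: t_def)
    ultimately show False
      using in_piece[of b "Suc k"] in_piece[of b' "Suc k"] ij[of L "P b"] eq k
      by (cases "b k"; cases "b' k") auto
  qed
  moreover have "range P \<subseteq> {A'. (L, A') \<in> E}"
    using in_F by (auto simp: E)
  then have "countable (range P)"
    using count[of L] by (rule countable_subset)
  ultimately have "countable (UNIV :: (nat \<Rightarrow> bool) set)"
    by (simp add: countable_image_inj_eq)
  then show ?thesis
    using uncountable_nat_bool by simp
qed

lemma kills_equiv:
  assumes E: "equiv Einf E" and kills: "kills E B"
    and A: "A \<in> Einf" "B \<le> A" and A': "A' \<in> Einf" "B \<le> A'"
  shows "(A, A') \<in> E \<longleftrightarrow> A = A'"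
proof
  assume *: "(A, A') \<in> E"
  then have "(A', A) \<in> E"
    using E by (meson equiv_def symE)
  then show "A = A'"
    using * kills A A' unfolding kills_def by (blast intro: antisym)
next
  assume "A = A'"
  then show "(A, A') \<in> E"
    using E A(1) by (auto simp: equiv_def refl_on_def)
qed

lemma persistent_kills:
  assumes "countable_borel_equiv Einf E"
  shows "persistent (kills E)"
proof -
  have E: "equiv Einf E" "E \<in> sets (restrict_space borel (Einf \<times> Einf))" "\<And>C. C \<in> Einf // E \<Longrightarrow> countable C"
    using assms by (auto simp: countable_borel_equiv_def)
  from E(2) obtain S where S: "S \<in> sets borel" "E = (Einf \<times> Einf) \<inter> S"
    by (auto simp: sets_restrict_space)
  then have "analytic_rel E"
    using analytic_rel_Int[OF analytic_Einf analytic_rel_borel] by simp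
  then obtain F where "limit_closed F" "E = {(A, A'). \<exists>z. (A, A', z) \<in> F}"
    unfolding analytic_rel_def by blast
  moreover have "countable {A'. (A, A') \<in> E}" for A
  proof (cases "A \<in> Einf")
    case True
    then have "E `` {A} \<in> Einf // E"
      by (rule quotientI)
    then show ?thesis
      using E(3)[of "E `` {A}"] by (simp add: Image_singleton)
  next
    case False
    then have "{A'. (A, A') \<in> E} = {}"
      using S(2) by auto
    then show ?thesis by simp
  qed
  ultimately have "negligible_rel E"
    by (rule countable_sections_negligible)
  then show ?thesis
    by (simp add: negligible_rel_def)
qed

section \<open>Reductions to and from equality on the Cantor space\<close>

lemma Einf_nonempty: "(=) \<in> Einf"
  using kernel_in_Einf[of "\<lambda>x. x"] by (auto simp: fun_eq_iff)

lemma continuous_on_coord_pred: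
  fixes P :: "bool \<Rightarrow> bool \<Rightarrow> bool"
  shows "continuous_on UNIV (\<lambda>x :: 'a \<Rightarrow> bool. P (x p) (x q))"
proof -
  have "closed ((\<lambda>x :: 'a \<Rightarrow> bool. P (x p) (x q)) -` S)" for S
    using closed_coord_pred[of "\<lambda>a b c. P a b \<in> S" p q q] by (simp add: vimage_def)
  then show ?thesis
    by (subst continuous_on_closed_vimage) auto
qed

text \<open>Classes of \<open>B\<close> with even index stay apart, so infinitely many remain; class
  \<open>2 * n + 1\<close> joins class \<open>0\<close> exactly when \<open>x n\<close> holds, so
  \<open>x\<close> can be recovered. On coarsenings of \<open>B\<close> the relation
  \<open>E\<close> is equality, and the map is continuous.\<close>

lemma cantor_reducible:
  assumes E: "equiv Einf E" and B: "B \<in> Einf" "kills E B"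
  shows "borel_reducible (UNIV :: (nat \<Rightarrow> bool) set) Id Einf E"
proof -
  define e where "e = enumerate {x. lead B x}"
  have inf: "infinite {x. lead B x}"
    using Einf_lead[OF B(1)] by (auto simp: infinite_nat_iff_unbounded_le)
  have sm: "strict_mono e"
    unfolding e_def using inf by (rule strict_mono_enumerate)
  have range_e: "range e = {x. lead B x}"
    unfolding e_def using inf by (rule range_enumerate)
  have e_lead: "lead B (e n)" for n
    using range_e by blast
  have inv_e [simp]: "inv e (e n) = n" for n
    using strict_mono_imp_inj_on[OF sm] by simp
  have leader_e: "leader B (e n) = e n" for n
    using e_lead[of n] equivp_leader(5)[OF Einf_equivp[OF B(1)]] by simp
  define r where "r x z = (if odd (inv e z) \<and> x (inv e z div 2) then e 0 else z)" for x z
  define f where "f x = (\<lambda>i j. r x (leader B i) = r x (leader B j))" for x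
  have f: "f x \<in> nb 0 B" for x
    unfolding f_def
  proof (rule quotient_in_nb[OF B(1)])
    show "r x z \<le> z" if z: "lead B z" for z
    proof -
      have "z \<in> range e"
        using z range_e by simp
      then obtain n where "z = e n"
        by blast
      then show ?thesis
        using strict_mono_less_eq[OF sm, of 0 n] by (simp add: r_def)
    qed
    show "\<exists>y\<ge>n. lead B y \<and> r x y = y" for n
      using strict_mono_imp_increasing[OF sm, of "2 * n"] e_lead
      by (intro exI[of _ "e (2 * n)"]) (simp add: r_def)
  qed auto
  have f_e: "f x (e (2 * n + 1)) (e 0) \<longleftrightarrow> x n" for x n
    using strict_mono_eq[OF sm, of "2 * n + 1" 0] by (simp add: f_def leader_e r_def)
  have inj: "f x = f x' \<longleftrightarrow> x = x'" for x x'
  proof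
    assume "f x = f x'"
    then have "x n = x' n" for n
      using f_e[of x n] f_e[of x' n] by simp
    then show "x = x'" by blast
  qed simp
  have "continuous_on UNIV f"
  proof (intro continuous_on_coordinatewise_then_product)
    fix i j
    let ?p = "inv e (leader B i)" and ?q = "inv e (leader B j)"
    show "continuous_on UNIV (\<lambda>x. f x i j)"
      unfolding f_def r_def
      by (rule continuous_on_coord_pred[of "\<lambda>a b. (if odd ?p \<and> a then e 0 else leader B i) =
        (if odd ?q \<and> b then e 0 else leader B j)" "?p div 2" "?q div 2"])
  qed
  then have "f \<in> borel_measurable borel"
    by (rule borel_measurable_continuous_onI)
  then have "f \<in> restrict_space borel UNIV \<rightarrow>\<^sub>M restrict_space borel Einf"
    using nbD(1)[OF f] by (intro measurable_restrict_space2 measurable_restrict_space1) auto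
  moreover have "(x, x') \<in> Id \<longleftrightarrow> (f x, f x') \<in> E" for x x'
    using kills_equiv[OF E B(2) nbD(1,2)[OF f] nbD(1,2)[OF f]] inj by simp
  ultimately show ?thesis
    unfolding borel_reducible_def by blast
qed

theorem theorem1p2:
  fixes E :: "(nat \<Rightarrow> nat \<Rightarrow> bool) rel"
  assumes "countable_borel_equiv Einf E"
  shows "(\<exists>D. Ramsey_conull D \<and>
            (\<forall>B \<in> D. \<forall>A \<in> Einf. \<forall>A' \<in> Einf. coarsens A B \<longrightarrow> coarsens A' B \<longrightarrow>
               ((A, A') \<in> E \<longleftrightarrow> A = A')))
       \<and> canonizes Einf Ramsey_ideal E (UNIV :: (nat \<Rightarrow> bool) set) Id"
proof
  have E: "equiv Einf E"
    using assms by (simp add: countable_borel_equiv_def)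
  note pers = persistent_kills[OF assms]
  have kills: "\<exists>B'\<in>nb m B. kills E B'" if "B \<in> Einf" for B m
    using pers that by (simp add: persistent_def)
  show "\<exists>D. Ramsey_conull D \<and> (\<forall>B \<in> D. \<forall>A \<in> Einf. \<forall>A' \<in> Einf. coarsens A B \<longrightarrow> coarsens A' B \<longrightarrow>
               ((A, A') \<in> E \<longleftrightarrow> A = A'))"
  proof (intro exI conjI ballI impI)
    let ?D = "{B \<in> Einf. kills E B}"
    have "\<exists>B'\<in>nb m B. \<forall>A\<in>Einf. B' \<le> A \<longrightarrow> A \<notin> Einf - ?D" if "B \<in> Einf" for B m
      using kills[OF that, of m] kills_antimono by blast
    then show "Ramsey_conull ?D"
      by (auto simp: Ramsey_conull_def Ramsey_ideal_iff persistent_def)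
    fix B A A' assume "B \<in> ?D" "A \<in> Einf" "A' \<in> Einf" "coarsens A B" "coarsens A' B"
    then show "(A, A') \<in> E \<longleftrightarrow> A = A'"
      using kills_equiv[OF E, of B A A'] by (simp add: coarsens_iff)
  qed
  show "canonizes Einf Ramsey_ideal E (UNIV :: (nat \<Rightarrow> bool) set) Id"
    unfolding canonizes_def
  proof (intro conjI ballI impI)
    show "sigma_ideal_on Einf Ramsey_ideal" "equiv Einf E"
      by (fact sigma_ideal_Ramsey_ideal E)+
    show "equiv (UNIV :: (nat \<Rightarrow> bool) set) Id"
      by (auto simp: equiv_def refl_on_def sym_def trans_def)
    obtain B0 where "B0 \<in> nb 0 (=)" "kills E B0"
      using kills[OF Einf_nonempty] by blast
    then show "borel_reducible (UNIV :: (nat \<Rightarrow> bool) set) Id Einf E"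
      using cantor_reducible[OF E] nbD(1) by blast
    fix \<B> assume \<B>: "\<B> \<in> sets (restrict_space borel Einf)" "\<B> \<notin> Ramsey_ideal"
    obtain S where S: "S \<in> sets borel" "\<B> = Einf \<inter> S"
      using \<B>(1) by (auto simp: sets_restrict_space)
    then have "\<not> (\<forall>B\<in>Einf. \<forall>m. \<exists>B'\<in>basic_nbhd m B. basic_nbhd m B' \<inter> \<B> = {})"
      using \<B>(2) unfolding Ramsey_ideal_def by blast
    then obtain B m where B: "B \<in> Einf"
      and "\<And>B'. B' \<in> basic_nbhd m B \<Longrightarrow> basic_nbhd m B' \<inter> \<B> \<noteq> {}"
      by blast
    then have hit: "nb m B' \<inter> \<B> \<noteq> {}" if "B' \<in> nb m B" for B'
      using basic_nbhd_eq[OF B] basic_nbhd_eq[OF nbD(1)[OF that]] that by metis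
    obtain B1 where B1: "B1 \<in> nb m B" "kills E B1"
      using kills[OF B] by blast
    \<comment> \<open>\<open>\<C>\<close> stays outside the ideal because \<open>B1\<close> lies in
      \<open>nb m B\<close>: every shrinking of \<open>B1\<close> at height \<open>m\<close> is one
      of \<open>B\<close>, so its neighbourhood still meets \<open>\<B>\<close>.\<close>
    define \<C> where "\<C> = \<B> \<inter> {A. B1 \<le> A}"
    have "closed {A. B1 \<le> A}"
    proof -
      have "closed {A :: nat \<Rightarrow> nat \<Rightarrow> bool. B1 i j \<longrightarrow> A i j}" for i j
      proof -
        have "continuous_on UNIV (\<lambda>A :: nat \<Rightarrow> nat \<Rightarrow> bool. A i j)"
          by (rule continuous_on_product_then_coordinatewise[OF continuous_on_product_coordinates])
        then have "closed ((\<lambda>A :: nat \<Rightarrow> nat \<Rightarrow> bool. A i j) -` {b. B1 i j \<longrightarrow> b})"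
          by (intro closed_vimage finite_imp_closed) auto
        then show ?thesis
          by (simp add: vimage_def)
      qed
      then have "closed (\<Inter>i. \<Inter>j. {A :: nat \<Rightarrow> nat \<Rightarrow> bool. B1 i j \<longrightarrow> A i j})"
        by (intro closed_INT ballI)
      moreover have "{A. B1 \<le> A} = (\<Inter>i. \<Inter>j. {A. B1 i j \<longrightarrow> A i j})"
        by (auto simp: le_fun_def)
      ultimately show ?thesis by simp
    qed
    then have "S \<inter> {A. B1 \<le> A} \<in> sets borel"
      using S(1) by auto
    moreover have "\<C> = Einf \<inter> (S \<inter> {A. B1 \<le> A})"
      by (auto simp: \<C>_def S(2))
    ultimately have "\<C> \<in> sets (restrict_space borel Einf)"
      by (auto simp: sets_restrict_space)
    moreover have "\<C> \<notin> Ramsey_ideal"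
    proof
      assume "\<C> \<in> Ramsey_ideal"
      then obtain B2 where B2: "B2 \<in> nb m B1" "\<And>A. A \<in> Einf \<Longrightarrow> B2 \<le> A \<Longrightarrow> A \<notin> \<C>"
        using nbD(1)[OF B1(1)] unfolding Ramsey_ideal_iff persistent_def by blast
      obtain A where A: "A \<in> nb m B2" "A \<in> \<B>"
        using hit[OF nb_trans[OF B2(1) B1(1) order_refl]] by blast
      have "B1 \<le> A"
        using nbD(2)[OF B2(1)] nbD(2)[OF A(1)] by (rule order_trans)
      then show False
        using A B2(2)[OF nbD(1,2)[OF A(1)]] by (simp add: \<C>_def)
    qed
    moreover have "borel_reducible \<C> (E \<inter> \<C> \<times> \<C>) (UNIV :: (nat \<Rightarrow> bool) set) Id"
    proof -
      \<comment> \<open>On \<open>\<C>\<close> the relation \<open>E\<close> is equality, so a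
        continuous injection into the Cantor space reduces it; the pairing function lists the
        entries of the matrix.\<close>
      define f where "f A n = A (fst (prod_decode n)) (snd (prod_decode n))" for A :: "nat \<Rightarrow> nat \<Rightarrow> bool" and n
      have "f A = f A' \<longleftrightarrow> A = A'" for A A'
      proof
        assume eq: "f A = f A'"
        have "A i j = A' i j" for i j
          using fun_cong[OF eq, of "prod_encode (i, j)"] by (simp add: f_def)
        then show "A = A'" by blast
      qed simp
      moreover have "(A, A') \<in> E \<longleftrightarrow> A = A'" if "A \<in> \<C>" "A' \<in> \<C>" for A A'
        using kills_equiv[OF E B1(2), of A A'] that by (auto simp: \<C>_def S(2))
      moreover have "continuous_on UNIV f"
        unfolding f_def
        by (intro continuous_on_coordinatewise_then_product
            continuous_on_product_then_coordinatewise[OF continuous_on_product_coordinates])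
      then have "f \<in> restrict_space borel \<C> \<rightarrow>\<^sub>M restrict_space borel UNIV"
        by (intro measurable_restrict_space2 measurable_restrict_space1 borel_measurable_continuous_onI) auto
      ultimately show ?thesis
        unfolding borel_reducible_def by (intro bexI[of _ f]) auto
    qed
    ultimately show "\<exists>C\<in>sets (restrict_space borel Einf). C \<subseteq> \<B> \<and> C \<notin> Ramsey_ideal \<and>
        borel_reducible C (E \<inter> C \<times> C) (UNIV :: (nat \<Rightarrow> bool) set) Id"
      by (intro bexI[of _ \<C>]) (auto simp: \<C>_def)
  qed
qed

end
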